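(* Let $m\in\mathbb{Z}$ and $\alpha\in\{0,1,2,3\}$. If $m\equiv\alpha+1\pmod2$, then the polynomial $D(0,m,\alpha;p)$ divides the polynomial $C(0,m,\alpha;p)$ in $\mathbb{Q}[p]$. If $1+m\equiv\alpha+1\pmod 2$, then $D(1,m,\alpha;p)$ divides $C(1,m,\alpha;p)$ in $\mathbb{Q}[p]$.
   Context: The Aztec diamond of size $n\ge1$ is the union of all unit squares $[i,i+1]\times[j,j+1]$ ($i,j\in\mathbb{Z}$) contained in $\{(x,y): |x|+|y|\le n+1\}$. Its squares are coloured black and white like a chessboard so that the left one of the two topmost squares is black. $\mathbb{P}(l,m;n)$ denotes the probability that a uniformly random domino tiling of the Aztec diamond of size $n$ contains the horizontal domino $[l-1,l+1]\times[m,m+1]$ and that the left square $[l-1,l]\times[m,m+1]$ of this domino is black. For $l,m\in\mathbb{Z}$ and $\alpha\in\{0,1,2,3\}$ with $l+m\equiv\alpha+1\pmod2$, there is a unique rational function $f_{l,m,\alpha}\in\mathbb{Q}(p)$ with $\mathbb{P}(l,m;4p+\alpha)=\frac14+2^{-4p-\alpha}\binom{2p-1}{p}^2f_{l,m,\alpha}(p)$ for all sufficiently large integers $p$. Write $f_{l,m,\alpha}=Z(l,m,\alpha;p)/D(l,m,\alpha;p)$ in lowest terms, so $D(l,m,\alpha;p)$ is the denominator of minimal degree (unique up to a nonzero constant). For an integer $z$ put $z\,\mathrm{div}\,2:=\max(\lfloor z/2\rfloor,0)$. For integers $x$ put $r(x)=x\,\mathrm{div}\,2$ if $x>0$ and $r(x)=(|x|+\alpha-1)\,\mathrm{div}\,2$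 if $x\le0$; $s(x)=(x-\alpha+1)\,\mathrm{div}\,2$ if $x\ge0$ and $s(x)=|x|\,\mathrm{div}\,2$ if $x<0$. For nonnegative integers, $N(u,v,U,V;p):=\prod_{i=1}^{u}(i+p)^{\alpha_i}\prod_{j=1}^{v}(-2j+1+2p)^{\beta_j}$, where $\alpha_i=2$ if $i\le U$ and $1$ otherwise, $\beta_j=2$ if $j\le V$ and $1$ otherwise. With $a=(l+m+\alpha-1)/2$ and $b=(l-m+\alpha-1)/2$ define $$C(l,m,\alpha;p):=N\big(\max[r(a),r(b)],\max[s(a),s(b)],\min[r(a),r(b)],\min[s(a),s(b)];p\big).$$ *)

theory Defs
  imports
    "HOL-Probability.Probability"
    "HOL-Computational_Algebra.Computational_Algebra"
    "HOL-Computational_Algebra.Field_as_Ring"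
    "HOL-Number_Theory.Cong"
begin

text \<open>The unit square $[i,i+1] \times [j,j+1]$ is encoded by its lower left corner $(i,j)$.\<close>

definition unit_square :: "int \<times> int \<Rightarrow> (real \<times> real) set" where
  "unit_square c = {of_int (fst c)..of_int (fst c + 1)} \<times> {of_int (snd c)..of_int (snd c + 1)}"

definition aztec_diamond :: "nat \<Rightarrow> (int \<times> int) set" where
  "aztec_diamond n = {c. unit_square c \<subseteq> {(x, y). \<bar>x\<bar> + \<bar>y\<bar> \<le> real n + 1}}"

text \<open>The two topmost squares of the diamond of size \<open>n\<close> are \<open>(-1, n - 1)\<close> and \<open>(0, n - 1)\<close>;
  the colour of a square is determined by the parity of its distance to the first of them.\<close>

definition black_square :: "nat \<Rightarrow> int \<times> int \<Rightarrow> bool" where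
  "black_square n c \<longleftrightarrow> even ((fst c - (-1)) + (snd c - (int n - 1)))"

definition is_domino :: "(int \<times> int) set \<Rightarrow> bool" where
  "is_domino d \<longleftrightarrow> (\<exists>i j. d = {(i, j), (i + 1, j)} \<or> d = {(i, j), (i, j + 1)})"

definition domino_tilings :: "(int \<times> int) set \<Rightarrow> (int \<times> int) set set set" where
  "domino_tilings R = {T. partition_on R T \<and> (\<forall>d\<in>T. is_domino d)}"

definition aztec_prob :: "int \<Rightarrow> int \<Rightarrow> nat \<Rightarrow> real" where
  "aztec_prob l m n =
     measure_pmf.prob (pmf_of_set (domino_tilings (aztec_diamond n)))
       {T. {(l - 1, m), (l, m)} \<in> T \<and> black_square n (l - 1, m)}"

definition eval_ratfun :: "rat poly fract \<Rightarrow> rat \<Rightarrow> rat" where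
  "eval_ratfun f x = poly (fst (quot_of_fract f)) x / poly (snd (quot_of_fract f)) x"

text \<open>At most one \<open>f\<close> satisfies the description, as two rational functions that agree at all large
  integers are equal. The truncated subtraction in \<open>2 * p - 1\<close> only matters at \<open>p = 0\<close>.\<close>

definition aztec_ratfun :: "int \<Rightarrow> int \<Rightarrow> nat \<Rightarrow> rat poly fract" where
  "aztec_ratfun l m \<alpha> = (THE f. \<forall>\<^sub>F p in sequentially.
     aztec_prob l m (4 * p + \<alpha>) =
       1 / 4 + 1 / 2 ^ (4 * p + \<alpha>) * (real ((2 * p - 1) choose p))\<^sup>2
         * of_rat (eval_ratfun f (of_nat p)))"

text \<open>\<^const>\<open>quot_of_fract\<close> yields a coprime pair with monic denominator.\<close>

definition aztec_denominator :: "int \<Rightarrow> int \<Rightarrow> nat \<Rightarrow> rat poly" where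
  "aztec_denominator l m \<alpha> = snd (quot_of_fract (aztec_ratfun l m \<alpha>))"

text \<open>Truncation by \<^const>\<open>nat\<close> makes this $\max(\lfloor z/2\rfloor, 0)$.\<close>

definition div2 :: "int \<Rightarrow> nat" where
  "div2 z = nat (z div 2)"

definition r_index :: "nat \<Rightarrow> int \<Rightarrow> nat" where
  "r_index \<alpha> x = (if x > 0 then div2 x else div2 (\<bar>x\<bar> + int \<alpha> - 1))"

definition s_index :: "nat \<Rightarrow> int \<Rightarrow> nat" where
  "s_index \<alpha> x = (if x \<ge> 0 then div2 (x - int \<alpha> + 1) else div2 \<bar>x\<bar>)"

definition N_poly :: "nat \<Rightarrow> nat \<Rightarrow> nat \<Rightarrow> nat \<Rightarrow> rat poly" where
  "N_poly u v U V =
     (\<Prod>i=1..u. [:of_nat i, 1:] ^ (if i \<le> U then 2 else 1)) *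
     (\<Prod>j=1..v. [:1 - 2 * of_nat j, 2:] ^ (if j \<le> V then 2 else 1))"

text \<open>The divisions by 2 are exact when \<open>l + m\<close> and \<open>\<alpha> + 1\<close> have the same parity.\<close>

definition C_poly :: "int \<Rightarrow> int \<Rightarrow> nat \<Rightarrow> rat poly" where
  "C_poly l m \<alpha> =
     (let a = (l + m + int \<alpha> - 1) div 2; b = (l - m + int \<alpha> - 1) div 2
      in N_poly (max (r_index \<alpha> a) (r_index \<alpha> b)) (max (s_index \<alpha> a) (s_index \<alpha> b))
           (min (r_index \<alpha> a) (r_index \<alpha> b)) (min (s_index \<alpha> a) (s_index \<alpha> b)))"

end

theory Submission
  imports Defs
begin

text \<open>
  The point is to compute the placement probabilities on the lines \<open>l = 0\<close> and \<open>l = 1\<close> in closed form.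

  Call the 2 by 2 square centred at a lattice point a block. Every domino in the diamond of size \<open>n\<close> is
  an edge of exactly one block with centre \<open>(x, y)\<close>, \<open>|x| + |y| < n\<close>, \<open>x + y + n\<close> odd. So a tiling is a
  choice, for every block, of the cells that the block covers with its own edges, together with one of two
  pairings for each block that covers all its four cells. Exchanging covered and uncovered cells in every
  block turns such patterns of size \<open>n\<close> into patterns of size \<open>n - 1\<close>, and it multiplies the number of
  tilings with a given pattern by a factor that does not depend on the pattern. This is domino shuffling.
  In linear form (\<open>shuffling_step\<close>) it says that the probability of an edge in size \<open>n\<close> minus the
  probability of the opposite edge of the same block in size \<open>n - 1\<close> is the same number \<open>c / 2\<close> for all four
  edges of the block, and that the probabilities of the four edges add up to \<open>1 + c\<close>. Eliminating the
  probabilities leaves a recurrence for the net creation rates \<open>c\<close> (\<open>net_creation_recurrence\<close>). It is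
  solved by \<open>2\<close> to the power \<open>1 - n\<close> times a product of two Krawtchouk coefficients
  \<open>[z^A] (1 + z)^(n - 1 - B) (1 - z)^B\<close> (\<open>net_creation_eq\<close>).

  A placement probability is half the sum of the net creation rates along a lattice line. On the lines
  \<open>l = 0\<close> and \<open>l = 1\<close> the sums telescope: the difference of the probabilities at neighbouring points is
  \<open>2\<close> to the power \<open>- n\<close> times a product or a sum of squares of two Krawtchouk coefficients
  (\<open>north_step_up\<close>, \<open>north_step_down\<close>, \<open>north_step_axis\<close>), and the probability at the centre is \<open>1 / 4\<close>
  plus \<open>2\<close> to the power \<open>- n - 1\<close> times such a square (\<open>north_center\<close>).

  For \<open>n = 4 p + \<alpha>\<close> and a fixed point the coefficients have the form
  \<open>[z^(2 p + i)] (1 + z)^(2 p + j) (1 - z)^(2 p - q)\<close> with fixed \<open>i\<close>, \<open>j\<close>, \<open>q\<close>. Writing the product as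
  \<open>(1 + z)^(j + q) (1 - z^2)^(2 p - q)\<close> shows that they are fixed combinations of binomial coefficients
  \<open>binomial (2 p - q) (p + t)\<close> with \<open>2 t \<le> i\<close>. The quotient by \<open>binomial (2 p - 1) p\<close> then has a denominator
  dividing the product of \<open>p + 1, ..., p + (i div 2)\<close> and of the first \<open>q div 2\<close> of \<open>2 p - 1, 2 p - 3, ...\<close>
  (\<open>ratio_by_kraw\<close>). Walking away from the centre along the two lines, the products of these bounds divide
  \<open>C\<close>, and \<open>C\<close> grows (\<open>deviation_up\<close>, \<open>deviation_down\<close>). Thus \<open>C\<close> is a denominator of the rational function
  in question, and the minimal one divides it.
\<close>

type_synonym cell = "int \<times> int"

section \<open>Dominoes and blocks\<close>

text \<open>A block is named after the lattice point at its centre.\<close>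

definition block_cells :: "cell \<Rightarrow> cell set" where
  "block_cells f = (case f of (x, y) \<Rightarrow> {(x, y), (x - 1, y), (x - 1, y - 1), (x, y - 1)})"

fun top_edge bottom_edge left_edge right_edge :: "cell \<Rightarrow> cell set" where
  "top_edge (x, y) = {(x - 1, y), (x, y)}"
| "bottom_edge (x, y) = {(x - 1, y - 1), (x, y - 1)}"
| "left_edge (x, y) = {(x - 1, y - 1), (x - 1, y)}"
| "right_edge (x, y) = {(x, y - 1), (x, y)}"

definition block_edges :: "cell \<Rightarrow> cell set set" where
  "block_edges f = {top_edge f, bottom_edge f, left_edge f, right_edge f}"

definition block_matchings :: "cell \<Rightarrow> cell set set set" where
  "block_matchings f = {Mt. Mt \<subseteq> block_edges f \<and> disjoint Mt}"

lemma edge_distinct: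
  "top_edge f \<noteq> bottom_edge f" "top_edge f \<noteq> left_edge f" "top_edge f \<noteq> right_edge f"
  "bottom_edge f \<noteq> left_edge f" "bottom_edge f \<noteq> right_edge f" "left_edge f \<noteq> right_edge f"
  by (cases f; simp add: doubleton_eq_iff)+

lemma edge_disjoint:
  "top_edge f \<inter> bottom_edge f = {}" "left_edge f \<inter> right_edge f = {}"
  "top_edge f \<inter> left_edge f \<noteq> {}" "top_edge f \<inter> right_edge f \<noteq> {}"
  "bottom_edge f \<inter> left_edge f \<noteq> {}" "bottom_edge f \<inter> right_edge f \<noteq> {}"
  by (cases f; simp)+

lemma block_matchings_eq:
  "block_matchings f = {{}, {top_edge f}, {bottom_edge f}, {left_edge f}, {right_edge f},
     {top_edge f, bottom_edge f}, {left_edge f, right_edge f}}" (is "_ = ?R")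
proof
  show "?R \<subseteq> block_matchings f"
    using edge_disjoint[of f] by (auto simp: block_matchings_def block_edges_def disjoint_def)
  show "block_matchings f \<subseteq> ?R"
  proof
    fix Mt assume "Mt \<in> block_matchings f"
    then have sub: "Mt \<subseteq> block_edges f" and dis: "disjoint Mt"
      by (auto simp: block_matchings_def)
    have no: "\<not> (d \<in> Mt \<and> e \<in> Mt)" if "d \<inter> e \<noteq> {}" "d \<noteq> e" for d e
      using dis that by (auto simp: disjoint_def)
    have neg: "\<not> (top_edge f \<in> Mt \<and> left_edge f \<in> Mt)" "\<not> (top_edge f \<in> Mt \<and> right_edge f \<in> Mt)"
      "\<not> (bottom_edge f \<in> Mt \<and> left_edge f \<in> Mt)" "\<not> (bottom_edge f \<in> Mt \<and> right_edge f \<in> Mt)"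
      using no edge_disjoint[of f] edge_distinct[of f] by metis+
    have sub2: "Mt = {} \<or> Mt = {a} \<or> Mt = {b} \<or> Mt = {a, b}" if "Mt \<subseteq> {a, b}" for a b
      using that by blast
    from neg consider "top_edge f \<notin> Mt" "bottom_edge f \<notin> Mt" | "left_edge f \<notin> Mt" "right_edge f \<notin> Mt"
      by blast
    then show "Mt \<in> ?R"
    proof cases
      case 1
      with sub have "Mt \<subseteq> {left_edge f, right_edge f}" unfolding block_edges_def by blast
      from sub2[OF this] show ?thesis by (elim disjE) simp_all
    next
      case 2
      with sub have "Mt \<subseteq> {top_edge f, bottom_edge f}" unfolding block_edges_def by blast
      from sub2[OF this] show ?thesis by (elim disjE) simp_all
    qed
  qed
qed

text \<open>The predicate \<open>\<Phi>\<close> is used to ask for one particular edge.\<close>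

definition local_count :: "cell \<Rightarrow> (cell set set \<Rightarrow> bool) \<Rightarrow> cell set \<Rightarrow> nat" where
  "local_count f \<Phi> S = card {Mt \<in> block_matchings f. \<Union>Mt = S \<and> \<Phi> Mt}"

lemma finite_block_matchings [simp]: "finite (block_matchings f)"
  by (simp add: block_matchings_eq)

lemma local_count_eq:
  "local_count f \<Phi> S =
     of_bool ({} = S \<and> \<Phi> {}) + of_bool (top_edge f = S \<and> \<Phi> {top_edge f})
     + of_bool (bottom_edge f = S \<and> \<Phi> {bottom_edge f})
     + of_bool (left_edge f = S \<and> \<Phi> {left_edge f}) + of_bool (right_edge f = S \<and> \<Phi> {right_edge f})
     + of_bool (block_cells f = S \<and> \<Phi> {top_edge f, bottom_edge f})
     + of_bool (block_cells f = S \<and> \<Phi> {left_edge f, right_edge f})"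
proof -
  have Q: "top_edge f \<union> bottom_edge f = block_cells f" "left_edge f \<union> right_edge f = block_cells f"
    by (cases f; auto simp: block_cells_def)+
  have sum7: "sum g {{}, {a}, {b}, {c}, {d}, {a, b}, {c, d}} =
      g {} + g {a} + g {b} + g {c} + g {d} + g {a, b} + g {c, d}"
    if "a \<noteq> b" "a \<noteq> c" "a \<noteq> d" "b \<noteq> c" "b \<noteq> d" "c \<noteq> d"
    for g :: "cell set set \<Rightarrow> nat" and a b c d
    using that by (simp add: doubleton_eq_iff)
  have "local_count f \<Phi> S = (\<Sum>Mt\<in>block_matchings f. of_bool (\<Union>Mt = S \<and> \<Phi> Mt))"
    unfolding local_count_def by (simp add: Collect_conj_eq Int_assoc)
  then show ?thesis
    unfolding block_matchings_eq sum7[OF edge_distinct] by (simp only: Q Union_insert Union_empty Un_empty_right)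
qed

text \<open>The ownership patterns: \<open>Ow f\<close> is the set of cells of the block
  \<open>f\<close> that are covered by edges of \<open>f\<close>. Each cell of the region belongs
  to the set of exactly one block, and no other cell belongs to any. Stating this with
  cardinalities makes the passage to complements a subtraction.\<close>

definition local_configs :: "cell set \<Rightarrow> cell set \<Rightarrow> (cell \<Rightarrow> cell set) set" where
  "local_configs F R = {Ow \<in> PiE F (\<lambda>f. Pow (block_cells f)).
     \<forall>v. card {f \<in> F. v \<in> Ow f} = of_bool (v \<in> R)}"

lemma local_configs_card:
  "Ow \<in> local_configs F R \<Longrightarrow> card {f \<in> F. v \<in> Ow f} = of_bool (v \<in> R)"
  unfolding local_configs_def by (drule CollectD) (elim conjE allE)

lemma block_edge_subset: "d \<in> block_edges f \<Longrightarrow> d \<subseteq> block_cells f"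
  by (cases f; auto simp: block_edges_def block_cells_def)

lemma is_domino_block_edges: "d \<in> block_edges f \<Longrightarrow> is_domino d"
proof -
  obtain x y where f: "f = (x, y)" by (cases f)
  have "is_domino {(i, j), (i + 1, j)}" "is_domino {(i, j), (i, j + 1)}" for i j
    unfolding is_domino_def by blast+
  from this[of "x-1" "y"] this[of "x-1" "y-1"] this[of "x" "y-1"]
  show "d \<in> block_edges f \<Longrightarrow> is_domino d"
    by (auto simp: f block_edges_def)
qed

lemma block_edges_nonempty: "d \<in> block_edges f \<Longrightarrow> d \<noteq> {}"
  by (cases f; auto simp: block_edges_def)

lemma finite_block_cells [simp]: "finite (block_cells f)"
  by (cases f; simp add: block_cells_def)

text \<open>Once the ownership pattern is fixed, the blocks can be filled independently of each
  other. Cutting a tiling into its parts in the single blocks is a bijection to the families of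
  local fillings whose pattern is admissible, because each domino of the region is an edge of
  exactly one block.\<close>

lemma card_tilings_local:
  fixes F R :: "cell set"
  assumes fin: "finite F"
    and disj: "\<And>f g. f \<in> F \<Longrightarrow> g \<in> F \<Longrightarrow> f \<noteq> g \<Longrightarrow> block_edges f \<inter> block_edges g = {}"
    and cover: "\<And>d. is_domino d \<Longrightarrow> d \<subseteq> R \<Longrightarrow> \<exists>f\<in>F. d \<in> block_edges f"
  shows "card {T \<in> domino_tilings R. \<forall>f\<in>F. \<Phi> f (T \<inter> block_edges f)} =
    (\<Sum>Ow\<in>local_configs F R. \<Prod>f\<in>F. local_count f (\<Phi> f) (Ow f))"
proof -
  define L where "L Ow f = {Mt \<in> block_matchings f. \<Union>Mt = Ow f \<and> \<Phi> f Mt}" for Ow f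
  let ?LHS = "{T \<in> domino_tilings R. \<forall>f\<in>F. \<Phi> f (T \<inter> block_edges f)}"
  define split where "split T = (\<lambda>f\<in>F. T \<inter> block_edges f)" for T :: "cell set set"
  \<comment> \<open>The inverse glues the local fillings together.\<close>
  have bij: "bij_betw split ?LHS (\<Union>Ow\<in>local_configs F R. PiE F (L Ow))"
  proof (rule bij_betw_byWitness[where f' = "\<lambda>\<tau>. \<Union>f\<in>F. \<tau> f"])
    have T_eq: "(\<Union>f\<in>F. T \<inter> block_edges f) = T" if "T \<in> ?LHS" for T
    proof -
      have "\<exists>f\<in>F. d \<in> block_edges f" if "d \<in> T" for d
        using \<open>T \<in> ?LHS\<close> that
        by (intro cover) (auto simp: domino_tilings_def partition_on_def)
      then show ?thesis by blast
    qed
    then show "\<forall>T\<in>?LHS. (\<Union>f\<in>F. split T f) = T"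
      by (auto simp: split_def)
    have part: "(\<Union>f\<in>F. \<tau> f) \<inter> block_edges g = \<tau> g"
      if "\<tau> \<in> (\<Union>Ow\<in>local_configs F R. PiE F (L Ow))" "g \<in> F" for \<tau> g
    proof -
      have "\<tau> f \<subseteq> block_edges f" if "f \<in> F" for f
        using \<open>\<tau> \<in> _\<close> that by (auto simp: L_def block_matchings_def PiE_iff)
      with disj \<open>g \<in> F\<close> show ?thesis by blast
    qed
    show "\<forall>\<tau>\<in>\<Union>Ow\<in>local_configs F R. PiE F (L Ow). split (\<Union>f\<in>F. \<tau> f) = \<tau>"
    proof (rule ballI)
      fix \<tau> assume \<tau>: "\<tau> \<in> (\<Union>Ow\<in>local_configs F R. PiE F (L Ow))"
      then obtain Ow where "\<tau> \<in> PiE F (L Ow)" by blast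
      then have undef: "\<tau> g = undefined" if "g \<notin> F" for g
        using that by (rule PiE_arb)
      show "split (\<Union>f\<in>F. \<tau> f) = \<tau>"
      proof
        fix g show "split (\<Union>f\<in>F. \<tau> f) g = \<tau> g"
          unfolding split_def using part[OF \<tau>, of g] undef[of g] by (cases "g \<in> F") auto
      qed
    qed
    show "split ` ?LHS \<subseteq> (\<Union>Ow\<in>local_configs F R. PiE F (L Ow))"
    proof (rule image_subsetI)
      fix T assume T: "T \<in> ?LHS"
      then have part: "partition_on R T" by (simp add: domino_tilings_def)
      define Ow where "Ow = (\<lambda>f\<in>F. \<Union>(T \<inter> block_edges f))"
      have "card {f \<in> F. v \<in> Ow f} = of_bool (v \<in> R)" for v
      proof (cases "v \<in> R")
        case True
        then obtain d where d: "d \<in> T" "v \<in> d" using part by (auto simp: partition_on_def)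
        then obtain f where f: "f \<in> F" "d \<in> block_edges f" using T_eq[OF T] by blast
        have "e = d" if "e \<in> T" "v \<in> e" for e
          using partition_onD2[OF part] that d by (auto simp: disjoint_def)
        have "g = f" if g: "g \<in> F" "v \<in> Ow g" for g
        proof -
          obtain e where "e \<in> T" "v \<in> e" "e \<in> block_edges g"
            using g by (auto simp: Ow_def)
          with \<open>\<And>e. e \<in> T \<Longrightarrow> v \<in> e \<Longrightarrow> e = d\<close> have "d \<in> block_edges g" by blast
          then show "g = f" using f disj[OF g(1) f(1)] by blast
        qed
        moreover have "v \<in> Ow f" using f d by (auto simp: Ow_def)
        ultimately have "{g \<in> F. v \<in> Ow g} = {f}" using f(1) by blast
        then show ?thesis using True by simp
      next
        case False
        then have "{f \<in> F. v \<in> Ow f} = {}"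
          using partition_onD1[OF part] by (auto simp: Ow_def)
        then show ?thesis using False by (simp only: card.empty) simp
      qed
      moreover have "Ow \<in> PiE F (\<lambda>f. Pow (block_cells f))"
        using block_edge_subset by (auto simp: Ow_def)
      ultimately have "Ow \<in> local_configs F R" by (simp add: local_configs_def)
      moreover have "split T \<in> PiE F (L Ow)"
      proof (rule PiE_I)
        fix f assume "f \<in> F"
        have "disjoint (T \<inter> block_edges f)"
          using partition_onD2[OF part] by (auto simp: disjoint_def)
        then show "split T f \<in> L Ow f"
          using \<open>f \<in> F\<close> T by (simp add: split_def L_def Ow_def block_matchings_def)
      qed (simp add: split_def)
      ultimately show "split T \<in> (\<Union>Ow\<in>local_configs F R. PiE F (L Ow))" by blast
    qed
    show "(\<lambda>\<tau>. \<Union>f\<in>F. \<tau> f) ` (\<Union>Ow\<in>local_configs F R. PiE F (L Ow)) \<subseteq> ?LHS"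
    proof (rule image_subsetI)
      fix \<tau> assume \<tau>: "\<tau> \<in> (\<Union>Ow\<in>local_configs F R. PiE F (L Ow))"
      then obtain Ow where Ow: "Ow \<in> local_configs F R" and \<tau>Ow: "\<tau> \<in> PiE F (L Ow)" by blast
      have \<tau>D: "\<tau> f \<subseteq> block_edges f" "disjoint (\<tau> f)" "\<Union>(\<tau> f) = Ow f" "\<Phi> f (\<tau> f)" if "f \<in> F" for f
        using \<tau>Ow that by (auto simp: L_def block_matchings_def PiE_iff)
      let ?T = "\<Union>f\<in>F. \<tau> f"
      have one: "f = g" if "f \<in> F" "g \<in> F" "v \<in> Ow f" "v \<in> Ow g" for f g v
      proof (rule ccontr)
        assume "f \<noteq> g"
        then have "card {f, g} = 2" by simp
        moreover have "card {f, g} \<le> card {f \<in> F. v \<in> Ow f}"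
          using that fin by (intro card_mono) auto
        moreover have "card {f \<in> F. v \<in> Ow f} \<le> 1"
          using local_configs_card[OF Ow] by simp
        ultimately show False by linarith
      qed
      have ex: "(\<exists>f\<in>F. v \<in> Ow f) \<longleftrightarrow> v \<in> R" for v
      proof -
        have "card {f \<in> F. v \<in> Ow f} = of_bool (v \<in> R)"
          using Ow by (rule local_configs_card)
        moreover have "card {f \<in> F. v \<in> Ow f} = 0 \<longleftrightarrow> \<not> (\<exists>f\<in>F. v \<in> Ow f)"
          using fin by auto
        ultimately show ?thesis by (cases "v \<in> R") auto
      qed
      have "\<Union>?T = R" 
      proof (intro equalityI subsetI)
        fix v assume "v \<in> \<Union>?T"
        then obtain f where "f \<in> F" "v \<in> \<Union>(\<tau> f)" by blast
        then show "v \<in> R" using \<tau>D(3) ex by metis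
      next
        fix v assume "v \<in> R"
        then obtain f where "f \<in> F" "v \<in> Ow f" using ex by blast
        then show "v \<in> \<Union>?T" using \<tau>D(3)[of f] by blast
      qed
      moreover have "disjoint ?T"
        unfolding disjoint_def
      proof (intro ballI impI)
        fix d e assume de: "d \<in> ?T" "e \<in> ?T" "d \<noteq> e"
        then obtain f g where fg: "f \<in> F" "d \<in> \<tau> f" "g \<in> F" "e \<in> \<tau> g" by blast
        show "d \<inter> e = {}"
        proof (cases "f = g")
          case True
          then show ?thesis using fg de \<tau>D(2)[of f] by (auto simp: disjoint_def)
        next
          case False
          have "d \<subseteq> Ow f" "e \<subseteq> Ow g" using fg \<tau>D(3) by blast+
          then show ?thesis using one[OF fg(1) fg(3)] False by (intro equals0I) auto
        qed
      qed
      moreover have "{} \<notin> ?T" using \<tau>D(1) block_edges_nonempty by blast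
      moreover have "\<forall>d\<in>?T. is_domino d" using \<tau>D(1) is_domino_block_edges by blast
      ultimately show "?T \<in> ?LHS"
        using part[OF \<tau>] \<tau>D(4) by (simp add: domino_tilings_def partition_on_def)
    qed
  qed
  have finL: "finite (L Ow f)" for Ow f by (simp add: L_def)
  have fin_conf: "finite (local_configs F R)"
  proof (rule finite_subset)
    show "local_configs F R \<subseteq> PiE F (\<lambda>f. Pow (block_cells f))"
      by (simp add: local_configs_def)
    show "finite (PiE F (\<lambda>f. Pow (block_cells f)))"
      using fin by (intro finite_PiE) simp_all
  qed
  have "card ?LHS = card (\<Union>Ow\<in>local_configs F R. PiE F (L Ow))"
    by (rule bij_betw_same_card[OF bij])
  also have "\<dots> = (\<Sum>Ow\<in>local_configs F R. card (PiE F (L Ow)))"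
  proof (rule card_UN_disjoint[OF fin_conf])
    show "\<forall>Ow\<in>local_configs F R. finite (PiE F (L Ow))"
      using fin finL by (auto intro: finite_PiE)
    show "\<forall>Ow\<in>local_configs F R. \<forall>Ow'\<in>local_configs F R. Ow \<noteq> Ow' \<longrightarrow> PiE F (L Ow) \<inter> PiE F (L Ow') = {}"
    proof (intro ballI impI equals0I)
      fix Ow Ow' \<tau>
      assume A: "Ow \<in> local_configs F R" "Ow' \<in> local_configs F R" "Ow \<noteq> Ow'"
        and "\<tau> \<in> PiE F (L Ow) \<inter> PiE F (L Ow')"
      then have "Ow f = Ow' f" if "f \<in> F" for f
        using that by (auto simp: PiE_iff L_def)
      moreover have "Ow \<in> PiE F (\<lambda>f. Pow (block_cells f))" "Ow' \<in> PiE F (\<lambda>f. Pow (block_cells f))"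
        using A(1,2) unfolding local_configs_def by blast+
      ultimately have "Ow = Ow'" by (intro PiE_ext)
      with A show False by simp
    qed
  qed
  also have "\<dots> = (\<Sum>Ow\<in>local_configs F R. \<Prod>f\<in>F. local_count f (\<Phi> f) (Ow f))"
    by (simp add: card_PiE fin L_def local_count_def)
  finally show ?thesis .
qed

lemma edge_not_whole:
  "top_edge f \<noteq> {}" "bottom_edge f \<noteq> {}" "left_edge f \<noteq> {}" "right_edge f \<noteq> {}" "block_cells f \<noteq> {}"
  "top_edge f \<noteq> block_cells f" "bottom_edge f \<noteq> block_cells f"
  "left_edge f \<noteq> block_cells f" "right_edge f \<noteq> block_cells f"
  by (cases f; auto simp: block_cells_def insert_eq_iff)+

lemma edge_compl:
  "block_cells f - top_edge f = bottom_edge f" "block_cells f - bottom_edge f = top_edge f"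
  "block_cells f - left_edge f = right_edge f" "block_cells f - right_edge f = left_edge f"
  by (cases f; auto simp: block_cells_def)+

lemma card_block_edge:
  "card (top_edge f) = 2" "card (bottom_edge f) = 2" "card (left_edge f) = 2" "card (right_edge f) = 2"
  "card (block_cells f) = 4"
  by (cases f; auto simp: block_cells_def)+

lemmas edge_neq = edge_distinct edge_distinct[symmetric] edge_not_whole edge_not_whole[symmetric]

text \<open>A set of cells of a block that its edges can cover is empty, one edge, or everything;
  the last case collects the sets of weight 0.\<close>

lemma block_subset_cases:
  obtains "S = {}" | "S = top_edge f" | "S = bottom_edge f" | "S = left_edge f" | "S = right_edge f"
  | "S = block_cells f"
  | "({} = S) = False" "(top_edge f = S) = False" "(bottom_edge f = S) = False" "(left_edge f = S) = False"
    "(right_edge f = S) = False" "(block_cells f = S) = False" "(S = {}) = False" "(S = block_cells f) = False"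
  by blast

lemma sqrt2_pow4: "sqrt 2 ^ 4 = (4::real)"
  by (simp add: power4_eq_xxxx)

abbreviation local_weight :: "cell \<Rightarrow> cell set \<Rightarrow> nat" where
  "local_weight f \<equiv> local_count f (\<lambda>_. True)"

text \<open>Passing to complements exchanges opposite edges, and the empty with the full
  set.\<close>

lemma compl_eq_iff:
  assumes "S \<subseteq> block_cells f"
  shows "{} = block_cells f - S \<longleftrightarrow> block_cells f = S"
    "block_cells f = block_cells f - S \<longleftrightarrow> {} = S"
    "top_edge f = block_cells f - S \<longleftrightarrow> bottom_edge f = S"
    "bottom_edge f = block_cells f - S \<longleftrightarrow> top_edge f = S"
    "left_edge f = block_cells f - S \<longleftrightarrow> right_edge f = S"
    "right_edge f = block_cells f - S \<longleftrightarrow> left_edge f = S"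
  using assms edge_compl[of f] by blast+

text \<open>The full set has two fillings and the empty one has one, the other admissible sets are
  edges and have one filling as their complements have. The power of \<open>sqrt 2\<close> records
  this asymmetry in a form that multiplies up to a constant over all blocks.\<close>

lemma local_weight_compl:
  assumes "S \<subseteq> block_cells f"
  shows "2 * real (local_weight f S) = real (local_weight f (block_cells f - S)) * sqrt 2 ^ card S"
  unfolding local_count_eq compl_eq_iff[OF assms]
  by (rule block_subset_cases[where S = S and f = f])
    (simp_all add: card_block_edge block_edges_def edge_neq sqrt2_pow4)

text \<open>The local form of the shuffling relation: the right-hand side does not depend on the
  edge \<open>d\<close>. If \<open>S\<close> is a single edge the two terms on the left cancel, so
  that only full blocks (creation) and empty blocks (destruction) contribute.\<close>

lemma local_edge_count_compl:
  assumes "S \<subseteq> block_cells f" "d \<in> block_edges f"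
  shows "2 * real (local_count f (\<lambda>Mt. d \<in> Mt) S)
      - real (local_count f (\<lambda>Mt. block_cells f - d \<in> Mt) (block_cells f - S)) * sqrt 2 ^ card S
    = 2 * of_bool (S = block_cells f) - of_bool (S = {})"
proof -
  from assms(2) consider "d = top_edge f" | "d = bottom_edge f" | "d = left_edge f" | "d = right_edge f"
    by (auto simp: block_edges_def)
  then show ?thesis
    unfolding local_count_eq compl_eq_iff[OF assms(1)]
    by (cases; rule block_subset_cases[where S = S and f = f])
      (simp_all add: card_block_edge block_edges_def edge_neq edge_compl sqrt2_pow4)
qed

lemma sum_local_edge_count:
  "(\<Sum>d\<in>block_edges f. real (local_count f (\<lambda>Mt. d \<in> Mt) S))
    = real (local_weight f S) + (2 * of_bool (S = block_cells f) - of_bool (S = {}))"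
proof -
  have sum4: "(\<Sum>d\<in>block_edges f. g d) = g (top_edge f) + g (bottom_edge f) + g (left_edge f) + g (right_edge f)"
    for g :: "cell set \<Rightarrow> real"
    unfolding block_edges_def using edge_distinct[of f] by simp
  show ?thesis
    unfolding local_count_eq sum4
    by (rule block_subset_cases[where S = S and f = f]) (simp_all add: edge_neq)
qed

section \<open>Domino shuffling as a linear relation\<close>

text \<open>A cell of both regions lies in two blocks, exactly one of which owns it, so the other
  one owns it after the exchange. A cell of \<open>R\<close> alone lies in one block, and it is
  lost.\<close>

lemma flip_local_configs:
  fixes F R R' :: "cell set"
  assumes fin: "finite F"
    and deg: "\<And>v. card {f \<in> F. v \<in> block_cells f} = of_bool (v \<in> R) + of_bool (v \<in> R')"
  shows "bij_betw (\<lambda>Ow. \<lambda>f\<in>F. block_cells f - Ow f) (local_configs F R) (local_configs F R')"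
proof -
  have flip: "(\<lambda>f\<in>F. block_cells f - Ow f) \<in> local_configs F R'"
    if "\<And>v. card {f \<in> F. v \<in> block_cells f} = of_bool (v \<in> R) + of_bool (v \<in> R')"
      "Ow \<in> local_configs F R" for Ow R R'
  proof -
    have sub: "Ow f \<subseteq> block_cells f" if "f \<in> F" for f
      using \<open>Ow \<in> _\<close> that by (auto simp: local_configs_def PiE_iff)
    have "card {f \<in> F. v \<in> block_cells f - Ow f} = of_bool (v \<in> R')" for v
    proof -
      have "{f \<in> F. v \<in> block_cells f - Ow f} = {f \<in> F. v \<in> block_cells f} - {f \<in> F. v \<in> Ow f}"
        by auto
      moreover have "{f \<in> F. v \<in> Ow f} \<subseteq> {f \<in> F. v \<in> block_cells f}" using sub by auto
      ultimately have "card {f \<in> F. v \<in> block_cells f - Ow f}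
          = card {f \<in> F. v \<in> block_cells f} - card {f \<in> F. v \<in> Ow f}"
        using fin by (simp add: card_Diff_subset)
      moreover have "card {f \<in> F. v \<in> Ow f} = of_bool (v \<in> R)"
        using \<open>Ow \<in> _\<close> by (rule local_configs_card)
      ultimately show ?thesis using that(1)[of v] by simp
    qed
    moreover have "{f \<in> F. v \<in> (\<lambda>f\<in>F. block_cells f - Ow f) f} = {f \<in> F. v \<in> block_cells f - Ow f}" for v
      by auto
    ultimately show ?thesis by (auto simp: local_configs_def simp del: Diff_iff)
  qed
  have inv: "(\<lambda>f\<in>F. block_cells f - (\<lambda>f\<in>F. block_cells f - Ow f) f) = Ow" if "Ow \<in> local_configs F R" for Ow R
  proof
    fix f
    show "(\<lambda>f\<in>F. block_cells f - (\<lambda>f\<in>F. block_cells f - Ow f) f) f = Ow f"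
    proof (cases "f \<in> F")
      case True
      then have "Ow f \<subseteq> block_cells f"
        using that by (auto simp: local_configs_def PiE_iff)
      then show ?thesis using True by (simp add: double_diff)
    next
      case False
      moreover have "Ow \<in> PiE F (\<lambda>f. Pow (block_cells f))"
        using that unfolding local_configs_def by blast
      ultimately show ?thesis using PiE_arb[of Ow F _ f] by simp
    qed
  qed
  show ?thesis
  proof (rule bij_betw_byWitness[where f' = "\<lambda>Ow. \<lambda>f\<in>F. block_cells f - Ow f"])
    show "(\<lambda>Ow. \<lambda>f\<in>F. block_cells f - Ow f) ` local_configs F R \<subseteq> local_configs F R'"
      using flip[OF deg] by blast
    show "(\<lambda>Ow. \<lambda>f\<in>F. block_cells f - Ow f) ` local_configs F R' \<subseteq> local_configs F R"
      using flip[of R' R] deg by (auto simp: add.commute)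
  qed (use inv in blast)+
qed

lemma sum_card_local_config:
  assumes fin: "finite F" "finite R" and Ow: "Ow \<in> local_configs F R"
  shows "(\<Sum>f\<in>F. card (Ow f)) = card R"
proof -
  have fO: "finite (Ow f)" if "f \<in> F" for f
  proof (rule finite_subset)
    show "Ow f \<subseteq> block_cells f" using Ow that by (auto simp: local_configs_def PiE_iff)
  qed simp
  have c: "card {f \<in> F. v \<in> Ow f} = of_bool (v \<in> R)" for v
    using Ow by (rule local_configs_card)
  have disj: "Ow f \<inter> Ow g = {}" if "f \<in> F" "g \<in> F" "f \<noteq> g" for f g
  proof (rule equals0I)
    fix v assume "v \<in> Ow f \<inter> Ow g"
    then have "card {f, g} \<le> card {f \<in> F. v \<in> Ow f}"
      using that fin by (intro card_mono) auto
    with c[of v] that show False by (auto split: if_splits simp: of_bool_def)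
  qed
  have "v \<in> (\<Union>f\<in>F. Ow f) \<longleftrightarrow> v \<in> R" for v
  proof -
    have "card {f \<in> F. v \<in> Ow f} = 0 \<longleftrightarrow> \<not> (\<exists>f\<in>F. v \<in> Ow f)"
      using fin by auto
    with c[of v] show ?thesis by (cases "v \<in> R") auto
  qed
  then have "R = (\<Union>f\<in>F. Ow f)" by blast
  then show ?thesis using disj fO fin by (simp add: card_UN_disjoint)
qed

definition tiling_prob :: "cell set \<Rightarrow> cell set \<Rightarrow> real" where
  "tiling_prob R d = card {T \<in> domino_tilings R. d \<in> T} / card (domino_tilings R)"

text \<open>In the sums of \<open>card_tilings_local\<close>, exchanging covered and uncovered
  cells multiplies all weights by the constant \<open>q\<close>, because the cells owned by all
  blocks together are always those of \<open>R\<close>. Both statements then hold pattern by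
  pattern, by \<open>local_edge_count_compl\<close> and \<open>sum_local_edge_count\<close>. The
  number \<open>c\<close> is the probability that the block is full minus the probability that it
  is empty.\<close>

lemma shuffling_step:
  fixes F R R' :: "cell set"
  assumes fin: "finite F" "finite R"
    and disj: "\<And>f g. f \<in> F \<Longrightarrow> g \<in> F \<Longrightarrow> f \<noteq> g \<Longrightarrow> block_edges f \<inter> block_edges g = {}"
    and cover: "\<And>d. is_domino d \<Longrightarrow> d \<subseteq> R \<Longrightarrow> \<exists>f\<in>F. d \<in> block_edges f"
    and deg: "\<And>v. card {f \<in> F. v \<in> block_cells f} = of_bool (v \<in> R) + of_bool (v \<in> R')"
    and sub: "R' \<subseteq> R"
    and pos: "card (domino_tilings R') > 0"
  shows "card (domino_tilings R) > 0"
    and "f \<in> F \<Longrightarrow> \<exists>c. (\<forall>d\<in>block_edges f. 2 * (tiling_prob R d - tiling_prob R' (block_cells f - d)) = c)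
       \<and> (\<Sum>d\<in>block_edges f. tiling_prob R d) = 1 + c"
proof -
  have cover': "\<exists>f\<in>F. d \<in> block_edges f" if "is_domino d" "d \<subseteq> R'" for d
    using cover that sub by blast
  let ?C = "local_configs F R"
  let ?co = "\<lambda>Ow. \<lambda>f\<in>F. block_cells f - Ow f"
  define Z Z' where "Z = real (card (domino_tilings R))" and "Z' = real (card (domino_tilings R'))"
  \<comment> \<open>The factor by which the exchange changes the number of tilings with a given pattern.\<close>
  define q where "q = sqrt 2 ^ card R / 2 ^ card F"
  have q: "q > 0" by (simp add: q_def)
  have Z: "Z = (\<Sum>Ow\<in>?C. \<Prod>f\<in>F. real (local_weight f (Ow f)))"
    using card_tilings_local[OF fin(1) disj cover, where \<Phi> = "\<lambda>_ _. True"] by (simp add: Z_def)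
  have "Z' = (\<Sum>Ow\<in>local_configs F R'. \<Prod>f\<in>F. real (local_weight f (Ow f)))"
    using card_tilings_local[OF fin(1) disj cover', where \<Phi> = "\<lambda>_ _. True"] by (simp add: Z'_def)
  also have "\<dots> = (\<Sum>Ow\<in>?C. \<Prod>f\<in>F. real (local_weight f (block_cells f - Ow f)))"
    by (subst sum.reindex_bij_betw[OF flip_local_configs[OF fin(1) deg], symmetric])
      (intro sum.cong prod.cong; simp)
  finally have Z': "Z' = (\<Sum>Ow\<in>?C. \<Prod>f\<in>F. real (local_weight f (block_cells f - Ow f)))" .
  have ow_sub: "Ow f \<subseteq> block_cells f" if "Ow \<in> ?C" "f \<in> F" for Ow f
    using that by (auto simp: local_configs_def PiE_iff)
  have weights: "2 ^ card G * (\<Prod>f\<in>G. real (local_weight f (Ow f)))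
      = (\<Prod>f\<in>G. real (local_weight f (block_cells f - Ow f))) * sqrt 2 ^ (\<Sum>f\<in>G. card (Ow f))"
    if "Ow \<in> ?C" "G \<subseteq> F" for Ow G
  proof -
    have "2 ^ card G * (\<Prod>f\<in>G. real (local_weight f (Ow f))) = (\<Prod>f\<in>G. 2 * real (local_weight f (Ow f)))"
      by (simp add: prod.distrib)
    also have "\<dots> = (\<Prod>f\<in>G. real (local_weight f (block_cells f - Ow f)) * sqrt 2 ^ card (Ow f))"
      using that ow_sub[OF that(1)] by (intro prod.cong refl local_weight_compl) blast
    finally show ?thesis by (simp add: prod.distrib power_sum)
  qed
  have "Z = q * Z'"
    unfolding Z Z' sum_distrib_left
  proof (rule sum.cong[OF refl])
    fix Ow assume "Ow \<in> ?C"
    from weights[OF this subset_refl] sum_card_local_config[OF fin this]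
    show "(\<Prod>f\<in>F. real (local_weight f (Ow f))) = q * (\<Prod>f\<in>F. real (local_weight f (block_cells f - Ow f)))"
      by (simp add: q_def field_simps)
  qed
  with pos q have Zpos: "Z > 0" and Z'pos: "Z' > 0" by (auto simp: Z'_def)
  then show "card (domino_tilings R) > 0" by (simp add: Z_def)
  assume f: "f \<in> F"
  define r where "r Ow = (\<Prod>g\<in>F - {f}. real (local_weight g (Ow g)))" for Ow
  define r' where "r' Ow = (\<Prod>g\<in>F - {f}. real (local_weight g (block_cells g - Ow g)))" for Ow
  \<comment> \<open>The pattern's contribution to the net creation rate: \<open>2\<close> fillings of a full block count positively, the one of an empty block negatively.\<close>
  define s where "s Ow = 2 * of_bool (Ow f = block_cells f) - (of_bool (Ow f = {}) :: real)" for Ow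
  have edge_in: "local_count g (\<lambda>Mt. g = f \<longrightarrow> d \<in> Mt) S
      = (if g = f then local_count f (\<lambda>Mt. d \<in> Mt) S else local_weight g S)" for g d S
    by (auto simp: local_count_def)
  have K: "real (card {T \<in> domino_tilings Q. d \<in> T})
      = (\<Sum>Ow\<in>local_configs F Q. real (local_count f (\<lambda>Mt. d \<in> Mt) (Ow f)) * (\<Prod>g\<in>F - {f}. real (local_weight g (Ow g))))"
    if cov: "\<And>d. is_domino d \<Longrightarrow> d \<subseteq> Q \<Longrightarrow> \<exists>f\<in>F. d \<in> block_edges f" and d: "d \<in> block_edges f" for Q d
  proof -
    have "{T \<in> domino_tilings Q. d \<in> T}
        = {T \<in> domino_tilings Q. \<forall>g\<in>F. g = f \<longrightarrow> d \<in> T \<inter> block_edges g}"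
      using d f by auto
    also have "card \<dots> = (\<Sum>Ow\<in>local_configs F Q. \<Prod>g\<in>F. local_count g (\<lambda>Mt. g = f \<longrightarrow> d \<in> Mt) (Ow g))"
      using card_tilings_local[OF fin(1) disj cov, where \<Phi> = "\<lambda>g Mt. g = f \<longrightarrow> d \<in> Mt"] by simp
    finally show ?thesis
      by (simp add: edge_in prod.remove[OF fin(1) f])
  qed
  have K1: "real (card {T \<in> domino_tilings R. d \<in> T})
      = (\<Sum>Ow\<in>?C. real (local_count f (\<lambda>Mt. d \<in> Mt) (Ow f)) * r Ow)"
    if "d \<in> block_edges f" for d
    using K[OF cover that] by (simp add: r_def)
  have K2: "real (card {T \<in> domino_tilings R'. d \<in> T})
      = (\<Sum>Ow\<in>?C. real (local_count f (\<lambda>Mt. d \<in> Mt) (block_cells f - Ow f)) * r' Ow)"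
    if "d \<in> block_edges f" for d
  proof -
    have "real (card {T \<in> domino_tilings R'. d \<in> T}) = (\<Sum>Ow\<in>?C. real (local_count f (\<lambda>Mt. d \<in> Mt) (?co Ow f)) *
        (\<Prod>g\<in>F - {f}. real (local_weight g (?co Ow g))))"
      unfolding sum.reindex_bij_betw[OF flip_local_configs[OF fin(1) deg],
        of "\<lambda>Ow. real (local_count f (\<lambda>Mt. d \<in> Mt) (Ow f)) * (\<Prod>g\<in>F - {f}. real (local_weight g (Ow g)))"]
      using K[OF cover' that] by simp
    also have "\<dots> = (\<Sum>Ow\<in>?C. real (local_count f (\<lambda>Mt. d \<in> Mt) (block_cells f - Ow f)) * r' Ow)"
      using f unfolding r'_def by (intro sum.cong arg_cong2[where f="(*)"] prod.cong) auto
    finally show ?thesis .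
  qed
  have rr: "2 * q * r' Ow = r Ow * sqrt 2 ^ card (Ow f)" if "Ow \<in> ?C" for Ow
  proof -
    have "card R = card (Ow f) + (\<Sum>g\<in>F - {f}. card (Ow g))"
      using sum_card_local_config[OF fin that] by (simp add: sum.remove[OF fin(1) f])
    moreover have "card F = Suc (card (F - {f}))"
      using fin f by (metis card_Suc_Diff1)
    moreover have "2 ^ card (F - {f}) * r Ow = r' Ow * sqrt 2 ^ (\<Sum>g\<in>F - {f}. card (Ow g))"
      using weights[OF that, of "F - {f}"] by (simp add: r_def r'_def)
    ultimately have "q * 2 = sqrt 2 ^ card (Ow f) * sqrt 2 ^ (\<Sum>g\<in>F - {f}. card (Ow g)) / 2 ^ card (F - {f})"
      and "r Ow = r' Ow * sqrt 2 ^ (\<Sum>g\<in>F - {f}. card (Ow g)) / 2 ^ card (F - {f})"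
      by (simp_all only: q_def power_add power_Suc) (simp_all add: eq_divide_eq mult.commute)
    then have "(q * 2) * r' Ow = r Ow * sqrt 2 ^ card (Ow f)" by simp
    then show ?thesis by (simp only: mult.commute[of 2 q])
  qed
  define c where "c = (\<Sum>Ow\<in>?C. r Ow * s Ow) / Z"
  have "2 * (tiling_prob R d - tiling_prob R' (block_cells f - d)) = c" if d: "d \<in> block_edges f" for d
  proof -
    have d': "block_cells f - d \<in> block_edges f"
      using d edge_compl[of f] by (auto simp: block_edges_def)
    have main: "2 * real (card {T \<in> domino_tilings R. d \<in> T})
        - 2 * q * real (card {T \<in> domino_tilings R'. block_cells f - d \<in> T}) = (\<Sum>Ow\<in>?C. r Ow * s Ow)"
      unfolding K1[OF d] K2[OF d'] sum_distrib_left sum_subtractf[symmetric]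
    proof (rule sum.cong[OF refl])
      fix Ow assume Ow: "Ow \<in> ?C"
      let ?a = "real (local_count f (\<lambda>Mt. d \<in> Mt) (Ow f))"
      let ?b = "real (local_count f (\<lambda>Mt. block_cells f - d \<in> Mt) (block_cells f - Ow f))"
      have "2 * (?a * r Ow) - 2 * q * (?b * r' Ow) = 2 * ?a * r Ow - ?b * (2 * q * r' Ow)"
        by simp
      also have "\<dots> = r Ow * (2 * ?a - ?b * sqrt 2 ^ card (Ow f))"
        unfolding rr[OF Ow] by (simp add: algebra_simps)
      also have "\<dots> = r Ow * s Ow"
        using local_edge_count_compl[OF ow_sub[OF Ow f] d] by (simp add: s_def)
      finally show "2 * (?a * r Ow) - 2 * q * (?b * r' Ow) = r Ow * s Ow" .
    qed
    show ?thesis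
      unfolding tiling_prob_def c_def Z_def[symmetric] Z'_def[symmetric] main[symmetric]
      using \<open>Z = q * Z'\<close> q Z'pos by (simp add: right_diff_distrib diff_divide_distrib)
  qed
  moreover have "(\<Sum>d\<in>block_edges f. tiling_prob R d) = 1 + c"
  proof -
    have "(\<Sum>d\<in>block_edges f. real (card {T \<in> domino_tilings R. d \<in> T}))
        = (\<Sum>Ow\<in>?C. (\<Sum>d\<in>block_edges f. real (local_count f (\<lambda>Mt. d \<in> Mt) (Ow f))) * r Ow)"
      by (simp add: K1 sum.swap[of _ "block_edges f"] sum_distrib_right)
    also have "\<dots> = (\<Sum>Ow\<in>?C. real (local_weight f (Ow f)) * r Ow) + (\<Sum>Ow\<in>?C. r Ow * s Ow)"
      unfolding sum_local_edge_count sum.distrib[symmetric]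
      by (intro sum.cong refl) (simp add: s_def algebra_simps)
    also have "(\<Sum>Ow\<in>?C. real (local_weight f (Ow f)) * r Ow) = Z"
      by (simp add: Z r_def prod.remove[OF fin(1) f])
    finally show ?thesis
      using Zpos by (simp add: tiling_prob_def c_def Z_def[symmetric] sum_divide_distrib[symmetric] field_simps)
  qed
  ultimately show "\<exists>c. (\<forall>d\<in>block_edges f. 2 * (tiling_prob R d - tiling_prob R' (block_cells f - d)) = c)
       \<and> (\<Sum>d\<in>block_edges f. tiling_prob R d) = 1 + c" by blast
qed

section \<open>Blocks of the Aztec diamond\<close>

lemma aztec_diamond_iff:
  "(i, j) \<in> aztec_diamond n \<longleftrightarrow> max \<bar>i\<bar> \<bar>i + 1\<bar> + max \<bar>j\<bar> \<bar>j + 1\<bar> \<le> int n + 1"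
proof
  assume "(i, j) \<in> aztec_diamond n"
  then have sub: "\<bar>x\<bar> + \<bar>y\<bar> \<le> real n + 1"
    if "of_int i \<le> x" "x \<le> of_int i + 1" "of_int j \<le> y" "y \<le> of_int j + 1" for x y :: real
  proof -
    have "(x, y) \<in> unit_square (i, j)" using that by (simp add: unit_square_def)
    with \<open>(i, j) \<in> _\<close> show ?thesis unfolding aztec_diamond_def by blast
  qed
  have "real_of_int (\<bar>a\<bar> + \<bar>b\<bar>) \<le> real_of_int (int n + 1)" if "a \<in> {i, i + 1}" "b \<in> {j, j + 1}" for a b
    using sub[of "of_int a" "of_int b"] that by auto
  then have "\<bar>a\<bar> + \<bar>b\<bar> \<le> int n + 1" if "a \<in> {i, i + 1}" "b \<in> {j, j + 1}" for a b
    using that by (simp only: of_int_le_iff)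
  from this[of i j] this[of "i + 1" j] this[of i "j + 1"] this[of "i + 1" "j + 1"]
  show "max \<bar>i\<bar> \<bar>i + 1\<bar> + max \<bar>j\<bar> \<bar>j + 1\<bar> \<le> int n + 1" by (simp add: max_def)
next
  assume "max \<bar>i\<bar> \<bar>i + 1\<bar> + max \<bar>j\<bar> \<bar>j + 1\<bar> \<le> int n + 1"
  then have le: "real_of_int (max \<bar>i\<bar> \<bar>i + 1\<bar> + max \<bar>j\<bar> \<bar>j + 1\<bar>) \<le> real_of_int (int n + 1)"
    by (simp only: of_int_le_iff)
  have "\<bar>x\<bar> \<le> real_of_int (max \<bar>i\<bar> \<bar>i + 1\<bar>)" if "of_int i \<le> x" "x \<le> of_int i + 1" for x :: real and i
    using that by (auto simp: max_def)
  then have "\<bar>x\<bar> + \<bar>y\<bar> \<le> real n + 1"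
    if "of_int i \<le> x" "x \<le> of_int i + 1" "of_int j \<le> y" "y \<le> of_int j + 1" for x y :: real
    using le that by (smt (verit, best) of_int_add of_int_1 of_int_of_nat_eq)
  then show "(i, j) \<in> aztec_diamond n" by (auto simp: aztec_diamond_def unit_square_def)
qed

text \<open>These blocks form a rotated \<open>n\<close> by \<open>n\<close> array; all their
  cells lie in the diamond of size \<open>n\<close>, and together they cover it.\<close>

definition aztec_blocks :: "nat \<Rightarrow> cell set" where
  "aztec_blocks n = {(x, y). \<bar>x\<bar> + \<bar>y\<bar> < int n \<and> odd (x + y + int n)}"

lemma finite_aztec_blocks: "finite (aztec_blocks n)"
  by (rule finite_subset[of _ "{- int n..int n} \<times> {- int n..int n}"]) (auto simp: aztec_blocks_def)

lemma finite_aztec_diamond: "finite (aztec_diamond n)"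
proof (rule finite_subset)
  show "aztec_diamond n \<subseteq> {- int n - 1..int n + 1} \<times> {- int n - 1..int n + 1}"
    by (auto simp: aztec_diamond_iff max_def split: if_splits)
qed simp

lemma aztec_diamond_mono: "aztec_diamond n \<subseteq> aztec_diamond (Suc n)"
  by (auto simp: aztec_diamond_iff)

lemma aztec_diamond_0: "aztec_diamond 0 = {}"
proof -
  have "\<not> max \<bar>i\<bar> \<bar>i + 1\<bar> + max \<bar>j\<bar> \<bar>j + 1\<bar> \<le> int 0 + 1" for i j :: int by auto
  then show ?thesis by (auto simp only: aztec_diamond_iff[symmetric])
qed

lemma max_abs_Suc: "max \<bar>i\<bar> \<bar>i + 1\<bar> = (if 0 \<le> i then i + 1 else - i)" for i :: int
  by auto

text \<open>Each cell is in two blocks of the right parity. For a cell of the smaller diamond both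
  centres are within the bound, for a cell of the outermost layer one of them is.\<close>

lemma card_blocks_at_cell:
  "card {f \<in> aztec_blocks (Suc n). v \<in> block_cells f}
    = of_bool (v \<in> aztec_diamond (Suc n)) + of_bool (v \<in> aztec_diamond n)"
proof -
  obtain i j where v: "v = (i, j)" by (cases v)
  have card2: "card {f \<in> {a, b}. P f} = of_bool (P a) + of_bool (P b)" if "a \<noteq> b" for a b :: cell and P
  proof -
    have "{f \<in> {a, b}. P f} = (if P a then {a} else {}) \<union> (if P b then {b} else {})" by auto
    with that show ?thesis by simp
  qed
  have mem: "(x, y) \<in> aztec_blocks (Suc n) \<longleftrightarrow> even (x + y + int n) \<and> \<bar>x\<bar> + \<bar>y\<bar> \<le> int n" for x y
    by (auto simp: aztec_blocks_def)
  have around: "{f \<in> aztec_blocks (Suc n). v \<in> block_cells f}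
      = {f \<in> {(i, j), (i + 1, j), (i, j + 1), (i + 1, j + 1)}. f \<in> aztec_blocks (Suc n)}"
  proof -
    have "v \<in> block_cells f \<longleftrightarrow> f \<in> {(i, j), (i + 1, j), (i, j + 1), (i + 1, j + 1)}" for f
      by (cases f) (auto simp: v block_cells_def)
    then show ?thesis by blast
  qed
  show ?thesis
  proof (cases "even (i + j + int n)")
    case True
    have "{f \<in> aztec_blocks (Suc n). v \<in> block_cells f}
      = {f \<in> {(i, j), (i + 1, j + 1)}. (\<lambda>(x, y). \<bar>x\<bar> + \<bar>y\<bar> \<le> int n) f}"
    proof -
      have par: "odd (i + 1 + j + int n)" "odd (i + (j + 1) + int n)" "even (i + 1 + (j + 1) + int n)"
        using True by (auto simp: even_add)
      have "(i + 1, j) \<notin> aztec_blocks (Suc n)" "(i, j + 1) \<notin> aztec_blocks (Suc n)"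
        "(i, j) \<in> aztec_blocks (Suc n) \<longleftrightarrow> (\<lambda>(x, y). \<bar>x\<bar> + \<bar>y\<bar> \<le> int n) (i, j)"
        "(i + 1, j + 1) \<in> aztec_blocks (Suc n) \<longleftrightarrow> (\<lambda>(x, y). \<bar>x\<bar> + \<bar>y\<bar> \<le> int n) (i + 1, j + 1)"
        using True par unfolding mem by (simp_all only: simp_thms case_prod_conv)
      then show ?thesis unfolding around by blast
    qed
    also have "card \<dots> = of_bool (\<bar>i\<bar> + \<bar>j\<bar> \<le> int n) + of_bool (\<bar>i + 1\<bar> + \<bar>j + 1\<bar> \<le> int n)"
      by (subst card2) auto
    also have "\<dots> = of_bool (v \<in> aztec_diamond (Suc n)) + of_bool (v \<in> aztec_diamond n)"
    proof -
      define S T where "S = \<bar>i\<bar> + \<bar>j\<bar>" and "T = \<bar>i + 1\<bar> + \<bar>j + 1\<bar>"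
      have "even (S + int n)" "even (T + int n)" using True by (auto simp: S_def T_def)
      moreover define U where "U = max \<bar>i\<bar> \<bar>i + 1\<bar> + max \<bar>j\<bar> \<bar>j + 1\<bar>"
      have "T = S + 2 \<and> U = S + 2 \<or> S = T + 2 \<and> U = T + 2 \<or> S = T \<and> U = S + 1"
        unfolding U_def max_abs_Suc S_def T_def by (cases "0 \<le> i"; cases "0 \<le> j") auto
      ultimately have "U \<le> int (Suc n) + 1 \<longleftrightarrow> S \<le> int n \<or> T \<le> int n"
        "U \<le> int n + 1 \<longleftrightarrow> S \<le> int n \<and> T \<le> int n"
        by presburger+
      then have "v \<in> aztec_diamond (Suc n) \<longleftrightarrow> S \<le> int n \<or> T \<le> int n" "v \<in> aztec_diamond n \<longleftrightarrow> S \<le> int n \<and> T \<le> int n"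
        unfolding v aztec_diamond_iff U_def by simp_all
      then show ?thesis unfolding S_def T_def by auto
    qed
    finally show ?thesis .
  next
    case False
    have "{f \<in> aztec_blocks (Suc n). v \<in> block_cells f}
      = {f \<in> {(i + 1, j), (i, j + 1)}. (\<lambda>(x, y). \<bar>x\<bar> + \<bar>y\<bar> \<le> int n) f}"
    proof -
      have par: "odd (i + j + int n)" "odd (i + 1 + (j + 1) + int n)" "even (i + 1 + j + int n)" "even (i + (j + 1) + int n)"
        using False by (auto simp: even_add)
      have "(i, j) \<notin> aztec_blocks (Suc n)" "(i + 1, j + 1) \<notin> aztec_blocks (Suc n)"
        "(i + 1, j) \<in> aztec_blocks (Suc n) \<longleftrightarrow> (\<lambda>(x, y). \<bar>x\<bar> + \<bar>y\<bar> \<le> int n) (i + 1, j)"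
        "(i, j + 1) \<in> aztec_blocks (Suc n) \<longleftrightarrow> (\<lambda>(x, y). \<bar>x\<bar> + \<bar>y\<bar> \<le> int n) (i, j + 1)"
        using False par unfolding mem by (simp_all only: simp_thms case_prod_conv)
      then show ?thesis unfolding around by blast
    qed
    also have "card \<dots> = of_bool (\<bar>i + 1\<bar> + \<bar>j\<bar> \<le> int n) + of_bool (\<bar>i\<bar> + \<bar>j + 1\<bar> \<le> int n)"
      by (subst card2) auto
    also have "\<dots> = of_bool (v \<in> aztec_diamond (Suc n)) + of_bool (v \<in> aztec_diamond n)"
    proof -
      define S T where "S = \<bar>i + 1\<bar> + \<bar>j\<bar>" and "T = \<bar>i\<bar> + \<bar>j + 1\<bar>"
      have "even (S + int n)" "even (T + int n)" using False by (auto simp: S_def T_def)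
      moreover define U where "U = max \<bar>i\<bar> \<bar>i + 1\<bar> + max \<bar>j\<bar> \<bar>j + 1\<bar>"
      have "T = S + 2 \<and> U = S + 2 \<or> S = T + 2 \<and> U = T + 2 \<or> S = T \<and> U = S + 1"
        unfolding U_def max_abs_Suc S_def T_def by (cases "0 \<le> i"; cases "0 \<le> j") auto
      ultimately have "U \<le> int (Suc n) + 1 \<longleftrightarrow> S \<le> int n \<or> T \<le> int n"
        "U \<le> int n + 1 \<longleftrightarrow> S \<le> int n \<and> T \<le> int n"
        by presburger+
      then have "v \<in> aztec_diamond (Suc n) \<longleftrightarrow> S \<le> int n \<or> T \<le> int n" "v \<in> aztec_diamond n \<longleftrightarrow> S \<le> int n \<and> T \<le> int n"
        unfolding v aztec_diamond_iff U_def by simp_all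
      then show ?thesis unfolding S_def T_def by auto
    qed
    finally show ?thesis .
  qed
qed

text \<open>Two blocks that share an edge have neighbouring centres. The coordinate sums over the
  two cells of an edge determine the centre up to such a neighbour.\<close>

lemma block_edges_disjoint:
  assumes "even (x + y + x' + y')" "(x, y) \<noteq> (x', y')"
  shows "block_edges (x, y) \<inter> block_edges (x', y') = {}"
proof (rule equals0I)
  fix d assume d: "d \<in> block_edges (x, y) \<inter> block_edges (x', y')"
  have "(\<Sum>c\<in>d. fst c, \<Sum>c\<in>d. snd c)
      \<in> {(2 * x - 1, 2 * y), (2 * x - 1, 2 * y - 2), (2 * x - 2, 2 * y - 1), (2 * x, 2 * y - 1)}"
    if "d \<in> block_edges (x, y)" for x y
    using that by (auto simp: block_edges_def)
  from this[of x y] this[of x' y'] d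
  obtain a b where "(a, b) \<in> {(2 * x - 1, 2 * y), (2 * x - 1, 2 * y - 2), (2 * x - 2, 2 * y - 1), (2 * x, 2 * y - 1)}"
    "(a, b) \<in> {(2 * x' - 1, 2 * y'), (2 * x' - 1, 2 * y' - 2), (2 * x' - 2, 2 * y' - 1), (2 * x', 2 * y' - 1)}"
    by blast
  then have "x' = x \<and> (y' = y \<or> y' = y + 1 \<or> y' = y - 1)
      \<or> y' = y \<and> (x' = x + 1 \<or> x' = x - 1)"
    unfolding insert_iff prod.inject empty_iff by (elim disjE conjE FalseE; presburger)
  with assms show False by auto
qed

lemma edges_in_block:
  "top_edge f \<in> block_edges f" "bottom_edge f \<in> block_edges f"
  "left_edge f \<in> block_edges f" "right_edge f \<in> block_edges f"
  by (auto simp: block_edges_def)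

lemma domino_in_block:
  assumes "is_domino d" "d \<subseteq> aztec_diamond (Suc n)"
  shows "\<exists>f\<in>aztec_blocks (Suc n). d \<in> block_edges f"
proof -
  obtain i j where d: "d = {(i, j), (i + 1, j)} \<or> d = {(i, j), (i, j + 1)}"
    using assms(1) by (auto simp: is_domino_def)
  have corner: "(x, y) \<in> aztec_blocks (Suc n)"
    if "odd (x + y + int (Suc n))" "\<bar>x\<bar> + \<bar>y\<bar> \<le> int n + 1" for x y
  proof -
    have "\<bar>x\<bar> + \<bar>y\<bar> \<noteq> int n + 1"
    proof
      assume "\<bar>x\<bar> + \<bar>y\<bar> = int n + 1"
      moreover have "even (\<bar>x\<bar> + \<bar>y\<bar>) \<longleftrightarrow> even (x + y)" by simp
      ultimately show False using that(1) by simp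
    qed
    with that show ?thesis by (simp add: aztec_blocks_def)
  qed
  from d show ?thesis
  proof
    assume d: "d = {(i, j), (i + 1, j)}"
    have blocks: "d = top_edge (i + 1, j)" "d = bottom_edge (i + 1, j + 1)" using d by auto
    have "(i, j) \<in> aztec_diamond (Suc n)" "(i + 1, j) \<in> aztec_diamond (Suc n)"
      using assms(2) d by auto
    then have "\<bar>i + 1\<bar> + \<bar>j\<bar> \<le> int n + 1" "\<bar>i + 1\<bar> + \<bar>j + 1\<bar> \<le> int n + 1"
      unfolding aztec_diamond_iff max_abs_Suc by (simp_all split: if_splits)
    then have "(i + 1, j) \<in> aztec_blocks (Suc n) \<or> (i + 1, j + 1) \<in> aztec_blocks (Suc n)"
      using corner[of "i + 1" j] corner[of "i + 1" "j + 1"] by auto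
    with blocks edges_in_block show ?thesis by metis
  next
    assume d: "d = {(i, j), (i, j + 1)}"
    have blocks: "d = right_edge (i, j + 1)" "d = left_edge (i + 1, j + 1)" using d by auto
    have "(i, j) \<in> aztec_diamond (Suc n)" "(i, j + 1) \<in> aztec_diamond (Suc n)"
      using assms(2) d by auto
    then have "\<bar>i\<bar> + \<bar>j + 1\<bar> \<le> int n + 1" "\<bar>i + 1\<bar> + \<bar>j + 1\<bar> \<le> int n + 1"
      unfolding aztec_diamond_iff max_abs_Suc by (simp_all split: if_splits)
    then have "(i, j + 1) \<in> aztec_blocks (Suc n) \<or> (i + 1, j + 1) \<in> aztec_blocks (Suc n)"
      using corner[of i "j + 1"] corner[of "i + 1" "j + 1"] by auto
    with blocks edges_in_block show ?thesis by metis
  qed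
qed

lemma domino_tilings_empty: "domino_tilings {} = {{}}"
  by (auto simp: domino_tilings_def partition_on_def)

abbreviation aztec_tiling_prob :: "nat \<Rightarrow> cell set \<Rightarrow> real" where
  "aztec_tiling_prob n \<equiv> tiling_prob (aztec_diamond n)"

lemma aztec_blocks_disjoint:
  "f \<in> aztec_blocks n \<Longrightarrow> g \<in> aztec_blocks n \<Longrightarrow> f \<noteq> g \<Longrightarrow> block_edges f \<inter> block_edges g = {}"
  by (cases f; cases g; simp only:; rule block_edges_disjoint) (auto simp: aztec_blocks_def)

lemma aztec_tilings_exist: "card (domino_tilings (aztec_diamond n)) > 0"
proof (induction n)
  case 0
  then show ?case by (simp add: aztec_diamond_0 domino_tilings_empty)
next
  case (Suc n)
  show ?case
    by (rule shuffling_step(1)[OF finite_aztec_blocks finite_aztec_diamond aztec_blocks_disjoint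
          domino_in_block card_blocks_at_cell aztec_diamond_mono Suc])
qed

lemma aztec_shuffling:
  assumes "f \<in> aztec_blocks (Suc n)"
  shows "\<exists>c. (\<forall>d\<in>block_edges f.
      2 * (aztec_tiling_prob (Suc n) d - aztec_tiling_prob n (block_cells f - d)) = c)
    \<and> (\<Sum>d\<in>block_edges f. aztec_tiling_prob (Suc n) d) = 1 + c"
  by (rule shuffling_step(2)[OF finite_aztec_blocks finite_aztec_diamond aztec_blocks_disjoint
        domino_in_block card_blocks_at_cell aztec_diamond_mono aztec_tilings_exist assms])

lemma tiling_prob_outside: "\<not> d \<subseteq> R \<Longrightarrow> tiling_prob R d = 0"
proof -
  assume "\<not> d \<subseteq> R"
  then have "{T \<in> domino_tilings R. d \<in> T} = {}"
    by (auto simp: domino_tilings_def partition_on_def)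
  then show ?thesis unfolding tiling_prob_def by (simp only: card.empty)
qed

section \<open>Net creation rates\<close>

text \<open>The coordinates \<open>A\<close> and \<open>B\<close> turn the array of blocks of the
  diamond of size \<open>n = M + 1\<close> into the square with \<open>0 \<le> A \<le> M\<close>
  and \<open>0 \<le> B \<le> M\<close>. The parity condition on the centres holds
  automatically.\<close>

definition rotated :: "int \<Rightarrow> int \<Rightarrow> int \<Rightarrow> cell" where
  "rotated A B M = (A + B - M, A - B)"

text \<open>The four edges of a block carry the dominoes that domino shuffling moves north, south,
  east and west. All functions are defined for all integers, and are 0 outside the array and for
  \<open>M < 0\<close>; this spares boundary conditions in the recurrences.\<close>

definition north :: "int \<Rightarrow> int \<Rightarrow> int \<Rightarrow> real" where
  "north A B M = aztec_tiling_prob (nat (M + 1)) (top_edge (rotated A B M))"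

definition south :: "int \<Rightarrow> int \<Rightarrow> int \<Rightarrow> real" where
  "south A B M = aztec_tiling_prob (nat (M + 1)) (bottom_edge (rotated A B M))"

definition east :: "int \<Rightarrow> int \<Rightarrow> int \<Rightarrow> real" where
  "east A B M = aztec_tiling_prob (nat (M + 1)) (right_edge (rotated A B M))"

definition west :: "int \<Rightarrow> int \<Rightarrow> int \<Rightarrow> real" where
  "west A B M = aztec_tiling_prob (nat (M + 1)) (left_edge (rotated A B M))"

definition net_creation :: "int \<Rightarrow> int \<Rightarrow> int \<Rightarrow> real" where
  "net_creation A B M = 2 * (north A B M - north (A - 1) B (M - 1))"

lemma rotated_in_blocks:
  "rotated A B (int n) \<in> aztec_blocks (Suc n) \<longleftrightarrow> 0 \<le> A \<and> A \<le> int n \<and> 0 \<le> B \<and> B \<le> int n"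
  by (auto simp: rotated_def aztec_blocks_def abs_if split: if_splits)

text \<open>The opposite edge of a block is the edge of the same kind of a neighbouring block of
  the smaller diamond.\<close>

lemma shifted_edges:
  "top_edge (rotated (A - 1) B (M - 1)) = bottom_edge (rotated A B M)"
  "bottom_edge (rotated A (B - 1) (M - 1)) = top_edge (rotated A B M)"
  "right_edge (rotated (A - 1) (B - 1) (M - 1)) = left_edge (rotated A B M)"
  "left_edge (rotated A B (M - 1)) = right_edge (rotated A B M)"
  by (simp_all add: rotated_def algebra_simps)

lemma edge_outside:
  assumes "\<not> (0 \<le> A \<and> A \<le> M \<and> 0 \<le> B \<and> B \<le> M)" "d \<in> block_edges (rotated A B M)"
  shows "aztec_tiling_prob (nat (M + 1)) d = 0" "aztec_tiling_prob (nat M) d = 0"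
proof -
  have "\<not> d \<subseteq> aztec_diamond (nat (M + 1))"
  proof (cases "M \<ge> 0")
    case False
    then show ?thesis using block_edges_nonempty[OF assms(2)] by (simp add: aztec_diamond_0)
  next
    case True
    then obtain n where n: "M = int n" using nonneg_int_cases by blast
    show ?thesis
    proof
      assume "d \<subseteq> aztec_diamond (nat (M + 1))"
      then have "d \<subseteq> aztec_diamond (Suc n)" by (simp add: n nat_add_distrib)
      then obtain g where g: "g \<in> aztec_blocks (Suc n)" "d \<in> block_edges g"
        using domino_in_block is_domino_block_edges[OF assms(2)] by blast
      obtain x y where xy: "g = (x, y)" by (cases g)
      have "rotated A B M = g"
      proof (rule ccontr)
        assume "rotated A B M \<noteq> g"
        moreover have "even (A + B - M + (A - B) + x + y)"
          using g(1) by (auto simp: xy aztec_blocks_def n)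
        ultimately have "block_edges (rotated A B M) \<inter> block_edges g = {}"
          unfolding rotated_def xy by (intro block_edges_disjoint)
        with assms(2) g(2) show False by blast
      qed
      with g(1) assms(1) show False using rotated_in_blocks[of A B n] by (simp add: n)
    qed
  qed
  moreover have "aztec_diamond (nat M) \<subseteq> aztec_diamond (nat (M + 1))"
  proof (cases "M \<ge> 0")
    case True
    then show ?thesis using aztec_diamond_mono[of "nat M"] by (simp add: nat_add_distrib)
  qed simp
  ultimately show "aztec_tiling_prob (nat (M + 1)) d = 0" "aztec_tiling_prob (nat M) d = 0"
    by (auto intro!: tiling_prob_outside)
qed

text \<open>This is \<open>shuffling_step\<close> in rotated coordinates. Outside the array all
  terms vanish.\<close>

lemma going_step:
  "north A B M = north (A - 1) B (M - 1) + net_creation A B M / 2"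
  "south A B M = south A (B - 1) (M - 1) + net_creation A B M / 2"
  "east A B M = east (A - 1) (B - 1) (M - 1) + net_creation A B M / 2"
  "west A B M = west A B (M - 1) + net_creation A B M / 2"
  "north A B M + south A B M + east A B M + west A B M
    = of_bool (0 \<le> A \<and> A \<le> M \<and> 0 \<le> B \<and> B \<le> M) + net_creation A B M"
proof -
  define f where "f = rotated A B M"
  have going: "north A B M = aztec_tiling_prob (nat (M + 1)) (top_edge f)"
    "south A B M = aztec_tiling_prob (nat (M + 1)) (bottom_edge f)"
    "east A B M = aztec_tiling_prob (nat (M + 1)) (right_edge f)"
    "west A B M = aztec_tiling_prob (nat (M + 1)) (left_edge f)"
    "north (A - 1) B (M - 1) = aztec_tiling_prob (nat M) (bottom_edge f)"
    "south A (B - 1) (M - 1) = aztec_tiling_prob (nat M) (top_edge f)"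
    "east (A - 1) (B - 1) (M - 1) = aztec_tiling_prob (nat M) (left_edge f)"
    "west A B (M - 1) = aztec_tiling_prob (nat M) (right_edge f)"
    unfolding north_def south_def east_def west_def shifted_edges f_def by simp_all
  have sum4: "(\<Sum>d\<in>block_edges f. g d) = g (top_edge f) + g (bottom_edge f) + g (left_edge f) + g (right_edge f)"
    for g :: "cell set \<Rightarrow> real"
    unfolding block_edges_def using edge_distinct[of f] by simp
  have "north A B M = north (A - 1) B (M - 1) + net_creation A B M / 2
    \<and> south A B M = south A (B - 1) (M - 1) + net_creation A B M / 2
    \<and> east A B M = east (A - 1) (B - 1) (M - 1) + net_creation A B M / 2
    \<and> west A B M = west A B (M - 1) + net_creation A B M / 2
    \<and> north A B M + south A B M + east A B M + west A B M
      = of_bool (0 \<le> A \<and> A \<le> M \<and> 0 \<le> B \<and> B \<le> M) + net_creation A B M"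
  proof (cases "0 \<le> A \<and> A \<le> M \<and> 0 \<le> B \<and> B \<le> M")
    case True
    then have "0 \<le> M" by linarith
    then obtain n where n: "M = int n" using nonneg_int_cases by blast
    have "f \<in> aztec_blocks (Suc n)" using True by (simp add: f_def n rotated_in_blocks)
    from aztec_shuffling[OF this] obtain c where
      c: "\<And>d. d \<in> block_edges f \<Longrightarrow>
        2 * (aztec_tiling_prob (Suc n) d - aztec_tiling_prob n (block_cells f - d)) = c"
      and s: "(\<Sum>d\<in>block_edges f. aztec_tiling_prob (Suc n) d) = 1 + c" by blast
    have nn: "nat (M + 1) = Suc n" "nat M = n" by (simp_all add: n nat_add_distrib)
    show ?thesis
      unfolding net_creation_def going nn using s[unfolded sum4] True
        c[OF edges_in_block(1)] c[OF edges_in_block(2)] c[OF edges_in_block(3)] c[OF edges_in_block(4)]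
      unfolding edge_compl by simp
  next
    case False
    then show ?thesis
      unfolding net_creation_def going
      using edge_outside[OF False, folded f_def] edges_in_block[of f] by simp
  qed
  then show "north A B M = north (A - 1) B (M - 1) + net_creation A B M / 2"
    "south A B M = south A (B - 1) (M - 1) + net_creation A B M / 2"
    "east A B M = east (A - 1) (B - 1) (M - 1) + net_creation A B M / 2"
    "west A B M = west A B (M - 1) + net_creation A B M / 2"
    "north A B M + south A B M + east A B M + west A B M
      = of_bool (0 \<le> A \<and> A \<le> M \<and> 0 \<le> B \<and> B \<le> M) + net_creation A B M"
    by blast+
qed

lemma north_outside: "\<not> (0 \<le> A \<and> A \<le> M \<and> 0 \<le> B \<and> B \<le> M) \<Longrightarrow> north A B M = 0"
  unfolding north_def by (rule edge_outside(1)) (auto simp: edges_in_block)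

lemma net_creation_outside: 
  assumes "\<not> (0 \<le> A \<and> A \<le> M \<and> 0 \<le> B \<and> B \<le> M)" shows "net_creation A B M = 0"
  unfolding net_creation_def using assms by (subst (1 2) north_outside) auto

text \<open>These second differences undo the generating function of the indicator of the array,
  \<open>0 \<le> A, B \<le> M\<close>: with \<open>z\<close>, \<open>s\<close>, \<open>t\<close>
  marking \<open>M\<close>, \<open>A\<close>, \<open>B\<close> it is \<open>(1 - s t z^2) / ((1 -
  z) (1 - s z) (1 - t z) (1 - s t z))\<close>.\<close>

lemma square_indicator_diff:
  fixes A B M :: int
  defines "J \<equiv> \<lambda>A B M :: int. of_bool (0 \<le> A \<and> A \<le> M \<and> 0 \<le> B \<and> B \<le> M) :: real"
    and "\<rho> \<equiv> \<lambda>A B M :: int. of_bool (A = B \<and> 0 \<le> M \<and> (A = 0 \<or> A = M)) :: real"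
  shows "J A B M - J (A - 1) B (M - 1) - J A (B - 1) (M - 1) + J (A - 1) (B - 1) (M - 2) = \<rho> A B M"
    and "\<rho> A B M - \<rho> (A - 1) (B - 1) (M - 1) - \<rho> A B (M - 1) + \<rho> (A - 1) (B - 1) (M - 2)
       = of_bool (A = 0 \<and> B = 0 \<and> M = 0) - of_bool (A = 1 \<and> B = 1 \<and> M = 2)"
proof -
  have 1: "J A B M - J (A - 1) B (M - 1) = of_bool (0 \<le> A \<and> A \<le> M \<and> 0 \<le> B \<and> B \<le> M \<and> (A = 0 \<or> B = M))" for A B M
    unfolding J_def of_bool_def by auto
  from 1[of A B M] 1[of A "B - 1" "M - 1"]
  show "J A B M - J (A - 1) B (M - 1) - J A (B - 1) (M - 1) + J (A - 1) (B - 1) (M - 2) = \<rho> A B M"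
    unfolding \<rho>_def of_bool_def by auto
  show "\<rho> A B M - \<rho> (A - 1) (B - 1) (M - 1) - \<rho> A B (M - 1) + \<rho> (A - 1) (B - 1) (M - 2)
       = of_bool (A = 0 \<and> B = 0 \<and> M = 0) - of_bool (A = 1 \<and> B = 1 \<and> M = 2)"
  proof (cases "A = B")
    case True
    then show ?thesis unfolding \<rho>_def of_bool_def by auto
  next
    case False
    then show ?thesis unfolding \<rho>_def by auto
  qed
qed

text \<open>In terms of generating functions in \<open>z\<close>, \<open>s\<close>,
  \<open>t\<close>, the relations \<open>going_step\<close> express the four probabilities as
  \<open>c / 2\<close> divided by \<open>1 - s z\<close>, \<open>1 - t z\<close>, \<open>1 - s t
  z\<close> and \<open>1 - z\<close>. Their sum is \<open>c\<close> plus the indicator of the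
  array. Combining north with south and east with west, and clearing denominators, gives \<open>(1
  - s t z^2) Q c = 1 - s t z^2\<close> with \<open>2 Q = (1 - s z) (1 - t z) + (1 - z) (1 - s t
  z)\<close>, hence \<open>Q c = 1\<close>.\<close>

lemma net_creation_recurrence:
  "net_creation A B M = (net_creation (A - 1) (B - 1) (M - 1) + net_creation A B (M - 1)
      + net_creation (A - 1) B (M - 1) + net_creation A (B - 1) (M - 1)) / 2
    - net_creation (A - 1) (B - 1) (M - 2) + of_bool (A = 0 \<and> B = 0 \<and> M = 0)"
proof -
  let ?c = net_creation
  define J :: "int \<Rightarrow> int \<Rightarrow> int \<Rightarrow> real" where
    "J A B M = of_bool (0 \<le> A \<and> A \<le> M \<and> 0 \<le> B \<and> B \<le> M)" for A B M
  define \<rho> :: "int \<Rightarrow> int \<Rightarrow> int \<Rightarrow> real" where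
    "\<rho> A B M = of_bool (A = B \<and> 0 \<le> M \<and> (A = 0 \<or> A = M))" for A B M
  \<comment> \<open>Half of \<open>c\<close> is subtracted so that \<open>V\<close> and \<open>H\<close> satisfy second-order equations with the same right-hand side.\<close>
  define V where "V A B M = north A B M + south A B M - ?c A B M / 2" for A B M
  define H where "H A B M = east A B M + west A B M - ?c A B M / 2" for A B M
  define e where "e A B M = ?c A B M - (?c (A - 1) (B - 1) (M - 1) + ?c A B (M - 1)
      + ?c (A - 1) B (M - 1) + ?c A (B - 1) (M - 1)) / 2 + ?c (A - 1) (B - 1) (M - 2)" for A B M
  \<comment> \<open>The common shape of the two computations that follow, for \<open>V\<close> and for \<open>H\<close>.\<close>
  have lin: "(n1 + s1 - c / 2) - (n2 + s3 - c2 / 2) - (n3 + s2 - c3 / 2) + (n4 + s4 - c4 / 2) = (c - c4) / 2"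
    if "n1 = n2 + c / 2" "s3 = s4 + c2 / 2" "s1 = s2 + c / 2" "n3 = n4 + c3 / 2"
    for n1 n2 n3 n4 s1 s2 s3 s4 c c2 c3 c4 :: real
    unfolding that by (simp add: diff_divide_distrib)
  have VH: "V A B M + H A B M = J A B M" for A B M
    using going_step(5)[of A B M] by (simp add: V_def H_def J_def)
  have V: "V A B M - V (A - 1) B (M - 1) - V A (B - 1) (M - 1) + V (A - 1) (B - 1) (M - 2)
      = (?c A B M - ?c (A - 1) (B - 1) (M - 2)) / 2" for A B M
  proof -
    have "north A (B - 1) (M - 1) = north (A - 1) (B - 1) (M - 2) + ?c A (B - 1) (M - 1) / 2"
      "south (A - 1) B (M - 1) = south (A - 1) (B - 1) (M - 2) + ?c (A - 1) B (M - 1) / 2"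
      using going_step(1)[of A "B - 1" "M - 1"] going_step(2)[of "A - 1" B "M - 1"] by simp_all
    from lin[OF going_step(1)[of A B M] this(2) going_step(2)[of A B M] this(1)] show ?thesis unfolding V_def by (simp add: algebra_simps)
  qed
  have H: "H A B M - H (A - 1) (B - 1) (M - 1) - H A B (M - 1) + H (A - 1) (B - 1) (M - 2)
      = (?c A B M - ?c (A - 1) (B - 1) (M - 2)) / 2" for A B M
  proof -
    have "east A B (M - 1) = east (A - 1) (B - 1) (M - 2) + ?c A B (M - 1) / 2"
      "west (A - 1) (B - 1) (M - 1) = west (A - 1) (B - 1) (M - 2) + ?c (A - 1) (B - 1) (M - 1) / 2"
      using going_step(3)[of A B "M - 1"] going_step(4)[of "A - 1" "B - 1" "M - 1"] by simp_all
    from lin[OF going_step(3)[of A B M] this(2) going_step(4)[of A B M] this(1)] show ?thesis unfolding H_def by (simp add: algebra_simps)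
  qed
  have J\<rho>: "J A B M - J (A - 1) B (M - 1) - J A (B - 1) (M - 1) + J (A - 1) (B - 1) (M - 2) = \<rho> A B M" for A B M
    unfolding J_def \<rho>_def by (rule square_indicator_diff(1))
  have \<rho>: "\<rho> A B M - \<rho> (A - 1) (B - 1) (M - 1) - \<rho> A B (M - 1) + \<rho> (A - 1) (B - 1) (M - 2)
       = of_bool (A = 0 \<and> B = 0 \<and> M = 0) - of_bool (A = 1 \<and> B = 1 \<and> M = 2)" for A B M
    unfolding \<rho>_def by (rule square_indicator_diff(2))
  have step: "e A B M - e (A - 1) (B - 1) (M - 2)
      = of_bool (A = 0 \<and> B = 0 \<and> M = 0) - of_bool (A = 1 \<and> B = 1 \<and> M = 2)" for A B M
  proof -
    let ?V = "\<lambda>A B M. V A B M - V (A - 1) B (M - 1) - V A (B - 1) (M - 1) + V (A - 1) (B - 1) (M - 2)"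
    let ?H = "\<lambda>A B M. H A B M - H (A - 1) (B - 1) (M - 1) - H A B (M - 1) + H (A - 1) (B - 1) (M - 2)"
    \<comment> \<open>The difference operators of \<open>V\<close> and of \<open>H\<close> commute; \<open>V + H\<close> is the indicator of the array.\<close>
    have comm: "?V A B M - ?V (A - 1) (B - 1) (M - 1) - ?V A B (M - 1) + ?V (A - 1) (B - 1) (M - 2)
        + (?H A B M - ?H (A - 1) B (M - 1) - ?H A (B - 1) (M - 1) + ?H (A - 1) (B - 1) (M - 2))
      = \<rho> A B M - \<rho> (A - 1) (B - 1) (M - 1) - \<rho> A B (M - 1) + \<rho> (A - 1) (B - 1) (M - 2)"
      unfolding J\<rho>[symmetric] VH[symmetric] by (simp add: diff_diff_eq)
    show ?thesis
      using comm unfolding V H \<rho> e_def by (simp add: field_simps diff_diff_eq)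
  qed
  have e0: "e A B M = 0" if "M < 0" for A B M
    unfolding e_def using that by (simp add: net_creation_outside)
  have "e A B M = of_bool (A = 0 \<and> B = 0 \<and> M = 0)" for A B M
  proof (induction "nat (M + 1)" arbitrary: A B M rule: less_induct)
    case less
    show ?case
    proof (cases "M < 0")
      case True
      then show ?thesis by (simp add: e0)
    next
      case False
      then have "e (A - 1) (B - 1) (M - 2) = of_bool (A - 1 = 0 \<and> B - 1 = 0 \<and> M - 2 = 0)"
        by (intro less) auto
      with step[of A B M] show ?thesis by simp
    qed
  qed
  from this[of A B M] show ?thesis unfolding e_def by simp
qed

section \<open>Krawtchouk coefficients\<close>

text \<open>This is the coefficient of \<open>z^i\<close> in \<open>(1 + z)^x (1 - z)^y\<close>;
  integer indices save case distinctions at 0.\<close>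

definition kraw :: "int \<Rightarrow> nat \<Rightarrow> nat \<Rightarrow> int" where
  "kraw i x y = (if i < 0 then 0 else coeff ([:1, 1:] ^ x * [:1, -1:] ^ y) (nat i))"

lemma coeff_mult_linear:
  fixes P :: "int poly"
  shows "(if i < 0 then 0 else coeff ([:1, c:] * P) (nat i))
    = (if i < 0 then 0 else coeff P (nat i)) + c * (if i - 1 < 0 then 0 else coeff P (nat (i - 1)))"
proof (cases "i \<le> 0")
  case True
  then show ?thesis by auto
next
  case False
  then obtain k where "i = int (Suc k)" by (metis not_le pos_int_cases Suc_pred')
  then show ?thesis by (simp add: nat_add_distrib)
qed

lemma kraw_Suc_left: "kraw i (Suc x) y = kraw i x y + kraw (i - 1) x y"
  using coeff_mult_linear[of i 1 "[:1, 1:] ^ x * [:1, -1:] ^ y"]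
  by (simp only: kraw_def power_Suc mult.assoc mult_1)

lemma kraw_Suc_right: "kraw i x (Suc y) = kraw i x y - kraw (i - 1) x y"
  using coeff_mult_linear[of i "-1" "[:1, 1:] ^ x * [:1, -1:] ^ y"]
  by (simp only: kraw_def power_Suc mult.left_commute[of _ "[:1, -1:]"])

lemma kraw_0_0: "kraw i 0 0 = of_bool (i = 0)"
  by (auto simp: kraw_def)

lemma kraw_neg: "i < 0 \<Longrightarrow> kraw i x y = 0"
  by (simp add: kraw_def)

lemma kraw_high: "i > int x + int y \<Longrightarrow> kraw i x y = 0"
proof (induction x arbitrary: i)
  case 0
  then show ?case
    by (induction y arbitrary: i) (simp_all add: kraw_0_0 kraw_Suc_right)
qed (simp add: kraw_Suc_left)

lemma kraw_const: "kraw 0 x y = 1"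
proof (induction x)
  case 0
  show ?case by (induction y) (simp_all add: kraw_0_0 kraw_Suc_right kraw_neg)
qed (simp add: kraw_Suc_left kraw_neg)

lemma kraw_top: "kraw (int x + int y) x y = (-1) ^ y"
proof (induction x)
  case 0
  show ?case by (induction y) (simp_all add: kraw_0_0 kraw_Suc_right kraw_high)
next
  case (Suc x)
  then show ?case using kraw_high[of x y "1 + (int x + int y)"] by (simp add: kraw_Suc_left add.assoc)
qed

text \<open>Both sides satisfy the same recurrence, which is symmetric in \<open>a\<close> and
  \<open>b\<close>; the generating function is \<open>1 / (1 - x - y + 2 x y)\<close>.\<close>

lemma kraw_symmetric: "kraw (int a) a b = kraw (int b) b a"
proof (induction a arbitrary: b)
  case 0
  show ?case using kraw_top[of b 0] by (simp add: kraw_const)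
next
  case (Suc a)
  note IH = this
  show ?case
  proof (induction b)
    case 0
    show ?case using kraw_top[of "Suc a" 0] by (simp add: kraw_const)
  next
    case (Suc b)
    have rec: "kraw (int (Suc a)) (Suc a) (Suc b)
        = kraw (int a) a (Suc b) + kraw (int (Suc a)) (Suc a) b - 2 * kraw (int a) a b" for a b
      by (simp add: kraw_Suc_left kraw_Suc_right algebra_simps)
    show ?case unfolding rec[of a b] rec[of b a] using IH[of "Suc b"] IH[of b] Suc by simp
  qed
qed

lemma kraw_balanced_Suc: "kraw i (Suc n) (Suc n) = kraw i n n - kraw (i - 2) n n"
  by (simp add: kraw_Suc_left kraw_Suc_right)

text \<open>Here \<open>(1 + z)^n (1 - z)^n\<close> is a polynomial in \<open>z^2\<close>.\<close>

lemma kraw_balanced_odd: "odd i \<Longrightarrow> kraw i n n = 0"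
proof (induction n arbitrary: i)
  case (Suc n)
  have "odd (i - 2)" using Suc.prems by simp
  then show ?case using Suc.IH Suc.prems by (simp add: kraw_balanced_Suc)
qed (auto simp: kraw_0_0)

lemma kraw_balanced_even: "kraw (2 * int t) n n = (-1) ^ t * int (n choose t)"
proof (induction n arbitrary: t)
  case 0
  then show ?case by (cases t) (auto simp: kraw_0_0)
next
  case (Suc n)
  show ?case
  proof (cases t)
    case 0
    then show ?thesis by (simp add: kraw_const)
  next
    case (Suc u)
    have "2 * int t - 2 = 2 * int u" using Suc by simp
    then show ?thesis using Suc Suc.IH[of t] Suc.IH[of u] by (simp add: kraw_balanced_Suc algebra_simps)
  qed
qed

text \<open>The Krawtchouk polynomial of degree \<open>A\<close> at \<open>B\<close> for the
  binomial distribution on \<open>0, ..., M\<close>, extended by 0 to all integers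
  \<open>B\<close>.\<close>

definition krawtchouk :: "int \<Rightarrow> int \<Rightarrow> int \<Rightarrow> int" where
  "krawtchouk A B M = (if 0 \<le> B \<and> B \<le> M then kraw A (nat (M - B)) (nat B) else 0)"

text \<open>Here one factor \<open>1 + z\<close> is split off, in \<open>krawtchouk_minus\<close>
  one factor \<open>1 - z\<close>.\<close>

lemma krawtchouk_plus: "0 \<le> B \<Longrightarrow> B < M \<Longrightarrow> krawtchouk A B M = krawtchouk A B (M - 1) + krawtchouk (A - 1) B (M - 1)"
proof -
  assume "0 \<le> B" "B < M"
  moreover from this have "nat (M - B) = Suc (nat (M - 1 - B))" by simp
  ultimately show ?thesis by (simp add: krawtchouk_def kraw_Suc_left)
qed

lemma krawtchouk_minus: "0 < B \<Longrightarrow> B \<le> M \<Longrightarrow> krawtchouk A B M = krawtchouk A (B - 1) (M - 1) - krawtchouk (A - 1) (B - 1) (M - 1)"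
proof -
  assume "0 < B" "B \<le> M"
  moreover from this have "nat B = Suc (nat (B - 1))" by simp
  ultimately show ?thesis by (simp add: krawtchouk_def kraw_Suc_right)
qed

lemma krawtchouk_outside: "\<not> (0 \<le> A \<and> A \<le> M \<and> 0 \<le> B \<and> B \<le> M) \<Longrightarrow> krawtchouk A B M = 0"
  by (auto simp: krawtchouk_def kraw_neg kraw_high)

lemma krawtchouk_0: "0 \<le> B \<Longrightarrow> B \<le> M \<Longrightarrow> krawtchouk 0 B M = 1"
  by (simp add: krawtchouk_def kraw_const)

lemma krawtchouk_top: "0 \<le> B \<Longrightarrow> B \<le> M \<Longrightarrow> krawtchouk M B M = (-1) ^ nat B"
  using kraw_top[of "nat (M - B)" "nat B"] by (simp add: krawtchouk_def)

lemma krawtchouk_symmetric: "0 \<le> A \<Longrightarrow> 0 \<le> B \<Longrightarrow> M = A + B \<Longrightarrow> krawtchouk A B M = krawtchouk B A M"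
  using kraw_symmetric[of "nat A" "nat B"] by (simp add: krawtchouk_def)

section \<open>Closed form of the net creation rates\<close>

definition krawtchouk_pair :: "int \<Rightarrow> int \<Rightarrow> int \<Rightarrow> int" where
  "krawtchouk_pair A B M = krawtchouk A B M * krawtchouk B A M"

lemma krawtchouk_pair_commute: "krawtchouk_pair A B M = krawtchouk_pair B A M"
  by (simp add: krawtchouk_pair_def)

lemma krawtchouk_pair_outside: "\<not> (0 \<le> A \<and> A \<le> M \<and> 0 \<le> B \<and> B \<le> M) \<Longrightarrow> krawtchouk_pair A B M = 0"
  by (simp add: krawtchouk_pair_def krawtchouk_outside)

lemma krawtchouk_pair_0: "krawtchouk_pair A 0 M = krawtchouk A 0 M"
proof (cases "0 \<le> A \<and> A \<le> M")
  case True
  then show ?thesis by (simp add: krawtchouk_pair_def krawtchouk_0)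
next
  case False
  then have "krawtchouk A 0 M = 0" by (intro krawtchouk_outside) auto
  then show ?thesis by (simp add: krawtchouk_pair_def)
qed

lemma krawtchouk_pair_top: "krawtchouk_pair A M M = (-1) ^ nat A * krawtchouk A M M"
proof (cases "0 \<le> A \<and> A \<le> M")
  case True
  then show ?thesis by (simp add: krawtchouk_pair_def krawtchouk_top)
next
  case False
  then have "krawtchouk A M M = 0" by (intro krawtchouk_outside) auto
  then show ?thesis by (simp add: krawtchouk_pair_def)
qed

text \<open>In the application, \<open>P\<close>, \<open>Q\<close>, \<open>R\<close>,
  \<open>S\<close> are the coefficients for \<open>M - 1\<close> at the four relevant points,
  \<open>K\<close> is the one for \<open>M\<close> and \<open>U\<close> the one for \<open>M -
  2\<close>; the primed letters belong to exchanged \<open>A\<close> and \<open>B\<close>.\<close>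

lemma creation_bilinear_identity:
  fixes K K' P P' Q Q' R R' S S' U U' :: int
  assumes "K = P + Q" "K = R - S" "Q + S = 2 * U" "K' = P' + R'" "K' = Q' - S'" "R' + S' = 2 * U'"
  shows "K * K' = S * S' + P * P' + Q * Q' + R * R' - 4 * (U * U')"
proof -
  have P: "P = R - S - Q" "P' = Q' - S' - R'" using assms by auto
  have "4 * (U * U') = (2 * U) * (2 * U')" by simp
  also have "\<dots> = (Q + S) * (R' + S')" using assms by simp
  finally show ?thesis unfolding assms(2,5) P by (simp add: algebra_simps)
qed

text \<open>On the boundary of the array one of the two relations between neighbouring
  coefficients fails. But one factor of the product is a sign there, and the recurrence reduces to
  the other relation.\<close>

lemma krawtchouk_pair_edge:
  assumes "M > 0" "B = 0 \<or> B = M"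
  shows "krawtchouk_pair A B M = krawtchouk_pair (A - 1) (B - 1) (M - 1) + krawtchouk_pair A B (M - 1) + krawtchouk_pair (A - 1) B (M - 1)
    + krawtchouk_pair A (B - 1) (M - 1) - 4 * krawtchouk_pair (A - 1) (B - 1) (M - 2)"
  using assms(2)
proof
  assume B: "B = 0"
  show ?thesis using assms(1) by (simp add: B krawtchouk_pair_0 krawtchouk_pair_outside krawtchouk_plus[of 0 M A])
next
  assume B: "B = M"
  have "krawtchouk_pair A M M = krawtchouk_pair (A - 1) (M - 1) (M - 1) + krawtchouk_pair A (M - 1) (M - 1)"
  proof (cases "A \<ge> 1")
    case True
    then have "nat A = Suc (nat (A - 1))" by simp
    then show ?thesis using assms(1) unfolding krawtchouk_pair_top by (simp add: krawtchouk_minus[of M M A] algebra_simps)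
  next
    case False
    then show ?thesis using assms(1) unfolding krawtchouk_pair_top by (simp add: krawtchouk_minus[of M M A] krawtchouk_outside[of "A - 1"])
  qed
  then show ?thesis by (simp add: B krawtchouk_pair_outside)
qed

lemma krawtchouk_pair_recurrence:
  assumes "M > 0"
  shows "krawtchouk_pair A B M = krawtchouk_pair (A - 1) (B - 1) (M - 1) + krawtchouk_pair A B (M - 1) + krawtchouk_pair (A - 1) B (M - 1)
    + krawtchouk_pair A (B - 1) (M - 1) - 4 * krawtchouk_pair (A - 1) (B - 1) (M - 2)"
proof -
  consider "\<not> (0 \<le> A \<and> A \<le> M \<and> 0 \<le> B \<and> B \<le> M)" | "B = 0 \<or> B = M" | "A = 0 \<or> A = M"
    | "0 < A" "A < M" "0 < B" "B < M"
    by linarith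
  then show ?thesis
  proof cases
    case 1
    then show ?thesis
      by (subst (1 2 3 4 5 6) krawtchouk_pair_outside; force)
  next
    case 2
    then show ?thesis using krawtchouk_pair_edge[OF assms] by blast
  next
    case 3
    from krawtchouk_pair_edge[OF assms this, of B] show ?thesis
      by (simp add: krawtchouk_pair_commute)
  next
    case 4
    have 1: "krawtchouk (A - 1) B (M - 1) + krawtchouk (A - 1) (B - 1) (M - 1) = 2 * krawtchouk (A - 1) (B - 1) (M - 2)"
      if "0 < B" "B < M" for A B
      using that krawtchouk_minus[of B "M - 1" "A - 1"] krawtchouk_plus[of "B - 1" "M - 1" "A - 1"] by simp
    show ?thesis
      unfolding krawtchouk_pair_def
    proof (rule creation_bilinear_identity)
      show "krawtchouk A B M = krawtchouk A B (M - 1) + krawtchouk (A - 1) B (M - 1)" using 4 by (intro krawtchouk_plus) auto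
      show "krawtchouk A B M = krawtchouk A (B - 1) (M - 1) - krawtchouk (A - 1) (B - 1) (M - 1)" using 4 by (intro krawtchouk_minus) auto
      show "krawtchouk B A M = krawtchouk B A (M - 1) + krawtchouk (B - 1) A (M - 1)" using 4 by (intro krawtchouk_plus) auto
      show "krawtchouk B A M = krawtchouk B (A - 1) (M - 1) - krawtchouk (B - 1) (A - 1) (M - 1)" using 4 by (intro krawtchouk_minus) auto
      show "krawtchouk (A - 1) B (M - 1) + krawtchouk (A - 1) (B - 1) (M - 1) = 2 * krawtchouk (A - 1) (B - 1) (M - 2)"
        using 4 by (intro 1)
      show "krawtchouk (B - 1) A (M - 1) + krawtchouk (B - 1) (A - 1) (M - 1) = 2 * krawtchouk (B - 1) (A - 1) (M - 2)"
        using 4 by (intro 1)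
    qed
  qed
qed

text \<open>Both sides satisfy the recurrence \<open>net_creation_recurrence\<close>, which
  determines its solution.\<close>

theorem net_creation_eq: "net_creation A B M = krawtchouk_pair A B M / 2 ^ nat M"
proof (induction "nat (M + 1)" arbitrary: A B M rule: less_induct)
  case less
  consider "M < 0" | "M = 0" | "M > 0" by linarith
  then show ?case
  proof cases
    case 1
    then show ?thesis by (simp add: net_creation_outside krawtchouk_pair_outside)
  next
    case 2
    have "net_creation A B 0 = of_bool (A = 0 \<and> B = 0)"
      by (subst net_creation_recurrence) (simp add: net_creation_outside)
    moreover have "krawtchouk_pair A B 0 = of_bool (A = 0 \<and> B = 0)"
    proof (cases "A = 0 \<and> B = 0")
      case True
      then show ?thesis by (simp add: krawtchouk_pair_0 krawtchouk_0)
    qed (auto intro!: krawtchouk_pair_outside)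
    ultimately show ?thesis using 2 by simp
  next
    case 3
    have IH1: "net_creation A B (M - 1) = 2 * (krawtchouk_pair A B (M - 1) / 2 ^ nat M)" for A B
    proof -
      have "nat M = Suc (nat (M - 1))" using 3 by simp
      then show ?thesis using less[of "M - 1" A B] 3 by simp
    qed
    have IH2: "net_creation A B (M - 2) = 4 * (krawtchouk_pair A B (M - 2) / 2 ^ nat M)" for A B
    proof (cases "M = 1")
      case True
      then show ?thesis by (simp add: net_creation_outside krawtchouk_pair_outside)
    next
      case False
      then have "nat M = Suc (Suc (nat (M - 2)))" using 3 by simp
      then show ?thesis using less[of "M - 2" A B] 3 by simp
    qed
    show ?thesis
      unfolding net_creation_recurrence[of A B M] IH1 IH2 krawtchouk_pair_recurrence[OF 3, of A B]
      using 3 by (simp add: add_divide_distrib diff_divide_distrib)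
  qed
qed

section \<open>Placement probabilities near the axis\<close>

text \<open>For \<open>M = A + B - 1\<close> both terms on the left satisfy
  \<open>going_step\<close> along the same direction, so that going from \<open>A - 1\<close> to
  \<open>A\<close> the difference changes by half a difference of net creation rates. With
  \<open>u\<close> and \<open>v\<close> as below, the claim reduces to \<open>u + v = 2
  v'\<close>.\<close>

lemma north_step_up:
  assumes "A \<ge> 0" "B \<ge> 1"
  shows "north A B (A + B - 1) - north (A - 1) B (A + B - 1)
    = krawtchouk B A (A + B - 1) * krawtchouk A B (A + B) / 2 ^ nat (A + B)"
  using assms(1)
proof (induction A rule: int_ge_induct)
  case base
  have "krawtchouk B 0 (B - 1) = 0" by (rule krawtchouk_outside) simp
  then show ?case by (simp add: north_outside)
next
  case (step A0)
  define A where "A = A0 + 1"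
  define M where "M = A + B - 1"
  define u v w v' K where "u = krawtchouk (A - 1) B M" and "v = krawtchouk B A M" and "w = krawtchouk (B - 1) (A - 1) (M - 1)"
    and "v' = krawtchouk B (A - 1) (M - 1)" and "K = krawtchouk A B M"
  have A: "A \<ge> 1" and M: "M \<ge> 1" using step(1) assms(2) by (simp_all add: A_def M_def)
  have y: "krawtchouk A B (A + B) = K + u"
    using krawtchouk_plus[of B "A + B" A] A assms(2) by (simp add: K_def u_def M_def)
  have u: "krawtchouk B (A - 1) M = u"
    unfolding u_def using A assms(2) by (intro krawtchouk_symmetric) (auto simp: M_def)
  moreover have "krawtchouk B (A - 1) M = v' + w"
    unfolding v'_def w_def using A assms(2) by (intro krawtchouk_plus) (auto simp: M_def)
  moreover have "v = v' - w"
    unfolding v_def v'_def w_def using A assms(2) by (intro krawtchouk_minus) (auto simp: M_def)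
  ultimately have uv: "u + v = 2 * v'" by simp
  have p: "nat (A + B) = Suc (nat M)" using M by (simp add: M_def)
  have "north A B M - north (A - 1) B M
      = north (A - 1) B (M - 1) - north (A - 1 - 1) B (M - 1)
        + net_creation A B M / 2 - net_creation (A - 1) B M / 2"
    using going_step(1)[of A B M] going_step(1)[of "A - 1" B M] by simp
  also have "north (A - 1) B (M - 1) - north (A - 1 - 1) B (M - 1) = v' * u / 2 ^ nat M"
    using step(2) by (simp add: A_def M_def v'_def u_def add.commute add.left_commute)
  also have "net_creation A B M = K * v / 2 ^ nat M"
    by (simp add: net_creation_eq krawtchouk_pair_def K_def v_def)
  also have "net_creation (A - 1) B M = u * u / 2 ^ nat M"
    by (simp add: net_creation_eq krawtchouk_pair_def u) (simp add: u_def)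
  also have "real_of_int (v' * u) / 2 ^ nat M + real_of_int (K * v) / 2 ^ nat M / 2 - real_of_int (u * u) / 2 ^ nat M / 2
      = real_of_int (2 * v' * u + K * v - u * u) / 2 ^ nat (A + B)"
    unfolding p by (simp add: add_divide_distrib diff_divide_distrib)
  also have "2 * v' * u + K * v - u * u = v * (K + u)"
    unfolding uv[symmetric] by (simp add: algebra_simps)
  finally have "north A B M - north (A - 1) B M = v * krawtchouk A B (A + B) / 2 ^ nat (A + B)"
    unfolding y .
  then show ?case by (simp add: M_def A_def v_def)
qed

text \<open>As for \<open>north_step_up\<close>; now the claim reduces to \<open>w = K + 2
  w'\<close> and \<open>v = v' - w'\<close>.\<close>

lemma north_step_down:
  assumes "A \<ge> 0" "B \<ge> 1"
  shows "north A (B - 1) (A + B - 1) - north A B (A + B - 1)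
    = krawtchouk A (B - 1) (A + B - 1) * (krawtchouk A (B - 1) (A + B - 1) - krawtchouk B A (A + B - 1)) / 2 ^ nat (A + B)"
  using assms(1)
proof (induction A rule: int_ge_induct)
  case base
  have "krawtchouk B 0 (B - 1) = 0" by (rule krawtchouk_outside) simp
  moreover have "krawtchouk 0 (B - 1) (B - 1) = 1" using assms(2) by (simp add: krawtchouk_0)
  moreover have "krawtchouk (B - 1) 0 (B - 1) = 1" using assms(2) krawtchouk_top[of 0 "B - 1"] by simp
  moreover have "nat B = Suc (nat (B - 1))" using assms(2) by simp
  ultimately show ?case
    using going_step(1)[of 0 "B - 1" "B - 1"]
    by (simp add: north_outside net_creation_eq krawtchouk_pair_def)
next
  case (step A0)
  define A where "A = A0 + 1"
  define M where "M = A + B - 1"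
  define w v w' v' K where "w = krawtchouk A (B - 1) M" and "v = krawtchouk B A M" and "w' = krawtchouk (A - 1) (B - 1) (M - 1)"
    and "v' = krawtchouk B (A - 1) (M - 1)" and "K = krawtchouk A B M"
  have A: "A \<ge> 1" and M: "M \<ge> 1" using step(1) assms(2) by (simp_all add: A_def M_def)
  have w: "krawtchouk (B - 1) A M = w"
    unfolding w_def using A assms(2) by (intro krawtchouk_symmetric) (auto simp: M_def)
  have w': "krawtchouk (B - 1) (A - 1) (M - 1) = w'"
    unfolding w'_def using A assms(2) by (intro krawtchouk_symmetric) (auto simp: M_def)
  have "K = krawtchouk A (B - 1) (M - 1) - w'"
    unfolding K_def w'_def using A assms(2) by (intro krawtchouk_minus) (auto simp: M_def)
  moreover have "w = krawtchouk A (B - 1) (M - 1) + w'"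
    unfolding w_def w'_def using A assms(2) by (intro krawtchouk_plus) (auto simp: M_def)
  ultimately have wK: "w = K + 2 * w'" by simp
  have v: "v = v' - w'"
    unfolding v_def v'_def w'[symmetric] using A assms(2) by (intro krawtchouk_minus) (auto simp: M_def)
  have p: "nat (A + B) = Suc (nat M)" using M by (simp add: M_def)
  have "north A (B - 1) M - north A B M
      = north (A - 1) (B - 1) (M - 1) - north (A - 1) B (M - 1)
        + net_creation A (B - 1) M / 2 - net_creation A B M / 2"
    using going_step(1)[of A B M] going_step(1)[of A "B - 1" M] by simp
  also have "north (A - 1) (B - 1) (M - 1) - north (A - 1) B (M - 1) = w' * (w' - v') / 2 ^ nat M"
    using step(2) by (simp add: A_def M_def v'_def w'_def add.commute add.left_commute)
  also have "net_creation A B M = K * v / 2 ^ nat M"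
    by (simp add: net_creation_eq krawtchouk_pair_def K_def v_def)
  also have "net_creation A (B - 1) M = w * w / 2 ^ nat M"
    by (simp add: net_creation_eq krawtchouk_pair_def w) (simp add: w_def)
  also have "real_of_int (w' * (w' - v')) / 2 ^ nat M + real_of_int (w * w) / 2 ^ nat M / 2 - real_of_int (K * v) / 2 ^ nat M / 2
      = real_of_int (2 * w' * (w' - v') + w * w - K * v) / 2 ^ nat (A + B)"
    unfolding p by (simp add: add_divide_distrib diff_divide_distrib)
  also have "2 * w' * (w' - v') + w * w - K * v = w * (w - v)"
    unfolding wK v by (simp add: algebra_simps)
  finally have "north A (B - 1) M - north A B M = w * (w - v) / 2 ^ nat (A + B)" .
  then show ?case by (simp add: M_def A_def v_def w_def)
qed

lemma krawtchouk_contiguous: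
  assumes "A \<ge> 0" "B \<ge> 1"
  shows "krawtchouk A B (A + B) = krawtchouk B A (A + B - 1) + krawtchouk A (B - 1) (A + B - 1)"
proof -
  have "krawtchouk A B (A + B) = krawtchouk B A (A + B)" using assms by (intro krawtchouk_symmetric) auto
  also have "\<dots> = krawtchouk B A (A + B - 1) + krawtchouk (B - 1) A (A + B - 1)"
    using assms by (intro krawtchouk_plus) auto
  also have "krawtchouk (B - 1) A (A + B - 1) = krawtchouk A (B - 1) (A + B - 1)"
    using assms by (intro krawtchouk_symmetric) auto
  finally show ?thesis .
qed

lemma north_step_axis:
  assumes "A \<ge> 0" "B \<ge> 1"
  shows "north A (B - 1) (A + B - 1) - north (A - 1) B (A + B - 1)
    = ((krawtchouk B A (A + B - 1))\<^sup>2 + (krawtchouk A (B - 1) (A + B - 1))\<^sup>2) / 2 ^ nat (A + B)"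
proof -
  let ?v = "krawtchouk B A (A + B - 1)" and ?w = "krawtchouk A (B - 1) (A + B - 1)"
  have "north A (B - 1) (A + B - 1) - north (A - 1) B (A + B - 1)
      = real_of_int (?v * (?v + ?w) + ?w * (?w - ?v)) / 2 ^ nat (A + B)"
    using north_step_up[OF assms] north_step_down[OF assms] krawtchouk_contiguous[OF assms]
    by (simp add: add_divide_distrib)
  also have "?v * (?v + ?w) + ?w * (?w - ?v) = ?v\<^sup>2 + ?w\<^sup>2"
    by (simp add: algebra_simps power2_eq_square)
  finally show ?thesis .
qed

lemma north_off_center:
  assumes "k \<ge> 1"
  shows "north k (k - 1) (2 * k - 1) = north (k - 1) (k - 1) (2 * k - 2)
    + (krawtchouk k (k - 1) (2 * k - 1))\<^sup>2 / 2 ^ nat (2 * k)"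
proof -
  have "krawtchouk (k - 1) k (2 * k - 1) = krawtchouk k (k - 1) (2 * k - 1)"
    using assms by (intro krawtchouk_symmetric) auto
  moreover have "nat (2 * k) = Suc (nat (2 * k - 1))" using assms by simp
  ultimately show ?thesis
    using going_step(1)[of k "k - 1" "2 * k - 1"]
    by (simp add: net_creation_eq krawtchouk_pair_def power2_eq_square)
qed

text \<open>The induction steps from the centre of the diamond of size \<open>2 k - 1\<close> to
  the one of size \<open>2 k + 1\<close> by way of two points next to the centre in size \<open>2
  k\<close>, using \<open>north_off_center\<close> and \<open>north_step_axis\<close>. It closes
  because one of the two coefficients \<open>e\<close> and \<open>f\<close> of \<open>(1 - z^2)^(k
  - 1)\<close> has odd index and vanishes.\<close>

lemma north_center:
  assumes "k \<ge> 0"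
  shows "north k k (2 * k) = 1 / 4 + (krawtchouk k k (2 * k))\<^sup>2 / 2 ^ nat (2 * k + 2)"
  using assms
proof (induction k rule: int_ge_induct)
  case base
  show ?case
    using going_step(1)[of 0 0 0] by (simp add: north_outside net_creation_eq krawtchouk_pair_def krawtchouk_0)
next
  case (step k0)
  define k where "k = k0 + 1"
  have k: "k \<ge> 1" using step(1) by (simp add: k_def)
  define e f v w y where "e = krawtchouk (k - 1) (k - 1) (2 * k - 2)" and "f = krawtchouk k (k - 1) (2 * k - 2)"
    and "v = krawtchouk k k (2 * k - 1)" and "w = krawtchouk k (k - 1) (2 * k - 1)" and "y = krawtchouk k k (2 * k)"
  have m: "2 * k - 1 - 1 = 2 * k - 2" by simp
  have v: "v = f - e"
    unfolding v_def f_def e_def m[symmetric] using k by (intro krawtchouk_minus) auto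
  have w: "w = f + e"
    unfolding w_def f_def e_def m[symmetric] using k by (intro krawtchouk_plus) auto
  have "y = v + w"
    unfolding v_def w_def y_def using krawtchouk_contiguous[of k k] k by (simp only: mult_2)
  then have y: "y = 2 * f" by (simp add: v w)
  have ef: "e * f = 0"
  proof (cases "odd k")
    case True
    then have "f = 0" using k kraw_balanced_odd[of k] by (simp add: f_def krawtchouk_def)
    then show ?thesis by simp
  next
    case False
    then have "odd (k - 1)" by simp
    then have "e = 0" using k kraw_balanced_odd[of "k - 1"] by (simp add: e_def krawtchouk_def)
    then show ?thesis by simp
  qed
  define p :: real where "p = 2 ^ nat (2 * k)"
  have p: "p > 0" by (simp add: p_def)
  have "k + k = 2 * k" by simp
  from north_step_axis[of k k, unfolded this] k
  have axis: "north k (k - 1) (2 * k - 1) - north (k - 1) k (2 * k - 1) = (v\<^sup>2 + w\<^sup>2) / p"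
    unfolding v_def[symmetric] w_def[symmetric] p_def[symmetric] by linarith
  have "north k k (2 * k) = north (k - 1) k (2 * k - 1) + net_creation k k (2 * k) / 2"
    using going_step(1)[of k k "2 * k"] by simp
  also have "net_creation k k (2 * k) = y\<^sup>2 / p"
    by (simp add: net_creation_eq krawtchouk_pair_def y_def power2_eq_square p_def)
  also have "north (k - 1) k (2 * k - 1) = north k (k - 1) (2 * k - 1) - (v\<^sup>2 + w\<^sup>2) / p"
    using axis by (simp add: algebra_simps)
  also have "north k (k - 1) (2 * k - 1) = north (k - 1) (k - 1) (2 * k - 2) + w\<^sup>2 / p"
    using north_off_center[OF k] by (simp add: w_def p_def)
  also have "north (k - 1) (k - 1) (2 * k - 2) = 1 / 4 + e\<^sup>2 / p"
    using step(2) by (simp add: k_def e_def p_def algebra_simps)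
  also have "1 / 4 + e\<^sup>2 / p + w\<^sup>2 / p - (v\<^sup>2 + w\<^sup>2) / p + y\<^sup>2 / p / 2
      = 1 / 4 + (4 * e\<^sup>2 - 4 * v\<^sup>2 + 2 * y\<^sup>2) / (4 * p)"
    by (simp add: add_divide_distrib diff_divide_distrib mult.commute)
  also have "4 * e\<^sup>2 - 4 * v\<^sup>2 + 2 * y\<^sup>2 = y\<^sup>2"
    using ef unfolding v y by (simp add: power2_eq_square algebra_simps)
  also have "4 * p = 2 ^ nat (2 * k + 2)"
    using k by (simp add: p_def nat_add_distrib)
  finally show ?case by (simp add: k_def y_def)
qed

section \<open>Quotients of sequences with polynomial denominators\<close>

text \<open>Eventually, \<open>F\<close> is \<open>b\<close> times a rational function with
  denominator \<open>X\<close>.\<close>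

definition ratio_by :: "(nat \<Rightarrow> rat) \<Rightarrow> rat poly \<Rightarrow> (nat \<Rightarrow> rat) \<Rightarrow> bool" where
  "ratio_by b X F \<longleftrightarrow> (\<exists>g. \<forall>\<^sub>F p in sequentially. F p * poly X (of_nat p) = b p * poly g (of_nat p))"

lemma ratio_by_cong:
  assumes "ratio_by b X F" "\<forall>\<^sub>F p in sequentially. G p = F p"
  shows "ratio_by b X G"
proof -
  obtain g where "\<forall>\<^sub>F p in sequentially. F p * poly X (of_nat p) = b p * poly g (of_nat p)"
    using assms(1) by (auto simp: ratio_by_def)
  with assms(2) have "\<forall>\<^sub>F p in sequentially. G p * poly X (of_nat p) = b p * poly g (of_nat p)"
    by eventually_elim simp
  then show ?thesis unfolding ratio_by_def by (rule exI)
qed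

lemma ratio_by_zero: "ratio_by b X (\<lambda>_. 0)"
  unfolding ratio_by_def by (rule exI[of _ 0]) simp

lemma ratio_by_add:
  assumes "ratio_by b X F" "ratio_by b X G"
  shows "ratio_by b X (\<lambda>p. F p + G p)"
proof -
  obtain f g where "\<forall>\<^sub>F p in sequentially. F p * poly X (of_nat p) = b p * poly f (of_nat p)"
    "\<forall>\<^sub>F p in sequentially. G p * poly X (of_nat p) = b p * poly g (of_nat p)"
    using assms by (auto simp: ratio_by_def)
  then have "\<forall>\<^sub>F p in sequentially. (F p + G p) * poly X (of_nat p) = b p * poly (f + g) (of_nat p)"
    by eventually_elim (simp add: algebra_simps)
  then show ?thesis unfolding ratio_by_def by (rule exI)
qed

lemma ratio_by_mult:
  assumes "ratio_by b X F" "ratio_by c Y G"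
  shows "ratio_by (\<lambda>p. b p * c p) (X * Y) (\<lambda>p. F p * G p)"
proof -
  obtain f g where "\<forall>\<^sub>F p in sequentially. F p * poly X (of_nat p) = b p * poly f (of_nat p)"
    "\<forall>\<^sub>F p in sequentially. G p * poly Y (of_nat p) = c p * poly g (of_nat p)"
    using assms by (auto simp: ratio_by_def)
  then have "\<forall>\<^sub>F p in sequentially. F p * G p * poly (X * Y) (of_nat p) = b p * c p * poly (f * g) (of_nat p)"
  proof eventually_elim
    case (elim p)
    have "F p * G p * poly (X * Y) (of_nat p) = (F p * poly X (of_nat p)) * (G p * poly Y (of_nat p))"
      by simp
    then show ?case unfolding elim by simp
  qed
  then show ?thesis unfolding ratio_by_def by (rule exI)
qed

text \<open>If \<open>G / F\<close> is the rational function \<open>n / d\<close>, the factor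
  \<open>d\<close> is the price for passing from \<open>F\<close> to \<open>G\<close>.\<close>

lemma ratio_by_step:
  assumes "ratio_by b X F" "\<forall>\<^sub>F p in sequentially. G p * poly d (of_nat p) = F p * poly n (of_nat p)"
  shows "ratio_by b (X * d) G"
proof -
  obtain f where "\<forall>\<^sub>F p in sequentially. F p * poly X (of_nat p) = b p * poly f (of_nat p)"
    using assms(1) by (auto simp: ratio_by_def)
  with assms(2) have "\<forall>\<^sub>F p in sequentially. G p * poly (X * d) (of_nat p) = b p * poly (f * n) (of_nat p)"
  proof eventually_elim
    case (elim p)
    have "G p * poly (X * d) (of_nat p) = (G p * poly d (of_nat p)) * poly X (of_nat p)" by simp
    also have "\<dots> = (F p * poly X (of_nat p)) * poly n (of_nat p)" unfolding elim(1) by simp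
    finally show ?case unfolding elim(2) by simp
  qed
  then show ?thesis unfolding ratio_by_def by (rule exI)
qed

lemma ratio_by_cmult: "ratio_by b X F \<Longrightarrow> ratio_by b X (\<lambda>p. c * F p)"
  using ratio_by_step[of b X F "\<lambda>p. c * F p" 1 "[:c:]"] by simp

lemma ratio_by_minus: "ratio_by b X F \<Longrightarrow> ratio_by b X (\<lambda>p. - F p)"
  using ratio_by_cmult[of b X F "-1"] by simp

lemma ratio_by_dvd:
  assumes "ratio_by b X F" "X dvd Y"
  shows "ratio_by b Y F"
proof -
  obtain Z where "Y = X * Z" using assms(2) by (elim dvdE)
  with ratio_by_step[OF assms(1), of F Z Z] show ?thesis by simp
qed

section \<open>Denominators of Krawtchouk coefficients\<close>

definition shifted_factors :: "nat \<Rightarrow> rat poly" where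
  "shifted_factors e = (\<Prod>i=1..e. [:of_nat i, 1:])"

definition odd_factors :: "nat \<Rightarrow> rat poly" where
  "odd_factors s = (\<Prod>j=1..s. [:1 - 2 * of_nat j, 2:])"

lemma shifted_factors_Suc: "shifted_factors (Suc e) = shifted_factors e * [:of_nat (Suc e), 1:]"
  by (simp add: shifted_factors_def mult.commute)

lemma odd_factors_Suc: "odd_factors (Suc s) = odd_factors s * [:1 - 2 * of_nat (Suc s), 2:]"
  by (simp add: odd_factors_def mult.commute)

lemma shifted_factors_0 [simp]: "shifted_factors 0 = 1" and odd_factors_0 [simp]: "odd_factors 0 = 1"
  by (simp_all add: shifted_factors_def odd_factors_def)

lemma shifted_factors_dvd: "e \<le> e' \<Longrightarrow> shifted_factors e dvd shifted_factors e'"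
  unfolding shifted_factors_def by (rule prod_dvd_prod_subset) auto

lemma odd_factors_dvd: "s \<le> s' \<Longrightarrow> odd_factors s dvd odd_factors s'"
  unfolding odd_factors_def by (rule prod_dvd_prod_subset) auto

lemma shifted_factors_nonzero: "shifted_factors e \<noteq> 0" and odd_factors_nonzero: "odd_factors s \<noteq> 0"
  by (auto simp: shifted_factors_def odd_factors_def)

definition central :: "nat \<Rightarrow> rat" where
  "central p = of_nat ((2 * p - 1) choose p)"

lemma central_binomial: "p > 0 \<Longrightarrow> of_nat ((2 * p) choose p) = 2 * central p"
proof -
  assume "p > 0"
  then obtain k where k: "p = Suc k" by (metis Suc_pred')
  have "(2 * p) choose p = ((2 * p - 1) choose k) + ((2 * p - 1) choose p)"
    using k by (simp add: binomial_Suc_Suc[of "Suc (2 * k)" k, simplified])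
  moreover have "(2 * p - 1) choose k = (2 * p - 1) choose p"
    using k binomial_symmetric[of k "2 * p - 1"] by simp
  ultimately show ?thesis by (simp add: central_def)
qed

lemma fact_falling:
  "k \<le> n \<Longrightarrow> (fact n :: rat) = fact (n - k) * (\<Prod>i<k. of_nat n - of_nat i)"
proof (induction k)
  case (Suc k)
  then have "n - k = Suc (n - Suc k)" by simp
  then have "(fact (n - k) :: rat) = of_nat (n - k) * fact (n - Suc k)" by simp
  with Suc show ?case by (simp add: of_nat_diff mult_ac)
qed simp

text \<open>The even factors of the falling factorial of \<open>2 x\<close> give a falling
  factorial of \<open>x\<close>, the odd ones are collected in \<open>odd_factors\<close>.\<close>

lemma falling_even_odd:
  "(\<Prod>i<q. 2 * x - of_nat i) = 2 ^ ((q + 1) div 2) * (\<Prod>j<(q + 1) div 2. x - of_nat j) * poly (odd_factors (q div 2)) x"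
proof (induction q)
  case (Suc q)
  show ?case
  proof (cases "even q")
    case True
    then obtain h where h: "q = 2 * h" by (elim evenE)
    have "2 ^ h * E * Od * (2 * x - of_nat q) = 2 ^ Suc h * (E * (x - of_nat h)) * Od" for E Od
      by (simp add: h algebra_simps)
    moreover have "(q + 1) div 2 = h" "(Suc q + 1) div 2 = Suc h" "Suc q div 2 = h" "q div 2 = h"
      by (simp_all add: h)
    ultimately show ?thesis using Suc by (simp only: prod.lessThan_Suc)
  next
    case False
    then obtain h where h: "q = 2 * h + 1" by (elim oddE)
    have "2 ^ Suc h * E * Od * (2 * x - of_nat q) = 2 ^ Suc h * E * (Od * (1 - 2 * of_nat (Suc h) + x * 2))" for E Od
      by (simp add: h algebra_simps)
    moreover have "(q + 1) div 2 = Suc h" "(Suc q + 1) div 2 = Suc h" "Suc q div 2 = Suc h" "q div 2 = h"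
      by (simp_all add: h)
    ultimately show ?thesis
      using Suc by (simp only: prod.lessThan_Suc odd_factors_Suc poly_mult poly_pCons poly_0 mult_zero_right add_0_right)
  qed
qed simp

text \<open>Expanding into factorials, the even factors of \<open>(2 p)! / (2 p - q)!\<close>
  appear in the denominator. They cancel against \<open>p! / (p - x)!\<close> or \<open>p! / (p -
  y)!\<close>, where \<open>x + y = q\<close>: one of \<open>x\<close> and \<open>y\<close> is at
  least \<open>(q + 1) div 2\<close>. So only odd factors survive.\<close>

lemma ratio_by_central_below:
  assumes "x \<le> q"
  shows "ratio_by central (odd_factors (q div 2)) (\<lambda>p. of_nat ((2 * p - q) choose (p - x)))"
proof -
  define y where "y = q - x"
  define c where "c = (q + 1) div 2"
  define E where "E k p = (\<Prod>j<k. of_nat p - of_nat j :: rat)" for k p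
  define X where "X = max x y"
  define Y where "Y = min x y"
  have XY: "E x p * E y p = E X p * E Y p" for p
    by (simp add: X_def Y_def max_def min_def mult.commute)
  have cX: "c \<le> X" unfolding c_def X_def y_def using assms by auto
  define g :: "rat poly" where "g = smult (2 / 2 ^ c) ((\<Prod>j=c..<X. [:- of_nat j, 1:]) * (\<Prod>j<Y. [:- of_nat j, 1:]))"
  have "of_nat ((2 * p - q) choose (p - x)) * poly (odd_factors (q div 2)) (of_nat p)
      = central p * poly g (of_nat p)" if p: "p > q" for p
  proof -
    have pq: "q \<le> 2 * p" "x \<le> p" "y \<le> p" using p assms by (auto simp: y_def)
    have f1: "(fact (2 * p) :: rat) = fact (2 * p - q) * (2 ^ c * E c p * poly (odd_factors (q div 2)) (of_nat p))"
      using fact_falling[OF pq(1)] falling_even_odd[of "of_nat p" q] by (simp add: E_def c_def)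
    have f2: "(fact p :: rat) = fact (p - x) * E x p" "(fact p :: rat) = fact (p - y) * E y p"
      using fact_falling[OF pq(2)] fact_falling[OF pq(3)] by (simp_all add: E_def)
    have nz: "E k p \<noteq> 0" if "k \<le> p" for k using that by (auto simp: E_def)
    have b1: "of_nat ((2 * p - q) choose (p - x)) = (fact (2 * p - q) / (fact (p - x) * fact (p - y)) :: rat)"
    proof -
      have "2 * p - q - (p - x) = p - y" using pq assms by (simp add: y_def)
      moreover have "p - x \<le> 2 * p - q" using pq assms p by simp
      ultimately show ?thesis by (simp add: binomial_fact)
    qed
    have b2: "2 * central p = (fact (2 * p) / (fact p * fact p) :: rat)"
      using central_binomial[of p] p by (simp add: binomial_fact)
    have ff: "fact p * fact p = (fact (p - x) * E x p) * (fact (p - y) * E y p)"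
      by (simp only: f2(1)[symmetric] f2(2)[symmetric])
    \<comment> \<open>The larger of \<open>x\<close> and \<open>y\<close> provides the even factors that have to be cancelled.\<close>
    have EX: "E X p = E c p * (\<Prod>j=c..<X. of_nat p - of_nat j)"
      unfolding E_def using cX by (metis prod.atLeastLessThan_concat le0 lessThan_atLeast0)
    have "E c p * (of_nat ((2 * p - q) choose (p - x)) * poly (odd_factors (q div 2)) (of_nat p) * 2 ^ c)
        = fact (2 * p) / (fact (p - x) * fact (p - y))"
      unfolding b1 f1 by simp
    also have "\<dots> = 2 * central p * (E x p * E y p)"
      unfolding b2 ff using nz[of x] nz[of y] pq by simp
    also have "\<dots> = E c p * (2 * central p * (\<Prod>j=c..<X. of_nat p - of_nat j) * E Y p)"
      unfolding XY EX by (simp add: mult_ac)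
    finally have "of_nat ((2 * p - q) choose (p - x)) * poly (odd_factors (q div 2)) (of_nat p) * 2 ^ c
        = 2 * central p * (\<Prod>j=c..<X. of_nat p - of_nat j) * E Y p"
      using nz[of c] p by (simp add: c_def)
    moreover have "poly g (of_nat p) * 2 ^ c = 2 * (\<Prod>j=c..<X. of_nat p - of_nat j) * E Y p"
      by (simp add: g_def E_def poly_prod)
    ultimately have "(of_nat ((2 * p - q) choose (p - x)) * poly (odd_factors (q div 2)) (of_nat p)) * 2 ^ c
        = (central p * poly g (of_nat p)) * 2 ^ c"
      by (simp add: mult_ac)
    then show ?thesis by simp
  qed
  then show ?thesis
    unfolding ratio_by_def by (intro exI[of _ g]) (auto simp: eventually_at_top_linorder intro!: exI[of _ "Suc q"])
qed

lemma binomial_Suc_ratio: "Suc k * (n choose Suc k) = (n - k) * (n choose k)"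
  by (simp only: binomial_absorption binomial_absorb_comp)

lemma ratio_by_shift:
  assumes "ratio_by b X (\<lambda>p. of_nat (nat (2 * int p - q) choose (p + t)))"
  shows "ratio_by b (X * [:of_nat (Suc t), 1:]) (\<lambda>p. of_nat (nat (2 * int p - q) choose (p + Suc t)))"
proof (rule ratio_by_step[OF assms, where n = "[:of_int (- q - int t), 1:]"])
  have "of_nat (nat (2 * int p - q) choose (p + Suc t)) * poly [:of_nat (Suc t), 1:] (of_nat p)
      = (of_nat (nat (2 * int p - q) choose (p + t)) * poly [:of_int (- q - int t), 1:] (of_nat p) :: rat)"
    if "int p \<ge> q + int t" "int p \<ge> q" for p
  proof -
    let ?n = "nat (2 * int p - q)"
    have "rat_of_nat (Suc (p + t)) * of_nat (?n choose Suc (p + t)) = of_nat (?n - (p + t)) * of_nat (?n choose (p + t))"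
      unfolding of_nat_mult[symmetric] binomial_Suc_ratio ..
    moreover have "rat_of_nat (?n - (p + t)) = of_int (int p - q - int t)"
    proof -
      have "int (?n - (p + t)) = int p - q - int t" using that by simp
      then show ?thesis by (metis of_int_of_nat_eq)
    qed
    ultimately show ?thesis by (simp add: algebra_simps)
  qed
  then show "\<forall>\<^sub>F p in sequentially. of_nat (nat (2 * int p - q) choose (p + Suc t)) * poly [:of_nat (Suc t), 1:] (of_nat p)
      = (of_nat (nat (2 * int p - q) choose (p + t)) * poly [:of_int (- q - int t), 1:] (of_nat p) :: rat)"
    by (auto simp: eventually_at_top_linorder intro!: exI[of _ "nat (\<bar>q\<bar> + int t)"])
qed

text \<open>For \<open>t \<le> 0\<close> this is \<open>ratio_by_central_below\<close>, and each
  step from \<open>t\<close> to \<open>t + 1\<close> contributes the factor \<open>p + t +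
  1\<close>. For \<open>q = -1\<close> the walk starts at \<open>t = 1\<close>.\<close>

lemma ratio_by_binomial:
  assumes q: "q \<ge> -1" and t: "t \<ge> - q" "t \<le> int e" and s: "q \<le> 2 * int s + 1"
  shows "ratio_by central (shifted_factors e * odd_factors s)
    (\<lambda>p. of_nat (nat (2 * int p - q) choose nat (int p + t)))"
proof -
  have up: "ratio_by central (shifted_factors t * odd_factors (nat q div 2))
      (\<lambda>p. of_nat (nat (2 * int p - q) choose (p + t)))" if "int t \<ge> - q" for t
    using that
  proof (induction t)
    case 0
    then have "nat (2 * int p - q) = 2 * p - nat q" for p by (simp add: nat_diff_distrib nat_mult_distrib)
    then show ?case using ratio_by_central_below[of 0 "nat q"] by simp
  next
    case (Suc t)
    show ?case
    proof (cases "int t \<ge> - q")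
      case True
      show ?thesis
        using ratio_by_shift[OF Suc.IH[OF True]]
        by (simp only: shifted_factors_Suc mult.assoc mult.commute[of "odd_factors _"])
    next
      case False
      with Suc.prems q have qt: "q = -1" "t = 0" by auto
      have "ratio_by central (1 * [:1, 1:]) (\<lambda>p. of_nat (Suc (2 * p) choose Suc p))"
      proof (rule ratio_by_step)
        show "ratio_by central 1 (\<lambda>p. of_nat ((2 * p) choose p))"
          using ratio_by_central_below[of 0 0] by simp
        have "of_nat (Suc (2 * p) choose Suc p) * poly [:1, 1:] (of_nat p)
            = (of_nat ((2 * p) choose p) * poly [:1, 2:] (of_nat p) :: rat)" for p
        proof -
          have "rat_of_nat (Suc p) * of_nat (Suc (2 * p) choose Suc p) = of_nat (Suc (2 * p)) * of_nat ((2 * p) choose p)"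
            unfolding of_nat_mult[symmetric] by (simp only: Suc_times_binomial_eq mult.commute)
          then show ?thesis by (simp add: algebra_simps)
        qed
        then show "\<forall>\<^sub>F p in sequentially. of_nat (Suc (2 * p) choose Suc p) * poly [:1, 1:] (of_nat p)
            = (of_nat ((2 * p) choose p) * poly [:1, 2:] (of_nat p) :: rat)" by simp
      qed
      moreover have "nat (2 * int p + 1) = Suc (2 * p)" for p by simp
      ultimately show ?thesis by (simp add: qt shifted_factors_Suc)
    qed
  qed
  have dvd: "X dvd shifted_factors e * odd_factors s"
    if "X dvd shifted_factors e * odd_factors (nat q div 2)" for X
  proof -
    have "nat q div 2 \<le> s" using s by linarith
    then show ?thesis using that by (meson dvd_trans mult_dvd_mono dvd_refl odd_factors_dvd)
  qed
  show ?thesis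
  proof (cases "t \<ge> 0")
    case True
    then have "nat (int p + t) = p + nat t" for p by simp
    moreover have "shifted_factors (nat t) * odd_factors (nat q div 2) dvd shifted_factors e * odd_factors (nat q div 2)"
      using t by (intro mult_dvd_mono shifted_factors_dvd) auto
    ultimately show ?thesis
      using ratio_by_dvd[OF up[of "nat t"] dvd] True t by simp
  next
    case False
    have "nat (2 * int p - q) = 2 * p - nat q" "nat (int p + t) = p - nat (- t)" for p
      using False t by (simp_all add: nat_diff_distrib nat_mult_distrib)
    then show ?thesis
      using ratio_by_dvd[OF ratio_by_central_below[of "nat (- t)" "nat q"] dvd] False t by simp
  qed
qed

text \<open>The coefficients of powers of \<open>1 - z^2\<close> carry the sign \<open>(-1) ^
  p\<close>, which is not a rational function; it disappears in products of two
  coefficients.\<close>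

definition signed_central :: "nat \<Rightarrow> rat" where
  "signed_central p = (-1) ^ p * central p"

text \<open>By induction on \<open>j\<close>, splitting off a factor \<open>1 + z\<close>,
  everything is reduced to \<open>j = - q\<close>, that is, to coefficients of \<open>(1 - z^2)^(2
  p - q)\<close>. The hypothesis \<open>j \<le> q + i + 1\<close> ensures that only binomial
  coefficients with \<open>t \<ge> - q\<close> arise.\<close>

lemma ratio_by_kraw:
  assumes "q \<ge> -1" "j \<ge> - q" "j \<le> q + i + 1" "i \<le> 2 * int e + 1" "q \<le> 2 * int s + 1"
  shows "ratio_by signed_central (shifted_factors e * odd_factors s)
    (\<lambda>p. of_int (kraw (2 * int p + i) (nat (2 * int p + j)) (nat (2 * int p - q))))"
  using assms(2-4)
proof (induction j arbitrary: i rule: int_ge_induct)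
  case base
  show ?case
  proof (cases "even i")
    case False
    then show ?thesis by (simp add: kraw_balanced_odd ratio_by_zero)
  next
    case True
    then obtain t where t: "i = 2 * t" by (elim evenE)
    have "ratio_by central (shifted_factors e * odd_factors s)
        (\<lambda>p. of_nat (nat (2 * int p - q) choose nat (int p + t)))"
      using base assms(1,5) t by (intro ratio_by_binomial) auto
    moreover have "ratio_by (\<lambda>p. (-1) ^ p) 1 (\<lambda>p. (-1) ^ p * (-1) ^ nat \<bar>t\<bar>)"
      unfolding ratio_by_def by (rule exI[of _ "[:(-1) ^ nat \<bar>t\<bar>:]"]) simp
    ultimately have "ratio_by (\<lambda>p. (-1) ^ p * central p) (1 * (shifted_factors e * odd_factors s))
        (\<lambda>p. (-1) ^ p * (-1) ^ nat \<bar>t\<bar> * of_nat (nat (2 * int p - q) choose nat (int p + t)))"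
      by (intro ratio_by_mult)
    then have "ratio_by signed_central (shifted_factors e * odd_factors s)
        (\<lambda>p. (-1) ^ p * (-1) ^ nat \<bar>t\<bar> * of_nat (nat (2 * int p - q) choose nat (int p + t)))"
      by (simp add: signed_central_def[abs_def])
    moreover have "of_int (kraw (2 * int p + i) (nat (2 * int p + - q)) (nat (2 * int p - q)))
        = ((-1) ^ p * (-1) ^ nat \<bar>t\<bar> * of_nat (nat (2 * int p - q) choose nat (int p + t)) :: rat)"
      if "p \<ge> nat \<bar>t\<bar>" for p
    proof -
      have "2 * int p + i = 2 * int (nat (int p + t))" using that by (simp add: t)
      then have "kraw (2 * int p + i) (nat (2 * int p - q)) (nat (2 * int p - q))
          = (-1) ^ nat (int p + t) * int (nat (2 * int p - q) choose nat (int p + t))"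
        by (simp only: kraw_balanced_even)
      moreover have "(-1) ^ nat (int p + t) = ((-1) ^ p * (-1) ^ nat \<bar>t\<bar> :: rat)"
      proof (cases "t \<ge> 0")
        case True
        then show ?thesis by (simp add: nat_add_distrib power_add)
      next
        case False
        then have "p = nat (int p + t) + nat \<bar>t\<bar>" using that by simp
        then have "(-1) ^ p = ((-1) ^ nat (int p + t) * (-1) ^ nat \<bar>t\<bar> :: rat)" by (metis power_add)
        then show ?thesis by (simp add: mult.assoc power_mult_distrib[symmetric])
      qed
      ultimately show ?thesis by simp
    qed
    ultimately show ?thesis
      by (elim ratio_by_cong) (auto simp: eventually_at_top_linorder)
  qed
next
  case (step j)
  have "ratio_by signed_central (shifted_factors e * odd_factors s)
      (\<lambda>p. of_int (kraw (2 * int p + i) (nat (2 * int p + j)) (nat (2 * int p - q)))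
         + of_int (kraw (2 * int p + (i - 1)) (nat (2 * int p + j)) (nat (2 * int p - q))))"
    using step.prems by (intro ratio_by_add step.IH) auto
  then show ?case
  proof (rule ratio_by_cong)
    have "of_int (kraw (2 * int p + i) (nat (2 * int p + (j + 1))) (nat (2 * int p - q)))
      = (of_int (kraw (2 * int p + i) (nat (2 * int p + j)) (nat (2 * int p - q)))
         + of_int (kraw (2 * int p + (i - 1)) (nat (2 * int p + j)) (nat (2 * int p - q))) :: rat)"
      if "p \<ge> nat \<bar>j\<bar>" for p
    proof -
      have "nat (2 * int p + (j + 1)) = Suc (nat (2 * int p + j))" using that by simp
      then show ?thesis by (simp add: kraw_Suc_left add_diff_eq)
    qed
    then show "\<forall>\<^sub>F p in sequentially. of_int (kraw (2 * int p + i) (nat (2 * int p + (j + 1))) (nat (2 * int p - q)))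
      = (of_int (kraw (2 * int p + i) (nat (2 * int p + j)) (nat (2 * int p - q)))
         + of_int (kraw (2 * int p + (i - 1)) (nat (2 * int p + j)) (nat (2 * int p - q))) :: rat)"
      by (auto simp: eventually_at_top_linorder)
  qed
qed

section \<open>The minimal denominator\<close>

lemma eventually_poly_nonzero:
  assumes "X \<noteq> (0 :: rat poly)"
  shows "\<forall>\<^sub>F p in sequentially. poly X (of_nat p) \<noteq> 0"
proof -
  have "finite (of_nat -` {x. poly X x = 0} :: nat set)"
    using poly_roots_finite[OF assms] by (rule finite_vimageI) (simp add: inj_on_def)
  moreover have "(of_nat -` {x. poly X x = 0} :: nat set) = {p. \<not> poly X (of_nat p) \<noteq> 0}" by auto
  ultimately show ?thesis
    unfolding cofinite_eq_sequentially[symmetric] eventually_cofinite by simp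
qed

lemma poly_eqI_eventually:
  assumes "\<forall>\<^sub>F p in sequentially. poly f (of_nat p) = poly g (of_nat p :: rat)"
  shows "f = g"
proof (rule ccontr)
  assume "f \<noteq> g"
  then have "\<forall>\<^sub>F p in sequentially. poly (f - g) (of_nat p) \<noteq> 0"
    by (intro eventually_poly_nonzero) simp
  with assms have "\<forall>\<^sub>F p in sequentially. False" by eventually_elim simp
  then show False by simp
qed

lemma eval_ratfun_Fract:
  assumes "X \<noteq> 0"
  shows "\<forall>\<^sub>F p in sequentially. eval_ratfun (Fract g X) (of_nat p) = poly g (of_nat p) / poly X (of_nat p)"
proof -
  define n d where "n = fst (quot_of_fract (Fract g X))" and "d = snd (quot_of_fract (Fract g X))"
  have d: "d \<noteq> 0" by (simp add: d_def)
  have "Fract n d = Fract g X" by (simp add: n_def d_def Fract_quot_of_fract)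
  then have "n * X = g * d" using d assms by (simp add: eq_fract)
  then have "poly n x * poly X x = poly g x * poly d x" for x by (metis poly_mult)
  then have eval: "eval_ratfun (Fract g X) x = poly g x / poly X x" if "poly d x \<noteq> 0" "poly X x \<noteq> 0" for x
    unfolding eval_ratfun_def n_def[symmetric] d_def[symmetric] using that by (simp add: frac_eq_eq)
  from eventually_poly_nonzero[OF d] eventually_poly_nonzero[OF assms] show ?thesis
    by eventually_elim (rule eval)
qed

text \<open>Cross-multiplied, two rational functions that eventually agree give two polynomials
  that agree at infinitely many points.\<close>

lemma eval_ratfun_inject:
  assumes "\<forall>\<^sub>F p in sequentially. eval_ratfun f (of_nat p) = eval_ratfun g (of_nat p)"
  shows "f = g"
proof -
  define n d n' d' where "n = fst (quot_of_fract f)" and "d = snd (quot_of_fract f)"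
    and "n' = fst (quot_of_fract g)" and "d' = snd (quot_of_fract g)"
  have d: "d \<noteq> 0" "d' \<noteq> 0" by (simp_all add: d_def d'_def)
  from assms eventually_poly_nonzero[OF d(1)] eventually_poly_nonzero[OF d(2)]
  have "\<forall>\<^sub>F p in sequentially. poly (n * d') (of_nat p) = poly (n' * d) (of_nat p :: rat)"
    unfolding eval_ratfun_def n_def[symmetric] d_def[symmetric] n'_def[symmetric] d'_def[symmetric]
    by eventually_elim (simp add: frac_eq_eq)
  then have "n * d' = n' * d" by (rule poly_eqI_eventually)
  then have "Fract n d = Fract n' d'" using d by (simp add: eq_fract)
  then show ?thesis by (simp add: n_def d_def n'_def d'_def Fract_quot_of_fract)
qed

lemma denominator_Fract_dvd:
  assumes "X \<noteq> (0 :: rat poly)"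
  shows "snd (quot_of_fract (Fract g X)) dvd X"
proof -
  define n d where "n = fst (quot_of_fract (Fract g X))" and "d = snd (quot_of_fract (Fract g X))"
  have d: "d \<noteq> 0" by (simp add: d_def)
  have "Fract n d = Fract g X" by (simp add: n_def d_def Fract_quot_of_fract)
  then have "n * X = g * d" using d assms by (simp add: eq_fract)
  then have "d dvd n * X" by simp
  moreover have "coprime d n"
    unfolding n_def d_def by (subst coprime_commute) (rule coprime_quot_of_fract)
  ultimately show ?thesis unfolding d_def[symmetric] by (simp add: coprime_dvd_mult_right_iff)
qed

text \<open>The deviation of the placement probability from \<open>1 / 4\<close> is described by a
  rational function with denominator \<open>X\<close>.\<close>

definition deviation_ratio :: "int \<Rightarrow> int \<Rightarrow> nat \<Rightarrow> rat poly \<Rightarrow> bool" where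
  "deviation_ratio l m \<alpha> X \<longleftrightarrow> (\<exists>F. ratio_by (\<lambda>p. (central p)\<^sup>2) X F \<and>
     (\<forall>\<^sub>F p in sequentially. aztec_prob l m (4 * p + \<alpha>) = 1 / 4 + of_rat (F p) / 2 ^ (4 * p + \<alpha>)))"

text \<open>The given representation with denominator \<open>X\<close> proves existence of the
  rational function, and \<open>eval_ratfun_inject\<close> its uniqueness; in lowest terms the
  denominator divides \<open>X\<close>.\<close>

lemma aztec_denominator_dvd:
  assumes "deviation_ratio l m \<alpha> X" "X \<noteq> 0"
  shows "aztec_denominator l m \<alpha> dvd X"
proof -
  obtain F g where F: "\<forall>\<^sub>F p in sequentially. F p * poly X (of_nat p) = (central p)\<^sup>2 * poly g (of_nat p)"
    and prob: "\<forall>\<^sub>F p in sequentially. aztec_prob l m (4 * p + \<alpha>) = 1 / 4 + of_rat (F p) / 2 ^ (4 * p + \<alpha>)"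
    using assms(1) by (auto simp: deviation_ratio_def ratio_by_def)
  let ?P = "\<lambda>f. \<forall>\<^sub>F p in sequentially. aztec_prob l m (4 * p + \<alpha>) =
       1 / 4 + 1 / 2 ^ (4 * p + \<alpha>) * (real ((2 * p - 1) choose p))\<^sup>2 * of_rat (eval_ratfun f (of_nat p))"
  have central: "real ((2 * p - 1) choose p) = of_rat (central p)" for p
    by (simp add: central_def)
  have ex: "?P (Fract g X)"
    using F prob eval_ratfun_Fract[OF assms(2), of g] eventually_poly_nonzero[OF assms(2)]
  proof eventually_elim
    case (elim p)
    have "F p = (central p)\<^sup>2 * eval_ratfun (Fract g X) (of_nat p)"
      using elim(1,4) unfolding elim(3) by (simp add: eq_divide_eq)
    then show ?case unfolding elim(2) central by (simp add: of_rat_mult of_rat_power)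
  qed
  have "f = Fract g X" if "?P f" for f
  proof (rule eval_ratfun_inject)
    show "\<forall>\<^sub>F p in sequentially. eval_ratfun f (of_nat p) = eval_ratfun (Fract g X) (of_nat p)"
      using that ex eventually_gt_at_top[of 0]
    proof eventually_elim
      case (elim p)
      have "(2 * p - 1) choose p \<noteq> 0" using elim(3) by simp
      then show ?case using elim(1,2) by simp
    qed
  qed
  with ex have "aztec_ratfun l m \<alpha> = Fract g X"
    unfolding aztec_ratfun_def by (intro the_equality)
  then show ?thesis
    unfolding aztec_denominator_def by (simp add: denominator_Fract_dvd[OF assms(2)])
qed

text \<open>The colour condition selects the dominoes that are top edges of blocks.\<close>

lemma aztec_prob_eq_north:
  assumes "n > 0" "M = int n - 1"
  shows "aztec_prob (A + B - M) (A - B) n = north A B M"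
proof -
  let ?S = "domino_tilings (aztec_diamond n)"
  let ?d = "top_edge (rotated A B M)"
  have S: "finite ?S" "?S \<noteq> {}"
    using aztec_tilings_exist[of n] by (auto intro: card_ge_0_finite)
  have black: "black_square n (A + B - M - 1, A - B)"
    using assms(2) by (simp add: black_square_def)
  have d: "{(A + B - M - 1, A - B), (A + B - M, A - B)} = ?d"
    by (simp add: rotated_def)
  have "aztec_prob (A + B - M) (A - B) n = measure_pmf.prob (pmf_of_set ?S) {T. ?d \<in> T}"
    unfolding aztec_prob_def d using black by simp
  also have "\<dots> = card (?S \<inter> {T. ?d \<in> T}) / card ?S"
    by (rule measure_pmf_of_set[OF S(2,1)])
  also have "?S \<inter> {T. ?d \<in> T} = {T \<in> ?S. ?d \<in> T}" by auto
  also have "nat (M + 1) = n" using assms(2) by simp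
  then have "card {T \<in> ?S. ?d \<in> T} / card ?S = north A B M"
    by (simp add: north_def tiling_prob_def)
  finally show ?thesis .
qed

section \<open>Steps along the axis\<close>

text \<open>With \<open>\<alpha> = a + b\<close> and \<open>n = 4 p + \<alpha>\<close>, the
  integers \<open>vterm\<close> and \<open>wterm\<close> are the two coefficients of
  \<open>north_step_axis\<close> for the points \<open>(0, m - 1)\<close>, \<open>(1, m)\<close>
  and \<open>(0, m + 1)\<close>, where \<open>m = a - b\<close>.\<close>

definition vterm :: "int \<Rightarrow> int \<Rightarrow> nat \<Rightarrow> int" where
  "vterm a b p = krawtchouk (2 * int p + b) (2 * int p + a) (4 * int p + a + b - 1)"

definition wterm :: "int \<Rightarrow> int \<Rightarrow> nat \<Rightarrow> int" where
  "wterm a b p = krawtchouk (2 * int p + a) (2 * int p + b - 1) (4 * int p + a + b - 1)"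

lemma aztec_prob_steps:
  assumes \<alpha>: "int \<alpha> = a + b" and p: "p \<ge> nat (\<bar>a\<bar> + \<bar>b\<bar> + 1)"
  shows "aztec_prob 0 (a - b + 1) (4 * p + \<alpha>) = aztec_prob 0 (a - b - 1) (4 * p + \<alpha>)
      + ((vterm a b p)\<^sup>2 + (wterm a b p)\<^sup>2) / 2 ^ (4 * p + \<alpha>)"
    and "aztec_prob 1 (a - b) (4 * p + \<alpha>) = aztec_prob 0 (a - b - 1) (4 * p + \<alpha>)
      + vterm a b p * (vterm a b p + wterm a b p) / 2 ^ (4 * p + \<alpha>)"
    and "aztec_prob 1 (a - b) (4 * p + \<alpha>) = aztec_prob 0 (a - b + 1) (4 * p + \<alpha>)
      + wterm a b p * (vterm a b p - wterm a b p) / 2 ^ (4 * p + \<alpha>)"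
proof -
  define A B where "A = 2 * int p + a" and "B = 2 * int p + b"
  have AB: "A \<ge> 0" "B \<ge> 1" "0 < 4 * p + \<alpha>" using p by (auto simp: A_def B_def)
  have M: "A + B - 1 = int (4 * p + \<alpha>) - 1" using \<alpha> by (simp add: A_def B_def)
  have n: "nat (A + B) = 4 * p + \<alpha>" using \<alpha> by (simp add: A_def B_def nat_eq_iff)
  have v: "krawtchouk B A (A + B - 1) = vterm a b p" and w: "krawtchouk A (B - 1) (A + B - 1) = wterm a b p"
    by (simp_all add: vterm_def wterm_def A_def B_def algebra_simps)
  have P: "aztec_prob 0 (a - b + 1) (4 * p + \<alpha>) = north A (B - 1) (A + B - 1)"
    "aztec_prob 0 (a - b - 1) (4 * p + \<alpha>) = north (A - 1) B (A + B - 1)"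
    "aztec_prob 1 (a - b) (4 * p + \<alpha>) = north A B (A + B - 1)"
    using aztec_prob_eq_north[OF AB(3) M, of A "B - 1"] aztec_prob_eq_north[OF AB(3) M, of "A - 1" B]
      aztec_prob_eq_north[OF AB(3) M, of A B]
    by (simp_all add: A_def B_def algebra_simps)
  have vy: "vterm a b p * (vterm a b p + wterm a b p) = krawtchouk B A (A + B - 1) * krawtchouk A B (A + B)"
    using krawtchouk_contiguous[OF AB(1,2)] v w by simp
  show "aztec_prob 1 (a - b) (4 * p + \<alpha>) = aztec_prob 0 (a - b - 1) (4 * p + \<alpha>)
      + vterm a b p * (vterm a b p + wterm a b p) / 2 ^ (4 * p + \<alpha>)"
    using north_step_up[OF AB(1,2)] unfolding P n vy by (simp only: diff_eq_eq add.commute)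
  show "aztec_prob 0 (a - b + 1) (4 * p + \<alpha>) = aztec_prob 0 (a - b - 1) (4 * p + \<alpha>)
      + ((vterm a b p)\<^sup>2 + (wterm a b p)\<^sup>2) / 2 ^ (4 * p + \<alpha>)"
    using north_step_axis[OF AB(1,2)] unfolding P n v w by (simp only: diff_eq_eq add.commute)
  have flip: "x - y = of_int (w * (w - v)) / N \<Longrightarrow> y = x + of_int (w * (v - w)) / N" for x y N :: real and v w
    by (simp add: algebra_simps diff_divide_distrib)
  show "aztec_prob 1 (a - b) (4 * p + \<alpha>) = aztec_prob 0 (a - b + 1) (4 * p + \<alpha>)
      + wterm a b p * (vterm a b p - wterm a b p) / 2 ^ (4 * p + \<alpha>)"
    using north_step_down[OF AB(1,2)] unfolding P n v w by (rule flip)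
qed

abbreviation factors :: "nat \<Rightarrow> nat \<Rightarrow> rat poly" where
  "factors e s \<equiv> shifted_factors e * odd_factors s"

lemma krawtchouk_eq_kraw: "0 \<le> B \<Longrightarrow> 0 \<le> C \<Longrightarrow> M = B + C \<Longrightarrow> krawtchouk A B M = kraw A (nat C) (nat B)"
  by (simp add: krawtchouk_def)

text \<open>The two integers can be read as coefficients of \<open>z^(2 p + a)\<close> and
  \<open>z^(2 p + a - 1)\<close> or, by symmetry, of \<open>z^(2 p + b)\<close> and \<open>z^(2 p
  + b - 1)\<close>. The bound of \<open>ratio_by_kraw\<close> is good for the first reading if
  \<open>b \<le> a\<close>, and for the second one if \<open>a < b\<close>.\<close>

lemma ratio_wterm_up:
  assumes "b \<le> 2" "b \<le> a + 1" "a \<le> 2 * int e + 1" "- b \<le> 2 * int s"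
  shows "ratio_by signed_central (factors e s) (\<lambda>p. of_int (wterm a b p))"
proof (rule ratio_by_cong)
  show "ratio_by signed_central (factors e s)
      (\<lambda>p. of_int (kraw (2 * int p + a) (nat (2 * int p + a)) (nat (2 * int p - (1 - b)))))"
    using assms by (intro ratio_by_kraw) auto
  have "wterm a b p = kraw (2 * int p + a) (nat (2 * int p + a)) (nat (2 * int p - (1 - b)))"
    if "p \<ge> nat (\<bar>a\<bar> + \<bar>b\<bar> + 1)" for p
    unfolding wterm_def using that by (subst krawtchouk_eq_kraw[where C = "2 * int p + a"]) (auto simp: algebra_simps)
  then show "\<forall>\<^sub>F p in sequentially. of_int (wterm a b p)
      = (of_int (kraw (2 * int p + a) (nat (2 * int p + a)) (nat (2 * int p - (1 - b)))) :: rat)"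
    by (intro eventually_sequentiallyI[of "nat (\<bar>a\<bar> + \<bar>b\<bar> + 1)"]) simp
qed

lemma vterm_plus_wterm:
  assumes "p \<ge> nat (\<bar>a\<bar> + \<bar>b\<bar> + 1)"
  shows "vterm a b p + wterm a b p = kraw (2 * int p + a) (nat (2 * int p + a)) (nat (2 * int p + b))"
proof -
  let ?A = "2 * int p + a" and ?B = "2 * int p + b"
  have AB: "?A \<ge> 0" "?B \<ge> 1" using assms by auto
  have "vterm a b p + wterm a b p = krawtchouk ?A ?B (?A + ?B)"
    using krawtchouk_contiguous[OF AB] by (simp add: vterm_def wterm_def algebra_simps)
  also have "\<dots> = kraw ?A (nat ?A) (nat ?B)" using AB by (intro krawtchouk_eq_kraw) auto
  finally show ?thesis .
qed

lemma ratio_vterm_up: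
  assumes "b \<le> 1" "b \<le> a + 1" "a \<le> 2 * int e + 2" "- b \<le> 2 * int s"
  shows "ratio_by signed_central (factors e s) (\<lambda>p. of_int (vterm a b p))"
proof (rule ratio_by_cong)
  show "ratio_by signed_central (factors e s)
      (\<lambda>p. - of_int (kraw (2 * int p + (a - 1)) (nat (2 * int p + a)) (nat (2 * int p - (1 - b)))))"
    using assms by (intro ratio_by_minus ratio_by_kraw) auto
  have "vterm a b p = - kraw (2 * int p + (a - 1)) (nat (2 * int p + a)) (nat (2 * int p - (1 - b)))"
    if p: "p \<ge> nat (\<bar>a\<bar> + \<bar>b\<bar> + 1)" for p
  proof -
    have "nat (2 * int p + b) = Suc (nat (2 * int p - (1 - b)))" using p by simp
    moreover have "wterm a b p = kraw (2 * int p + a) (nat (2 * int p + a)) (nat (2 * int p - (1 - b)))"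
      unfolding wterm_def using p by (subst krawtchouk_eq_kraw[where C = "2 * int p + a"]) (auto simp: algebra_simps)
    ultimately show ?thesis
      using vterm_plus_wterm[OF p] by (simp add: kraw_Suc_right algebra_simps)
  qed
  then show "\<forall>\<^sub>F p in sequentially. of_int (vterm a b p)
      = (- of_int (kraw (2 * int p + (a - 1)) (nat (2 * int p + a)) (nat (2 * int p - (1 - b)))) :: rat)"
    by (intro eventually_sequentiallyI[of "nat (\<bar>a\<bar> + \<bar>b\<bar> + 1)"]) simp
qed

text \<open>The sum of the two integers is itself a Krawtchouk coefficient, with \<open>q = -
  b\<close> in place of the \<open>1 - b\<close> of its summands; for odd \<open>b\<close> this
  saves the one odd factor by which the product of the bounds for the summands exceeds
  \<open>C\<close>.\<close>

lemma ratio_sum_up: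
  assumes "b \<le> 1" "b \<le> a" "a \<le> 2 * int e + 1" "- b \<le> 2 * int s + 1"
  shows "ratio_by signed_central (factors e s) (\<lambda>p. of_int (vterm a b p + wterm a b p))"
proof (rule ratio_by_cong)
  show "ratio_by signed_central (factors e s)
      (\<lambda>p. of_int (kraw (2 * int p + a) (nat (2 * int p + a)) (nat (2 * int p - (- b)))))"
    using assms by (intro ratio_by_kraw) auto
  show "\<forall>\<^sub>F p in sequentially. of_int (vterm a b p + wterm a b p)
      = (of_int (kraw (2 * int p + a) (nat (2 * int p + a)) (nat (2 * int p - (- b)))) :: rat)"
    by (intro eventually_sequentiallyI[of "nat (\<bar>a\<bar> + \<bar>b\<bar> + 1)"])
      (simp add: vterm_plus_wterm del: of_int_add)
qed

lemma ratio_vterm_down: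
  assumes "a \<le> 1" "a < b" "b \<le> 2 * int e + 1" "- a \<le> 2 * int s + 1"
  shows "ratio_by signed_central (factors e s) (\<lambda>p. of_int (vterm a b p))"
proof (rule ratio_by_cong)
  show "ratio_by signed_central (factors e s)
      (\<lambda>p. of_int (kraw (2 * int p + b) (nat (2 * int p + (b - 1))) (nat (2 * int p - (- a)))))"
    using assms by (intro ratio_by_kraw) auto
  have "vterm a b p = kraw (2 * int p + b) (nat (2 * int p + (b - 1))) (nat (2 * int p - (- a)))"
    if "p \<ge> nat (\<bar>a\<bar> + \<bar>b\<bar> + 1)" for p
    unfolding vterm_def using that by (subst krawtchouk_eq_kraw[where C = "2 * int p + (b - 1)"]) (auto simp: algebra_simps)
  then show "\<forall>\<^sub>F p in sequentially. of_int (vterm a b p)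
      = (of_int (kraw (2 * int p + b) (nat (2 * int p + (b - 1))) (nat (2 * int p - (- a)))) :: rat)"
    by (intro eventually_sequentiallyI[of "nat (\<bar>a\<bar> + \<bar>b\<bar> + 1)"]) simp
qed

lemma ratio_wterm_down:
  assumes "a \<le> 1" "a < b" "b \<le> 2 * int e + 2" "- a \<le> 2 * int s + 1"
  shows "ratio_by signed_central (factors e s) (\<lambda>p. of_int (wterm a b p))"
proof (rule ratio_by_cong)
  show "ratio_by signed_central (factors e s)
      (\<lambda>p. of_int (kraw (2 * int p + (b - 1)) (nat (2 * int p + (b - 1))) (nat (2 * int p - (- a)))))"
    using assms by (intro ratio_by_kraw) auto
  have "wterm a b p = kraw (2 * int p + (b - 1)) (nat (2 * int p + (b - 1))) (nat (2 * int p - (- a)))"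
    if p: "p \<ge> nat (\<bar>a\<bar> + \<bar>b\<bar> + 1)" for p
  proof -
    have "wterm a b p = krawtchouk (2 * int p + b - 1) (2 * int p + a) (4 * int p + a + b - 1)"
      unfolding wterm_def using p by (intro krawtchouk_symmetric) auto
    also have "\<dots> = kraw (2 * int p + b - 1) (nat (2 * int p + (b - 1))) (nat (2 * int p + a))"
      using p by (intro krawtchouk_eq_kraw) auto
    finally show ?thesis by (simp add: algebra_simps)
  qed
  then show "\<forall>\<^sub>F p in sequentially. of_int (wterm a b p)
      = (of_int (kraw (2 * int p + (b - 1)) (nat (2 * int p + (b - 1))) (nat (2 * int p - (- a)))) :: rat)"
    by (intro eventually_sequentiallyI[of "nat (\<bar>a\<bar> + \<bar>b\<bar> + 1)"]) simp
qed

lemma ratio_by_mult_signed: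
  assumes "ratio_by signed_central X F" "ratio_by signed_central Y G"
  shows "ratio_by (\<lambda>p. (central p)\<^sup>2) (X * Y) (\<lambda>p. F p * G p)"
proof -
  have "signed_central p * signed_central p = (central p)\<^sup>2" for p
    by (simp add: signed_central_def power2_eq_square mult_ac flip: power_mult_distrib)
  with ratio_by_mult[OF assms] show ?thesis by simp
qed

text \<open>Walking from one point to another adds the difference \<open>G\<close> to the
  deviation and may enlarge the denominator.\<close>

lemma deviation_ratio_step:
  assumes dev: "deviation_ratio l m \<alpha> X" and "X dvd Y"
    and G: "ratio_by (\<lambda>p. (central p)\<^sup>2) Y (\<lambda>p. of_int (G p))"
    and step: "\<And>p. p \<ge> N \<Longrightarrow> aztec_prob l' m' (4 * p + \<alpha>) = aztec_prob l m (4 * p + \<alpha>) + of_int (G p) / 2 ^ (4 * p + \<alpha>)"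
  shows "deviation_ratio l' m' \<alpha> Y"
proof -
  obtain F where F: "ratio_by (\<lambda>p. (central p)\<^sup>2) X F"
    and prob: "\<forall>\<^sub>F p in sequentially. aztec_prob l m (4 * p + \<alpha>) = 1 / 4 + of_rat (F p) / 2 ^ (4 * p + \<alpha>)"
    using dev by (auto simp: deviation_ratio_def)
  from prob eventually_ge_at_top[of N]
  have "\<forall>\<^sub>F p in sequentially. aztec_prob l' m' (4 * p + \<alpha>)
      = 1 / 4 + of_rat (F p + of_int (G p)) / 2 ^ (4 * p + \<alpha>)"
    by eventually_elim (simp add: step of_rat_add add_divide_distrib)
  with ratio_by_add[OF ratio_by_dvd[OF F \<open>X dvd Y\<close>] G] show ?thesis
    unfolding deviation_ratio_def by blast
qed

lemma deviation_ratio_dvd: "deviation_ratio l m \<alpha> X \<Longrightarrow> X dvd Y \<Longrightarrow> deviation_ratio l m \<alpha> Y"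
  unfolding deviation_ratio_def using ratio_by_dvd by blast

section \<open>The polynomial C near the axis\<close>

lemma prod_power_if:
  fixes f :: "nat \<Rightarrow> rat poly"
  assumes "U \<le> u"
  shows "(\<Prod>i=1..u. f i ^ (if i \<le> U then 2 else 1)) = (\<Prod>i=1..u. f i) * (\<Prod>i=1..U. f i)"
proof -
  have "(\<Prod>i=1..u. f i ^ (if i \<le> U then 2 else 1)) = (\<Prod>i=1..u. f i * (if i \<in> {1..U} then f i else 1))"
    by (intro prod.cong) (auto simp: power2_eq_square)
  also have "\<dots> = (\<Prod>i=1..u. f i) * (\<Prod>i\<in>{1..u} \<inter> {1..U}. f i)"
    by (simp only: prod.distrib prod.inter_restrict[OF finite_atLeastAtMost])
  also have "{1..u} \<inter> {1..U} = {1..U}" using assms by auto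
  finally show ?thesis .
qed

text \<open>Maximum and minimum only serve to collect the squares: \<open>C\<close> is a product
  of one factor for \<open>a\<close> and one for \<open>b\<close>. The factors are regrouped so
  that each pairs the first index of one of \<open>a\<close>, \<open>b\<close> with the second
  index of the other, which is how they are matched with the bounds for the two Krawtchouk
  coefficients.\<close>

lemma C_poly_eq:
  assumes "a = (l + m + int \<alpha> - 1) div 2" "b = (l - m + int \<alpha> - 1) div 2"
  shows "C_poly l m \<alpha> = factors (r_index \<alpha> a) (s_index \<alpha> b) * factors (r_index \<alpha> b) (s_index \<alpha> a)"
proof -
  have minmax: "g (max x y) * g (min x y) = g x * g y" for g :: "nat \<Rightarrow> rat poly" and x y
    by (simp add: max_def min_def mult.commute)
  have "N_poly u v U V = (shifted_factors u * shifted_factors U) * (odd_factors v * odd_factors V)"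
    if "U \<le> u" "V \<le> v" for u v U V
    unfolding N_poly_def shifted_factors_def odd_factors_def using that by (simp only: prod_power_if)
  then have "C_poly l m \<alpha> = (shifted_factors (r_index \<alpha> a) * shifted_factors (r_index \<alpha> b))
      * (odd_factors (s_index \<alpha> a) * odd_factors (s_index \<alpha> b))"
    unfolding C_poly_def Let_def assms[symmetric] by (simp add: minmax)
  then show ?thesis by (simp only: mult_ac)
qed

lemma C_poly_axis:
  assumes "int \<alpha> = a + b"
  shows "C_poly 0 (a - b + 1) \<alpha> = factors (r_index \<alpha> a) (s_index \<alpha> (b - 1)) * factors (r_index \<alpha> (b - 1)) (s_index \<alpha> a)"
    "C_poly 0 (a - b - 1) \<alpha> = factors (r_index \<alpha> (a - 1)) (s_index \<alpha> b) * factors (r_index \<alpha> b) (s_index \<alpha> (a - 1))"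
    "C_poly 1 (a - b) \<alpha> = factors (r_index \<alpha> a) (s_index \<alpha> b) * factors (r_index \<alpha> b) (s_index \<alpha> a)"
  using assms by (intro C_poly_eq; simp)+

lemma C_poly_nonzero: "C_poly l m \<alpha> \<noteq> 0"
  by (simp add: C_poly_eq[OF refl refl] shifted_factors_nonzero odd_factors_nonzero)

lemma div2_bounds: "z \<le> 2 * int (div2 z) + 1" "0 \<le> z \<Longrightarrow> 2 * int (div2 z) \<le> z"
  unfolding div2_def by linarith+

lemma div2_mono: "y \<le> z \<Longrightarrow> div2 y \<le> div2 z"
  unfolding div2_def by (intro nat_mono zdiv_mono1) auto

lemma r_index_lower: "x \<le> 2 * int (r_index \<alpha> x) + 1" "x \<le> 0 \<Longrightarrow> int \<alpha> - x \<le> 2 * int (r_index \<alpha> x) + 2"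
  using div2_bounds(1)[of x] div2_bounds(1)[of "\<bar>x\<bar> + int \<alpha> - 1"] by (auto simp: r_index_def)

lemma s_index_lower: "0 \<le> x \<Longrightarrow> x - int \<alpha> \<le> 2 * int (s_index \<alpha> x)" "x < 0 \<Longrightarrow> - x \<le> 2 * int (s_index \<alpha> x) + 1"
  using div2_bounds(1)[of "x - int \<alpha> + 1"] div2_bounds(1)[of "\<bar>x\<bar>"] by (auto simp: s_index_def)

lemma r_index_mono:
  "0 < x \<Longrightarrow> x \<le> y \<Longrightarrow> r_index \<alpha> x \<le> r_index \<alpha> y" "x \<le> 0 \<Longrightarrow> y \<le> x \<Longrightarrow> r_index \<alpha> x \<le> r_index \<alpha> y"
  by (auto simp: r_index_def intro!: div2_mono)

lemma s_index_mono:
  "0 \<le> x \<Longrightarrow> x \<le> y \<Longrightarrow> s_index \<alpha> x \<le> s_index \<alpha> y" "x < 0 \<Longrightarrow> y \<le> x \<Longrightarrow> s_index \<alpha> x \<le> s_index \<alpha> y"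
  by (auto simp: s_index_def intro!: div2_mono)

lemma index_small:
  "r_index \<alpha> 1 = 0" "\<alpha> \<le> 2 \<Longrightarrow> r_index \<alpha> 0 = 0" "0 \<le> x \<Longrightarrow> x \<le> int \<alpha> \<Longrightarrow> s_index \<alpha> x = 0"
  by (auto simp: r_index_def s_index_def div2_def)

text \<open>These inequalities compare the indices in \<open>C\<close> with the bounds for
  Krawtchouk coefficients. Since \<open>\<alpha> \<le> 3\<close> forces \<open>b \<le> 1\<close>,
  only a few points near the centre deviate from the generic formulas for the indices.\<close>

lemma index_bounds_up:
  assumes "\<alpha> \<le> 3" "int \<alpha> = a + b" "b < a"
  shows "b \<le> 1" "r_index \<alpha> (a - 1) \<le> r_index \<alpha> a" "r_index \<alpha> b \<le> r_index \<alpha> (b - 1)"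
    "s_index \<alpha> (a - 1) \<le> s_index \<alpha> a" "s_index \<alpha> b \<le> s_index \<alpha> (b - 1)"
    "a \<le> 2 * int (r_index \<alpha> a) + 1" "a \<le> 2 * int (r_index \<alpha> (b - 1)) + 1"
    "a \<le> 2 * int (r_index \<alpha> b) + 2" "- b \<le> 2 * int (s_index \<alpha> a)"
    "- b \<le> 2 * int (s_index \<alpha> (b - 1))" "- b \<le> 2 * int (s_index \<alpha> b) + 1"
proof -
  have a: "a \<ge> 1" and b: "b \<le> 1" using assms by linarith+
  show "b \<le> 1" by (rule b)
  show "r_index \<alpha> (a - 1) \<le> r_index \<alpha> a"
  proof (cases "a = 1")
    case True
    then show ?thesis using assms index_small(2)[of \<alpha>] by simp
  qed (use a in \<open>intro r_index_mono(1); simp\<close>)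
  show "r_index \<alpha> b \<le> r_index \<alpha> (b - 1)"
  proof (cases "b = 1")
    case True
    then show ?thesis using index_small(1)[of \<alpha>] by simp
  qed (use b in \<open>intro r_index_mono(2); simp\<close>)
  show "s_index \<alpha> (a - 1) \<le> s_index \<alpha> a" using a by (intro s_index_mono(1)) auto
  show "s_index \<alpha> b \<le> s_index \<alpha> (b - 1)"
  proof (cases "b < 0")
    case False
    then show ?thesis using assms a index_small(3)[of b \<alpha>] by simp
  qed (intro s_index_mono(2); simp)
  show "a \<le> 2 * int (r_index \<alpha> a) + 1" by (rule r_index_lower(1))
  show "a \<le> 2 * int (r_index \<alpha> (b - 1)) + 1" using r_index_lower(2)[of "b - 1" \<alpha>] assms b by simp
  show "a \<le> 2 * int (r_index \<alpha> b) + 2" using r_index_lower(2)[of b \<alpha>] assms b by (cases "b = 1") auto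
  show "- b \<le> 2 * int (s_index \<alpha> a)" using s_index_lower(1)[of a \<alpha>] assms a by simp
  show "- b \<le> 2 * int (s_index \<alpha> (b - 1))" using s_index_lower(2)[of "b - 1" \<alpha>] b by (cases "b = 1") auto
  show "- b \<le> 2 * int (s_index \<alpha> b) + 1" using s_index_lower(2)[of b \<alpha>] by (cases "b < 0") auto
qed

lemma index_bounds_down:
  assumes "\<alpha> \<le> 3" "int \<alpha> = a + b" "a < b"
  shows "a \<le> 1" "r_index \<alpha> a \<le> r_index \<alpha> (a - 1)" "r_index \<alpha> (b - 1) \<le> r_index \<alpha> b"
    "s_index \<alpha> a \<le> s_index \<alpha> (a - 1)" "s_index \<alpha> (b - 1) \<le> s_index \<alpha> b"
    "b \<le> 2 * int (r_index \<alpha> b) + 1" "b \<le> 2 * int (r_index \<alpha> (a - 1)) + 1"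
    "b \<le> 2 * int (r_index \<alpha> a) + 2" "- a \<le> 2 * int (s_index \<alpha> b)"
    "- a \<le> 2 * int (s_index \<alpha> (a - 1))" "- a \<le> 2 * int (s_index \<alpha> a) + 1"
  using index_bounds_up[of \<alpha> b a] assms by simp_all

section \<open>Walking away from the centre\<close>

text \<open>One step away from the centre on the upper half: the differences of the probabilities
  are \<open>v\<^sup>2 + w\<^sup>2\<close> and \<open>v (v + w)\<close> up to the power of 2, and
  the bounds for their factors multiply to divisors of \<open>C\<close> at the new point, which is
  a multiple of \<open>C\<close> at the old one.\<close>

lemma deviation_up:
  assumes "\<alpha> \<le> 3" "int \<alpha> = a + b" "b < a" "deviation_ratio 0 (a - b - 1) \<alpha> (C_poly 0 (a - b - 1) \<alpha>)"
  shows "deviation_ratio 0 (a - b + 1) \<alpha> (C_poly 0 (a - b + 1) \<alpha>)"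
    and "deviation_ratio 1 (a - b) \<alpha> (C_poly 1 (a - b) \<alpha>)"
proof -
  note bounds = index_bounds_up[OF assms(1-3)]
  note dvds = mult_dvd_mono shifted_factors_dvd odd_factors_dvd bounds le_refl
  show "deviation_ratio 0 (a - b + 1) \<alpha> (C_poly 0 (a - b + 1) \<alpha>)"
  proof (rule deviation_ratio_step[OF assms(4), where N = "nat (\<bar>a\<bar> + \<bar>b\<bar> + 1)"])
    show "C_poly 0 (a - b - 1) \<alpha> dvd C_poly 0 (a - b + 1) \<alpha>"
      unfolding C_poly_axis[OF assms(2)] by (intro dvds)
    have "ratio_by (\<lambda>p. (central p)\<^sup>2) (C_poly 0 (a - b + 1) \<alpha>)
        (\<lambda>p. of_int (vterm a b p) * of_int (vterm a b p) + of_int (wterm a b p) * of_int (wterm a b p))"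
      unfolding C_poly_axis[OF assms(2)] using bounds assms(3)
      by (intro ratio_by_add ratio_by_mult_signed ratio_vterm_up ratio_wterm_up; linarith)
    then show "ratio_by (\<lambda>p. (central p)\<^sup>2) (C_poly 0 (a - b + 1) \<alpha>)
        (\<lambda>p. of_int ((vterm a b p)\<^sup>2 + (wterm a b p)\<^sup>2))"
      by (simp add: power2_eq_square)
  qed (simp add: aztec_prob_steps(1)[OF assms(2)] add_divide_distrib diff_divide_distrib)
  show "deviation_ratio 1 (a - b) \<alpha> (C_poly 1 (a - b) \<alpha>)"
  proof (rule deviation_ratio_step[OF assms(4), where N = "nat (\<bar>a\<bar> + \<bar>b\<bar> + 1)"])
    show "C_poly 0 (a - b - 1) \<alpha> dvd C_poly 1 (a - b) \<alpha>"
      unfolding C_poly_axis[OF assms(2)] by (intro dvds)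
    have "ratio_by (\<lambda>p. (central p)\<^sup>2) (C_poly 1 (a - b) \<alpha>)
        (\<lambda>p. of_int (vterm a b p + wterm a b p) * of_int (vterm a b p))"
      unfolding C_poly_axis[OF assms(2)] using bounds assms(3)
      by (intro ratio_by_mult_signed ratio_vterm_up ratio_sum_up; linarith)
    then show "ratio_by (\<lambda>p. (central p)\<^sup>2) (C_poly 1 (a - b) \<alpha>)
        (\<lambda>p. of_int (vterm a b p * (vterm a b p + wterm a b p)))"
      by (simp add: mult.commute)
  qed (simp add: aztec_prob_steps(2)[OF assms(2)] add_divide_distrib diff_divide_distrib)
qed

text \<open>The same on the lower half. The step to \<open>l = 1\<close> now starts from
  \<open>(0, m + 1)\<close>, with difference \<open>w (v - w)\<close>.\<close>

lemma deviation_down: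
  assumes "\<alpha> \<le> 3" "int \<alpha> = a + b" "a < b" "deviation_ratio 0 (a - b + 1) \<alpha> (C_poly 0 (a - b + 1) \<alpha>)"
  shows "deviation_ratio 0 (a - b - 1) \<alpha> (C_poly 0 (a - b - 1) \<alpha>)"
    and "deviation_ratio 1 (a - b) \<alpha> (C_poly 1 (a - b) \<alpha>)"
proof -
  note bounds = index_bounds_down[OF assms(1-3)]
  note dvds = mult_dvd_mono shifted_factors_dvd odd_factors_dvd bounds le_refl
  show "deviation_ratio 0 (a - b - 1) \<alpha> (C_poly 0 (a - b - 1) \<alpha>)"
  proof (rule deviation_ratio_step[OF assms(4), where N = "nat (\<bar>a\<bar> + \<bar>b\<bar> + 1)"])
    show "C_poly 0 (a - b + 1) \<alpha> dvd C_poly 0 (a - b - 1) \<alpha>"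
      unfolding C_poly_axis[OF assms(2)] by (intro dvds)
    have "ratio_by (\<lambda>p. (central p)\<^sup>2) (C_poly 0 (a - b - 1) \<alpha>)
        (\<lambda>p. - (of_int (vterm a b p) * of_int (vterm a b p) + of_int (wterm a b p) * of_int (wterm a b p)))"
      unfolding C_poly_axis[OF assms(2)] using bounds assms(3)
      by (intro ratio_by_minus ratio_by_add ratio_by_mult_signed ratio_vterm_down ratio_wterm_down; linarith)
    then show "ratio_by (\<lambda>p. (central p)\<^sup>2) (C_poly 0 (a - b - 1) \<alpha>)
        (\<lambda>p. of_int (- ((vterm a b p)\<^sup>2 + (wterm a b p)\<^sup>2)))"
      by (simp add: power2_eq_square)
  qed (simp add: aztec_prob_steps(1)[OF assms(2)] add_divide_distrib diff_divide_distrib)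
  show "deviation_ratio 1 (a - b) \<alpha> (C_poly 1 (a - b) \<alpha>)"
  proof (rule deviation_ratio_step[OF assms(4), where N = "nat (\<bar>a\<bar> + \<bar>b\<bar> + 1)"])
    show "C_poly 0 (a - b + 1) \<alpha> dvd C_poly 1 (a - b) \<alpha>"
      unfolding C_poly_axis[OF assms(2)] by (intro dvds)
    have "ratio_by (\<lambda>p. (central p)\<^sup>2) (C_poly 1 (a - b) \<alpha>)
        (\<lambda>p. of_int (wterm a b p) * (of_int (vterm a b p) + - of_int (wterm a b p)))"
      unfolding C_poly_axis[OF assms(2)] using bounds assms(3)
      by (intro ratio_by_mult_signed ratio_by_add ratio_by_minus ratio_vterm_down ratio_wterm_down; linarith)
    then show "ratio_by (\<lambda>p. (central p)\<^sup>2) (C_poly 1 (a - b) \<alpha>)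
        (\<lambda>p. of_int (wterm a b p * (vterm a b p - wterm a b p)))"
      by simp
  qed (simp add: aztec_prob_steps(3)[OF assms(2)] add_divide_distrib diff_divide_distrib)
qed

text \<open>For odd \<open>\<alpha>\<close> the starting point is the centre of the
  diamond.\<close>

lemma deviation_base_odd:
  assumes "\<alpha> = 2 * c + 1" "c \<le> 1"
  shows "deviation_ratio 0 0 \<alpha> 1"
proof -
  define y where "y p = krawtchouk (2 * int p + int c) (2 * int p + int c) (2 * (2 * int p + int c))" for p
  have "ratio_by signed_central (factors 0 0)
      (\<lambda>p. of_int (kraw (2 * int p + int c) (nat (2 * int p + int c)) (nat (2 * int p - (- int c)))))"
    using assms by (intro ratio_by_kraw) auto
  then have "ratio_by signed_central 1 (\<lambda>p. of_int (y p))"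
    by (simp add: y_def[abs_def] krawtchouk_def)
  from ratio_by_cmult[OF ratio_by_mult_signed[OF this this], of "1 / 2"]
  have "ratio_by (\<lambda>p. (central p)\<^sup>2) 1 (\<lambda>p. 1 / 2 * (of_int (y p) * of_int (y p)))" by simp
  moreover have "aztec_prob 0 0 (4 * p + \<alpha>)
      = 1 / 4 + of_rat (1 / 2 * (of_int (y p) * of_int (y p))) / 2 ^ (4 * p + \<alpha>)" for p
  proof -
    define k where "k = 2 * int p + int c"
    have "aztec_prob (k + k - 2 * k) (k - k) (4 * p + \<alpha>) = north k k (2 * k)"
      using assms by (intro aztec_prob_eq_north) (auto simp: k_def)
    also have "\<dots> = 1 / 4 + (krawtchouk k k (2 * k))\<^sup>2 / 2 ^ nat (2 * k + 2)"
      by (rule north_center) (simp add: k_def)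
    also have "nat (2 * k + 2) = Suc (4 * p + \<alpha>)" using assms by (simp add: k_def)
    finally show ?thesis
      by (simp add: y_def k_def power2_eq_square of_rat_mult of_rat_divide)
  qed
  ultimately show ?thesis unfolding deviation_ratio_def by (intro exI conjI always_eventually allI)
qed

text \<open>For even \<open>\<alpha>\<close> the parity excludes the centre. The point \<open>(0,
  1)\<close> is reached from the centre of the next smaller diamond by
  \<open>north_off_center\<close>, and the other two neighbours of the centre from there.\<close>

lemma deviation_base_even:
  assumes "\<alpha> = 2 * c" "c \<le> 1"
  shows "deviation_ratio 0 1 \<alpha> 1" "deviation_ratio 0 (-1) \<alpha> 1" "deviation_ratio 1 0 \<alpha> 1"
proof -
  let ?v = "vterm (int c) (int c)" and ?w = "wterm (int c) (int c)"
  have \<alpha>: "int \<alpha> = int c + int c" using assms by simp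
  have v: "ratio_by signed_central 1 (\<lambda>p. of_int (?v p))"
    using ratio_vterm_up[of "int c" "int c" 0 0] assms by simp
  have w: "ratio_by signed_central 1 (\<lambda>p. of_int (?w p))"
    using ratio_wterm_up[of "int c" "int c" 0 0] assms by simp
  define e where "e p = krawtchouk (2 * int p + int c - 1) (2 * int p + int c - 1) (2 * (2 * int p + int c) - 2)" for p
  have e: "ratio_by signed_central 1 (\<lambda>p. of_int (e p))"
  proof (rule ratio_by_cong)
    show "ratio_by signed_central 1
      (\<lambda>p. of_int (kraw (2 * int p + (int c - 1)) (nat (2 * int p + (int c - 1))) (nat (2 * int p - (1 - int c)))))"
      using ratio_by_kraw[of "1 - int c" "int c - 1" "int c - 1" 0 0] assms by simp
    show "\<forall>\<^sub>F p in sequentially. of_int (e p)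
      = (of_int (kraw (2 * int p + (int c - 1)) (nat (2 * int p + (int c - 1))) (nat (2 * int p - (1 - int c)))) :: rat)"
      by (intro eventually_sequentiallyI[of 1]) (simp add: e_def krawtchouk_def algebra_simps)
  qed
  show 1: "deviation_ratio 0 1 \<alpha> 1"
    unfolding deviation_ratio_def
  proof (intro exI conjI)
    show "ratio_by (\<lambda>p. (central p)\<^sup>2) 1 (\<lambda>p. of_int (e p) * of_int (e p) + of_int (?w p) * of_int (?w p))"
      using ratio_by_add[OF ratio_by_mult_signed[OF e e] ratio_by_mult_signed[OF w w]] by simp
    have "aztec_prob 0 1 (4 * p + \<alpha>)
        = 1 / 4 + of_rat (of_int (e p) * of_int (e p) + of_int (?w p) * of_int (?w p)) / 2 ^ (4 * p + \<alpha>)"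
      if "p \<ge> 1" for p
    proof -
      define k where "k = 2 * int p + int c"
      have k: "k \<ge> 1" using that by (simp add: k_def)
      have "aztec_prob (k + (k - 1) - (2 * k - 1)) (k - (k - 1)) (4 * p + \<alpha>) = north k (k - 1) (2 * k - 1)"
        using assms that by (intro aztec_prob_eq_north) (auto simp: k_def)
      also have "\<dots> = north (k - 1) (k - 1) (2 * (k - 1)) + (krawtchouk k (k - 1) (2 * k - 1))\<^sup>2 / 2 ^ nat (2 * k)"
        using north_off_center[OF k] by (simp add: algebra_simps)
      also have "north (k - 1) (k - 1) (2 * (k - 1))
          = 1 / 4 + (krawtchouk (k - 1) (k - 1) (2 * (k - 1)))\<^sup>2 / 2 ^ nat (2 * (k - 1) + 2)"
        using k by (intro north_center) simp
      also have "nat (2 * (k - 1) + 2) = 4 * p + \<alpha>" using assms by (simp add: k_def)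
      also have "nat (2 * k) = 4 * p + \<alpha>" using assms by (simp add: k_def)
      also have "krawtchouk (k - 1) (k - 1) (2 * (k - 1)) = e p" by (simp add: e_def k_def algebra_simps)
      also have "krawtchouk k (k - 1) (2 * k - 1) = ?w p" by (simp add: wterm_def k_def algebra_simps)
      finally show ?thesis
        by (simp add: power2_eq_square of_rat_mult of_rat_add add_divide_distrib)
    qed
    then show "\<forall>\<^sub>F p in sequentially. aztec_prob 0 1 (4 * p + \<alpha>)
        = 1 / 4 + of_rat (of_int (e p) * of_int (e p) + of_int (?w p) * of_int (?w p)) / 2 ^ (4 * p + \<alpha>)"
      by (rule eventually_sequentiallyI)
  qed
  show "deviation_ratio 0 (-1) \<alpha> 1"
  proof (rule deviation_ratio_step[OF 1 dvd_refl, where N = "nat (\<bar>int c\<bar> + \<bar>int c\<bar> + 1)"])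
    show "ratio_by (\<lambda>p. (central p)\<^sup>2) 1 (\<lambda>p. of_int (- ((?v p)\<^sup>2 + (?w p)\<^sup>2)))"
      using ratio_by_minus[OF ratio_by_add[OF ratio_by_mult_signed[OF v v] ratio_by_mult_signed[OF w w]]]
      by (simp add: power2_eq_square)
  qed (use aztec_prob_steps(1)[OF \<alpha>] in \<open>simp add: add_divide_distrib diff_divide_distrib\<close>)
  show "deviation_ratio 1 0 \<alpha> 1"
  proof (rule deviation_ratio_step[OF 1 dvd_refl, where N = "nat (\<bar>int c\<bar> + \<bar>int c\<bar> + 1)"])
    show "ratio_by (\<lambda>p. (central p)\<^sup>2) 1 (\<lambda>p. of_int (?w p * (?v p - ?w p)))"
      using ratio_by_mult_signed[OF w ratio_by_add[OF v ratio_by_minus[OF w]]] by simp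
  qed (use aztec_prob_steps(3)[OF \<alpha>] in \<open>simp add: add_divide_distrib diff_divide_distrib\<close>)
qed

lemma deviation_axis_odd:
  assumes "\<alpha> = 2 * c + 1" "c \<le> 1"
  shows "deviation_ratio 0 (2 * int k) \<alpha> (C_poly 0 (2 * int k) \<alpha>)"
    and "deviation_ratio 0 (- 2 * int k) \<alpha> (C_poly 0 (- 2 * int k) \<alpha>)"
proof (induction k)
  case 0
  show "deviation_ratio 0 (2 * int 0) \<alpha> (C_poly 0 (2 * int 0) \<alpha>)"
    "deviation_ratio 0 (- 2 * int 0) \<alpha> (C_poly 0 (- 2 * int 0) \<alpha>)"
    using deviation_ratio_dvd[OF deviation_base_odd[OF assms] one_dvd] by simp_all
next
  case (Suc k)
  define a b where "a = int c + 1 + int k" and "b = int c - int k"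
  have ab: "\<alpha> \<le> 3" "int \<alpha> = a + b" "int \<alpha> = b + a" "b < a" using assms by (auto simp: a_def b_def)
  have m: "a - b - 1 = 2 * int k" "a - b + 1 = 2 * int (Suc k)"
    "b - a + 1 = - 2 * int k" "b - a - 1 = - 2 * int (Suc k)" by (simp_all add: a_def b_def)
  show "deviation_ratio 0 (2 * int (Suc k)) \<alpha> (C_poly 0 (2 * int (Suc k)) \<alpha>)"
    using deviation_up(1)[OF ab(1,2,4)] Suc(1) unfolding m .
  show "deviation_ratio 0 (- 2 * int (Suc k)) \<alpha> (C_poly 0 (- 2 * int (Suc k)) \<alpha>)"
    using deviation_down(1)[OF ab(1,3,4)] Suc(2) unfolding m .
qed

lemma deviation_axis_even:
  assumes "\<alpha> = 2 * c" "c \<le> 1"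
  shows "deviation_ratio 0 (2 * int k + 1) \<alpha> (C_poly 0 (2 * int k + 1) \<alpha>)"
    and "deviation_ratio 0 (- 2 * int k - 1) \<alpha> (C_poly 0 (- 2 * int k - 1) \<alpha>)"
proof (induction k)
  case 0
  show "deviation_ratio 0 (2 * int 0 + 1) \<alpha> (C_poly 0 (2 * int 0 + 1) \<alpha>)"
    "deviation_ratio 0 (- 2 * int 0 - 1) \<alpha> (C_poly 0 (- 2 * int 0 - 1) \<alpha>)"
    using deviation_base_even(1,2)[OF assms, THEN deviation_ratio_dvd, OF one_dvd] by simp_all
next
  case (Suc k)
  define a b where "a = int c + 1 + int k" and "b = int c - int k - 1"
  have ab: "\<alpha> \<le> 3" "int \<alpha> = a + b" "int \<alpha> = b + a" "b < a" using assms by (auto simp: a_def b_def)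
  have m: "a - b - 1 = 2 * int k + 1" "a - b + 1 = 2 * int (Suc k) + 1"
    "b - a + 1 = - 2 * int k - 1" "b - a - 1 = - 2 * int (Suc k) - 1" by (simp_all add: a_def b_def)
  show "deviation_ratio 0 (2 * int (Suc k) + 1) \<alpha> (C_poly 0 (2 * int (Suc k) + 1) \<alpha>)"
    using deviation_up(1)[OF ab(1,2,4)] Suc(1) unfolding m .
  show "deviation_ratio 0 (- 2 * int (Suc k) - 1) \<alpha> (C_poly 0 (- 2 * int (Suc k) - 1) \<alpha>)"
    using deviation_down(1)[OF ab(1,3,4)] Suc(2) unfolding m .
qed

text \<open>The points \<open>(1, m)\<close> are reached from the neighbour on the axis that is
  closer to the centre.\<close>

lemma deviation_next_odd:
  assumes "\<alpha> = 2 * c + 1" "c \<le> 1"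
  shows "deviation_ratio 1 (2 * int k + 1) \<alpha> (C_poly 1 (2 * int k + 1) \<alpha>)"
    and "deviation_ratio 1 (- 2 * int k - 1) \<alpha> (C_poly 1 (- 2 * int k - 1) \<alpha>)"
proof -
  define a b where "a = int c + 1 + int k" and "b = int c - int k"
  have ab: "\<alpha> \<le> 3" "int \<alpha> = a + b" "int \<alpha> = b + a" "b < a" using assms by (auto simp: a_def b_def)
  have m: "a - b - 1 = 2 * int k" "a - b = 2 * int k + 1"
    "b - a + 1 = - 2 * int k" "b - a = - 2 * int k - 1" by (simp_all add: a_def b_def)
  show "deviation_ratio 1 (2 * int k + 1) \<alpha> (C_poly 1 (2 * int k + 1) \<alpha>)"
    using deviation_up(2)[OF ab(1,2,4), unfolded m(1)] deviation_axis_odd(1)[OF assms] unfolding m(2) .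
  show "deviation_ratio 1 (- 2 * int k - 1) \<alpha> (C_poly 1 (- 2 * int k - 1) \<alpha>)"
    using deviation_down(2)[OF ab(1,3,4), unfolded m(3)] deviation_axis_odd(2)[OF assms] unfolding m(4) .
qed

lemma deviation_next_even:
  assumes "\<alpha> = 2 * c" "c \<le> 1"
  shows "deviation_ratio 1 (2 * int k) \<alpha> (C_poly 1 (2 * int k) \<alpha>)"
    and "deviation_ratio 1 (- 2 * int k) \<alpha> (C_poly 1 (- 2 * int k) \<alpha>)"
proof -
  have "deviation_ratio 1 (2 * int k) \<alpha> (C_poly 1 (2 * int k) \<alpha>)
    \<and> deviation_ratio 1 (- 2 * int k) \<alpha> (C_poly 1 (- 2 * int k) \<alpha>)"
  proof (cases k)
    case 0
    then show ?thesis
      using deviation_base_even(3)[OF assms, THEN deviation_ratio_dvd, OF one_dvd] by simp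
  next
    case (Suc k)
    define a b where "a = int c + 1 + int k" and "b = int c - int k - 1"
    have ab: "\<alpha> \<le> 3" "int \<alpha> = a + b" "int \<alpha> = b + a" "b < a" using assms by (auto simp: a_def b_def)
    have m: "a - b - 1 = 2 * int k + 1" "a - b = 2 * int (Suc k)"
      "b - a + 1 = - 2 * int k - 1" "b - a = - 2 * int (Suc k)" by (simp_all add: a_def b_def)
    have "deviation_ratio 1 (2 * int (Suc k)) \<alpha> (C_poly 1 (2 * int (Suc k)) \<alpha>)"
      using deviation_up(2)[OF ab(1,2,4), unfolded m(1)] deviation_axis_even(1)[OF assms] unfolding m(2) .
    moreover have "deviation_ratio 1 (- 2 * int (Suc k)) \<alpha> (C_poly 1 (- 2 * int (Suc k)) \<alpha>)"
      using deviation_down(2)[OF ab(1,3,4), unfolded m(3)] deviation_axis_even(2)[OF assms] unfolding m(4) .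
    ultimately show ?thesis using Suc by simp
  qed
  then show "deviation_ratio 1 (2 * int k) \<alpha> (C_poly 1 (2 * int k) \<alpha>)"
    "deviation_ratio 1 (- 2 * int k) \<alpha> (C_poly 1 (- 2 * int k) \<alpha>)" by blast+
qed

theorem corollaryA14:
  fixes m :: int and \<alpha> :: nat
  assumes "\<alpha> \<in> {0, 1, 2, 3}"
  shows "([m = int \<alpha> + 1] (mod 2) \<longrightarrow> aztec_denominator 0 m \<alpha> dvd C_poly 0 m \<alpha>) \<and>
         ([1 + m = int \<alpha> + 1] (mod 2) \<longrightarrow> aztec_denominator 1 m \<alpha> dvd C_poly 1 m \<alpha>)"
proof -
  obtain k where k: "m = 2 * int k \<or> m = - 2 * int k \<or> m = 2 * int k + 1 \<or> m = - 2 * int k - 1"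
  proof (cases "even m")
    case True
    then obtain j where "m = 2 * j" by (elim evenE)
    then show ?thesis using that[of "nat \<bar>j\<bar>"] by (cases "j \<ge> 0") auto
  next
    case False
    then obtain j where "m = 2 * j + 1" by (elim oddE)
    then show ?thesis using that[of "nat j"] that[of "nat (- j - 1)"] by (cases "j \<ge> 0") auto
  qed
  have parity: "[m = int \<alpha> + 1] (mod 2) \<longleftrightarrow> odd (m + int \<alpha>)" "[1 + m = int \<alpha> + 1] (mod 2) \<longleftrightarrow> even (m + int \<alpha>)"
    by (auto simp: cong_iff_dvd_diff)
  have "deviation_ratio 0 m \<alpha> (C_poly 0 m \<alpha>)" if "odd (m + int \<alpha>)"
  proof (cases "even \<alpha>")
    case True
    then obtain c where c: "\<alpha> = 2 * c" by (elim evenE)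
    moreover from c assms have "c \<le> 1" by auto
    ultimately show ?thesis
      using deviation_axis_even[of \<alpha> c k] k that by auto
  next
    case False
    then obtain c where c: "\<alpha> = 2 * c + 1" by (elim oddE)
    moreover from c assms have "c \<le> 1" by auto
    ultimately show ?thesis
      using deviation_axis_odd[of \<alpha> c k] k that by auto
  qed
  moreover have "deviation_ratio 1 m \<alpha> (C_poly 1 m \<alpha>)" if "even (m + int \<alpha>)"
  proof (cases "even \<alpha>")
    case True
    then obtain c where c: "\<alpha> = 2 * c" by (elim evenE)
    moreover from c assms have "c \<le> 1" by auto
    ultimately show ?thesis
      using deviation_next_even[of \<alpha> c k] k that by auto
  next
    case False
    then obtain c where c: "\<alpha> = 2 * c + 1" by (elim oddE)
    moreover from c assms have "c \<le> 1" by auto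
    ultimately show ?thesis
      using deviation_next_odd[of \<alpha> c k] k that by auto
  qed
  ultimately show ?thesis
    unfolding parity using aztec_denominator_dvd C_poly_nonzero by blast
qed

end
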